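(* Let $\mathfrak S$ be an arbitrary finite subset of $\mathbb Z^2$, $K(x,y;t)=1-t\sum_{(i,j)\in\mathfrak S}x^iy^j$, and $B(x;t)$ the generating function of bilateral walks with steps in $\mathfrak S$, with canonical factorization $(B_0(t),B_+(x;t),B_-(\bar x;t))$. Then the generating functions $L(t)$ of loops, $S_0(x;t)$ of bilateral walks on the slit plane, and $S(x,y;t)$ of walks on the slit plane (all with steps in $\mathfrak S$) are $$L(t)=B_0(t),\qquad S_0(x;t)=B_+(x;t),\qquad S(x,y;t)=\frac{1}{K(x,y;t)B_0(t)B_-(\bar x;t)}.$$ The logarithm of each of these series is D-finite.
   Context: A walk with steps in $\mathfrak S$ is a sequence $(w_0,\dots,w_n)$ of points of $\mathbb Z^2$ with $w_0=(0,0)$ and $w_k-w_{k-1}\in\mathfrak S$; $n$ is its length. It is on the slit plane if none of $w_1,\dots,w_n$ lies on $\mathcal H=\{(k,0):k\le0\}$; bilateral if $w_n$ lies on the $x$-axis; a loop if $w_n=(0,0)$ and no $w_k$ lies on $\{(k,0):k<0\}$. The generating function of a set of walks is $\sum_nt^n\sum_{i,j}a_{i,j}(n)x^iy^j$, $a_{i,j}(n)$ being the number of its walks of length $n$ ending at $(i,j)$ ($y$ omitted for walks ending on the $x$-axis, only $t$ kept for loops); $\bar x=1/x$. Canonical factorization: for a power series $B(x;t)$ in $t$ with coefficients in $\mathbb R[x,\bar x]$ and $B(x;0)=1$, there is a unique triple of formal power series in $t$ with $B=B_0(t)B_+(x;t)B_-(\bar x;t)$, where $B_0$ has real coefficients,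 $B_+$ has coefficients in $\mathbb R[x]$, $B_-$ has coefficients in $\mathbb R[\bar x]$, and $B_0(0)=B_+(x;0)=B_-(\bar x;0)=B_+(0;t)=B_-(0;t)=1$. A series is D-finite if its partial derivatives span a finite-dimensional vector space over the field of rational functions in its variables. *)

theory Defs
  imports
    Complex_Main
    "HOL-Library.Poly_Mapping"
    "HOL-Library.Product_Plus"
    "HOL-Computational_Algebra.Computational_Algebra"
begin

text \<open>
  The ring of Laurent polynomials over a ring \<open>'a\<close> is the group algebra \<open>int \<Rightarrow>\<^sub>0 'a\<close>, where
  \<open>Poly_Mapping.single k c\<close> is the monomial with exponent \<open>k\<close> and coefficient \<open>c\<close>.
  Series in \<open>t\<close> with coefficients in \<open>\<real>[x, 1/x]\<close> have type \<open>real laurent fps\<close>, and series in \<open>t\<close>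
  with coefficients in \<open>\<real>[x, 1/x, y, 1/y]\<close> have type \<open>real laurent laurent fps\<close>: the outer
  exponent is that of \<open>y\<close>, the inner one that of \<open>x\<close>.
\<close>

type_synonym 'a laurent = "int \<Rightarrow>\<^sub>0 'a"

definition fps_map :: "('a \<Rightarrow> 'b) \<Rightarrow> 'a fps \<Rightarrow> 'b fps" where
  "fps_map h f = Abs_fps (\<lambda>n. h (fps_nth f n))"

definition laurent_const :: "'a::zero \<Rightarrow> 'a laurent" where
  "laurent_const c = Poly_Mapping.single 0 c"

definition fps_lift :: "'a::zero fps \<Rightarrow> 'a laurent fps" where
  "fps_lift = fps_map laurent_const"


subsection \<open>Walks\<close>

definition walks :: "(int \<times> int) set \<Rightarrow> (int \<times> int) list set" where
  "walks \<SS> = {w. w \<noteq> [] \<and> w ! 0 = (0, 0) \<and> (\<forall>k\<in>{1..<length w}. w ! k - w ! (k - 1) \<in> \<SS>)}"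

definition walk_length :: "(int \<times> int) list \<Rightarrow> nat" where
  "walk_length w = length w - 1"

definition on_slit_plane :: "(int \<times> int) list \<Rightarrow> bool" where
  "on_slit_plane w \<longleftrightarrow> (\<forall>k\<in>{1..walk_length w}. w ! k \<notin> {(i, 0) | i. i \<le> 0})"

definition bilateral :: "(int \<times> int) list \<Rightarrow> bool" where
  "bilateral w \<longleftrightarrow> snd (last w) = 0"

definition is_loop :: "(int \<times> int) list \<Rightarrow> bool" where
  "is_loop w \<longleftrightarrow> last w = (0, 0) \<and> (\<forall>k\<in>{0..walk_length w}. w ! k \<notin> {(i, 0) | i. i < 0})"

definition bilateral_walks :: "(int \<times> int) set \<Rightarrow> (int \<times> int) list set" where
  "bilateral_walks \<SS> = {w \<in> walks \<SS>. bilateral w}"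

definition loops :: "(int \<times> int) set \<Rightarrow> (int \<times> int) list set" where
  "loops \<SS> = {w \<in> walks \<SS>. is_loop w}"

definition slit_walks :: "(int \<times> int) set \<Rightarrow> (int \<times> int) list set" where
  "slit_walks \<SS> = {w \<in> walks \<SS>. on_slit_plane w}"

definition bilateral_slit_walks :: "(int \<times> int) set \<Rightarrow> (int \<times> int) list set" where
  "bilateral_slit_walks \<SS> = {w \<in> walks \<SS>. on_slit_plane w \<and> bilateral w}"


subsection \<open>Generating functions\<close>

definition num_walks :: "(int \<times> int) list set \<Rightarrow> nat \<Rightarrow> int \<times> int \<Rightarrow> nat" where
  "num_walks W n p = card {w \<in> W. walk_length w = n \<and> last w = p}"

definition gf_xy :: "(int \<times> int) list set \<Rightarrow> real laurent laurent fps" where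
  "gf_xy W = Abs_fps (\<lambda>n. \<Sum>(i, j) | num_walks W n (i, j) \<noteq> 0.
     Poly_Mapping.single j (Poly_Mapping.single i (real (num_walks W n (i, j)))))"

text \<open>The next two are meant for walks ending on the \<open>x\<close>-axis and at the origin, respectively.\<close>

definition gf_x :: "(int \<times> int) list set \<Rightarrow> real laurent fps" where
  "gf_x W = Abs_fps (\<lambda>n. \<Sum>i | num_walks W n (i, 0) \<noteq> 0.
     Poly_Mapping.single i (real (num_walks W n (i, 0))))"

definition gf_t :: "(int \<times> int) list set \<Rightarrow> real fps" where
  "gf_t W = Abs_fps (\<lambda>n. real (num_walks W n (0, 0)))"

definition walk_kernel :: "(int \<times> int) set \<Rightarrow> real laurent laurent fps" where
  "walk_kernel \<SS> = 1 - fps_X * fps_const (\<Sum>(i, j)\<in>\<SS>. Poly_Mapping.single j (Poly_Mapping.single i 1))"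


subsection \<open>Canonical factorization\<close>

text \<open>
  The factor \<open>Bm\<close> is the series \<open>B\<^sub>-(1/x; t)\<close>, written as a series in \<open>x\<close> and \<open>t\<close> with nonpositive
  exponents of \<open>x\<close>. Hence both \<open>B\<^sub>+(0; t)\<close> and \<open>B\<^sub>-(0; t)\<close> are obtained by extracting the coefficient
  of \<open>x\<^sup>0\<close>.
\<close>

definition canonical_factorization ::
    "real laurent fps \<Rightarrow> real fps \<Rightarrow> real laurent fps \<Rightarrow> real laurent fps \<Rightarrow> bool" where
  "canonical_factorization B B0 Bp Bm \<longleftrightarrow>
     B = fps_lift B0 * Bp * Bm \<and>
     (\<forall>n. Poly_Mapping.keys (fps_nth Bp n) \<subseteq> {0..}) \<and>
     (\<forall>n. Poly_Mapping.keys (fps_nth Bm n) \<subseteq> {..0}) \<and>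
     fps_nth B0 0 = 1 \<and> fps_nth Bp 0 = 1 \<and> fps_nth Bm 0 = 1 \<and>
     fps_map (\<lambda>p. Poly_Mapping.lookup p 0) Bp = 1 \<and>
     fps_map (\<lambda>p. Poly_Mapping.lookup p 0) Bm = 1"


subsection \<open>Logarithm\<close>

text \<open>
  For a series \<open>f\<close> with constant coefficient 1, this is the sum over \<open>n \<ge> 1\<close> of
  \<open>(-1)^(n-1) (f - 1)^n / n\<close>. The argument \<open>\<iota>\<close> embeds the reals into the ring of coefficients.
\<close>

definition fps_log :: "(real \<Rightarrow> 'a::comm_ring_1) \<Rightarrow> 'a fps \<Rightarrow> 'a fps" where
  "fps_log \<iota> f = fps_compose (fps_map \<iota> (fps_ln 1)) (f - 1)"


subsection \<open>D-finite series\<close>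

definition laurent_deriv :: "'a::comm_ring_1 laurent \<Rightarrow> 'a laurent" where
  "laurent_deriv p = (\<Sum>k\<in>Poly_Mapping.keys p.
     Poly_Mapping.single (k - 1) (of_int k * Poly_Mapping.lookup p k))"

inductive_set iterated_derivs :: "('b \<Rightarrow> 'b) set \<Rightarrow> 'b \<Rightarrow> 'b set" for \<Delta> f where
  base: "f \<in> iterated_derivs \<Delta> f"
| step: "g \<in> iterated_derivs \<Delta> f \<Longrightarrow> \<delta> \<in> \<Delta> \<Longrightarrow> \<delta> g \<in> iterated_derivs \<Delta> f"

text \<open>
  For \<open>'a\<close> one of \<open>real\<close>, \<open>real laurent\<close>, \<open>real laurent laurent\<close>, the field \<open>'a poly fract\<close> is
  \<open>\<real>(t)\<close>, \<open>\<real>(x, t)\<close>, \<open>\<real>(x, y, t)\<close>, as a Laurent polynomial is a polynomial divided by a monomial.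
  It acts on the fraction field of the ring of series \<open>'a fps\<close>.
\<close>

definition ratfun_embed :: "'a::idom poly fract \<Rightarrow> 'a fps fract" where
  "ratfun_embed r = (THE u. \<exists>p q. q \<noteq> 0 \<and> r = Fract p q \<and> u = Fract (fps_of_poly p) (fps_of_poly q))"

lemma fps_of_poly_nonzero: "q \<noteq> 0 \<Longrightarrow> fps_of_poly q \<noteq> 0"
  using fps_of_poly_eq_iff[of q 0] by simp

lemma ratfun_embed_Fract:
  fixes p q :: "'a::idom poly"
  assumes "q \<noteq> 0"
  shows "ratfun_embed (Fract p q) = Fract (fps_of_poly p) (fps_of_poly q)"
  unfolding ratfun_embed_def
proof (rule the_equality)
  fix u
  assume "\<exists>p' q'. q' \<noteq> 0 \<and> Fract p q = Fract p' q' \<and> u = Fract (fps_of_poly p') (fps_of_poly q')"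
  then obtain p' q' where *: "q' \<noteq> 0" "Fract p q = Fract p' q'"
      "u = Fract (fps_of_poly p') (fps_of_poly q')"
    by blast
  have "p * q' = p' * q"
    using * assms by (simp add: eq_fract)
  then have "fps_of_poly p * fps_of_poly q' = fps_of_poly p' * fps_of_poly q"
    by (metis fps_of_poly_mult)
  then show "u = Fract (fps_of_poly p) (fps_of_poly q)"
    using * assms by (simp add: eq_fract fps_of_poly_nonzero)
qed (use assms in blast)

lemma ratfun_embed_1: "ratfun_embed 1 = 1"
  using ratfun_embed_Fract[of 1 1] by (simp add: One_fract_def)

lemma ratfun_embed_add: "ratfun_embed (a + b) = ratfun_embed a + ratfun_embed b"
  by (cases a; cases b)
    (simp add: ratfun_embed_Fract fps_of_poly_nonzero fps_of_poly_mult fps_of_poly_add)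

lemma ratfun_embed_mult: "ratfun_embed (a * b) = ratfun_embed a * ratfun_embed b"
  by (cases a; cases b)
    (simp add: ratfun_embed_Fract fps_of_poly_nonzero fps_of_poly_mult)

definition ratfun_scale :: "'a::idom poly fract \<Rightarrow> 'a fps fract \<Rightarrow> 'a fps fract" where
  "ratfun_scale r u = ratfun_embed r * u"

global_interpretation ratfun: vector_space ratfun_scale
  by unfold_locales
    (simp_all add: ratfun_scale_def ratfun_embed_1 ratfun_embed_add ratfun_embed_mult algebra_simps)

text \<open>The set \<open>\<Delta>\<close> consists of the partial derivations with respect to each of the variables.\<close>

definition D_finite :: "('a fps \<Rightarrow> 'a fps) set \<Rightarrow> 'a::idom fps \<Rightarrow> bool" where
  "D_finite \<Delta> f \<longleftrightarrow>
     (\<exists>G. finite G \<and> ratfun.span ((\<lambda>g. Fract g 1) ` iterated_derivs \<Delta> f) = ratfun.span G)"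

definition D_finite_t :: "real fps \<Rightarrow> bool" where
  "D_finite_t = D_finite {fps_deriv}"

definition D_finite_xt :: "real laurent fps \<Rightarrow> bool" where
  "D_finite_xt = D_finite {fps_deriv, fps_map laurent_deriv}"

definition D_finite_xyt :: "real laurent laurent fps \<Rightarrow> bool" where
  "D_finite_xyt =
     D_finite {fps_deriv, fps_map laurent_deriv, fps_map (Poly_Mapping.map laurent_deriv)}"

end

theory Submission
  imports Defs "HOL-Algebra.Algebraic_Closure_Type"
begin

text \<open>
  Let \<open>H\<close> be a subset of the \<open>x\<close>-axis, and let \<open>F\<close> count the walks that avoid \<open>H\<close> after their start.
  Appending a step gives \<open>F K = 1 - T\<close>, where \<open>T\<close> is supported on \<open>H\<close>, so \<open>F = (1 - T)/K\<close>, and on the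
  axis \<open>F\<^sub>0 = (1 - T) B\<close>. For \<open>H\<close> the closed or the open half line, comparing the signs of the exponents
  of \<open>x\<close> with \<open>B = B\<^sub>0 B\<^sub>+ B\<^sub>-\<close> yields the three formulas.

  For D-finiteness, write \<open>K = K\<^sub>- K\<^sub>+\<close> with factors in nonpositive and nonnegative powers of \<open>y\<close>.
  Since \<open>1/K = 1 - t K'/K\<close>, the series \<open>B\<close> is \<open>1 - t k'/k\<close>, where \<open>k\<close> is the constant coefficient of
  \<open>K\<^sub>+\<close>. Up to a factor in \<open>\<real>(x, t)\<close>, it is a product of roots of a polynomial over \<open>\<real>(x, t)\<close>,
  hence algebraic. So the derivatives of \<open>log B\<close> lie in a finite extension of \<open>\<real>(x, t)\<close>. By
  Lipshitz' counting argument the coefficients of \<open>log B\<close> in \<open>x\<close> are D-finite in \<open>t\<close>. Taking the part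
  with nonnegative exponents of \<open>x\<close> commutes with differential operators up to finitely many of
  these coefficients. The parts of \<open>log B\<close> are the logarithms of \<open>B\<^sub>0\<close>, \<open>B\<^sub>+\<close> and \<open>B\<^sub>-\<close>.
\<close>

subsection \<open>Linear algebra\<close>

text \<open>Logarithms enter because the canonical factorization is multiplicative, whereas taking
  the part with nonnegative exponents is linear; exponentiating a D-finite series, on the other
  hand, can destroy D-finiteness. The logarithm turns the factorization into a splitting by the sign
  of the exponent of \<open>x\<close>. The obstacle is that this splitting is not linear over
  rational functions: multiplying by a power of \<open>x\<close> pushes finitely many coefficients
  across the boundary. Those coefficients are series in \<open>t\<close> alone, and a system of
  differential equations for the nonnegative part closes up only once they satisfy linear equations
  of their own. For algebraicity, no study of which roots are small is required. The factorization
  in powers of \<open>y\<close> has already selected them, and since its nonpositive factor becomes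
  monic after a shift, the other factor inherits the leading coefficient of the kernel. D-finiteness
  itself is handled through finite sets of series closed under the derivations modulo rational
  functions, a notion stable under differences and under adjoining variables.\<close>

lemma homogeneous_system_nontrivial:
  fixes a :: "'i \<Rightarrow> 'j \<Rightarrow> 'k::field"
  assumes "finite J" "finite I" "card J < card I"
  shows "\<exists>c. (\<exists>i\<in>I. c i \<noteq> 0) \<and> (\<forall>j\<in>J. (\<Sum>i\<in>I. c i * a i j) = 0)"
  using assms
proof (induction J arbitrary: I a rule: finite_induct)
  case empty
  then have "I \<noteq> {}" by auto
  then show ?case by (intro exI[of _ "\<lambda>_. 1"]) auto
next
  case (insert j0 J)
  show ?case
  proof (cases "\<forall>i\<in>I. a i j0 = 0")
    case True
    have "card J < card I"
      using insert by simp
    from insert.IH[OF insert.prems(1) this, of a] True show ?thesis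
      by auto
  next
    case False
    then obtain i0 where i0: "i0 \<in> I" "a i0 j0 \<noteq> 0" by blast
    let ?I = "I - {i0}"
    let ?b = "\<lambda>i j. a i j - a i j0 / a i0 j0 * a i0 j"
    have "card J < card ?I"
      using insert i0 by simp
    then obtain c where c: "\<exists>i\<in>?I. c i \<noteq> 0" "\<forall>j\<in>J. (\<Sum>i\<in>?I. c i * ?b i j) = 0"
      using insert.IH[of ?I ?b] insert.prems by auto
    \<comment> \<open>Gaussian elimination: the pivot unknown \<open>i0\<close> is recovered from
      equation \<open>j0\<close> once the reduced system is solved.\<close>
    define s where "s = - (\<Sum>i\<in>?I. c i * (a i j0 / a i0 j0))"
    define d where "d = c(i0 := s)"
    have split: "(\<Sum>i\<in>I. d i * a i j) = s * a i0 j + (\<Sum>i\<in>?I. c i * a i j)" for j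
      by (subst sum.remove[of I i0]) (use insert.prems i0 in \<open>auto simp: d_def intro!: sum.cong\<close>)
    have sv: "s * x = - (\<Sum>i\<in>?I. c i * (a i j0 / a i0 j0 * x))" for x
      by (simp add: s_def sum_distrib_right mult.assoc)
    have "(\<Sum>i\<in>I. d i * a i j) = 0" if "j \<in> insert j0 J" for j
    proof (cases "j = j0")
      case True
      then show ?thesis
        using i0 by (simp add: split sv)
    next
      case False
      then have "(\<Sum>i\<in>?I. c i * ?b i j) = 0" using c that by blast
      then show ?thesis
        by (simp add: split sv right_diff_distrib sum_subtractf)
    qed
    moreover have "\<exists>i\<in>I. d i \<noteq> 0"
      using c(1) by (auto simp: d_def)
    ultimately show ?thesis by blast
  qed
qed

text \<open>Used for two embeddings of the rational functions: into the fraction field of series,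
  and into an algebraic closure of that field. An explicit map lets one theory of spans serve
  both.\<close>

locale field_embedding =
  fixes emb :: "'k::field \<Rightarrow> 'l::field"
  assumes emb_add: "emb (a + b) = emb a + emb b"
    and emb_mult: "emb (a * b) = emb a * emb b"
    and emb_1: "emb 1 = 1"
begin

sublocale vs: vector_space "\<lambda>c u. emb c * u"
  by unfold_locales (simp_all add: emb_add emb_mult emb_1 algebra_simps)

lemma emb_0: "emb 0 = 0"
  using emb_add[of 0 0] by (metis add.right_neutral add_left_cancel)

lemma emb_minus: "emb (- a) = - emb a"
  using emb_add[of "- a" a] by (simp add: emb_0 eq_neg_iff_add_eq_0)

lemma emb_sum: "emb (sum f A) = (\<Sum>i\<in>A. emb (f i))"
  by (induction A rule: infinite_finite_induct) (simp_all add: emb_0 emb_add)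

lemma emb_eq_0_iff: "emb a = 0 \<longleftrightarrow> a = 0"
proof
  assume "emb a = 0"
  then show "a = 0"
    using emb_mult[of a "inverse a"] emb_1 by (cases "a = 0") auto
qed (simp add: emb_0)

lemma emb_inverse: "emb (inverse a) = inverse (emb a)"
proof (cases "a = 0")
  case False
  then have "emb a * emb (inverse a) = 1"
    by (simp add: emb_mult[symmetric] emb_1)
  then show ?thesis
    by (metis inverse_unique)
qed (simp add: emb_0)

definition algebraic :: "'l \<Rightarrow> bool" where
  "algebraic u \<longleftrightarrow> (\<exists>n a. (\<exists>i\<le>n. a i \<noteq> 0) \<and> (\<Sum>i\<le>n. emb (a i) * u ^ i) = 0)"

lemma powers_dependent:
  assumes "finite G" "\<And>i::nat. u ^ i \<in> vs.span G"
  shows "algebraic u"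
proof -
  have "\<forall>i. \<exists>c. u ^ i = (\<Sum>g\<in>G. emb (c g) * g)"
    using assms(2) unfolding vs.span_finite[OF assms(1)] by blast
  then obtain c where c: "\<And>i. u ^ i = (\<Sum>g\<in>G. emb (c i g) * g)"
    by metis
  \<comment> \<open>There are \<open>card G + 1\<close> powers but only \<open>card G\<close>
    coordinates.\<close>
  obtain a where a: "\<exists>i\<in>{..card G}. a i \<noteq> 0" "\<forall>g\<in>G. (\<Sum>i\<in>{..card G}. a i * c i g) = 0"
    using homogeneous_system_nontrivial[OF assms(1), of "{..card G}" c] by force
  have "(\<Sum>i\<le>card G. emb (a i) * u ^ i) = (\<Sum>i\<le>card G. \<Sum>g\<in>G. emb (a i * c i g) * g)"
    unfolding c sum_distrib_left emb_mult mult.assoc ..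
  also have "\<dots> = (\<Sum>g\<in>G. emb (\<Sum>i\<le>card G. a i * c i g) * g)"
    by (subst sum.swap) (simp add: emb_sum sum_distrib_right)
  also have "\<dots> = 0"
    using a(2) by (simp add: emb_0)
  finally show ?thesis
    unfolding algebraic_def using a(1) by blast
qed

lemma span_mult:
  assumes "x \<in> vs.span A" "y \<in> vs.span B" "\<And>a b. a \<in> A \<Longrightarrow> b \<in> B \<Longrightarrow> a * b \<in> vs.span C"
  shows "x * y \<in> vs.span C"
proof -
  have *: "a * y \<in> vs.span C" if "a \<in> A" for a
    using assms(2)
  proof (induction rule: vs.span_induct_alt)
    case base
    then show ?case by (simp add: vs.span_zero)
  next
    case (step c z y)
    have "a * (emb c * z + y) = emb c * (a * z) + a * y"
      by (simp add: algebra_simps)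
    then show ?case
      using step assms(3)[OF that] by (simp add: vs.span_add vs.span_scale)
  qed
  show ?thesis
    using assms(1)
  proof (induction rule: vs.span_induct_alt)
    case base
    then show ?case by (simp add: vs.span_zero)
  next
    case (step c z x)
    have "(emb c * z + x) * y = emb c * (z * y) + x * y"
      by (simp add: algebra_simps)
    then show ?case
      using step *[of z] by (simp add: vs.span_add vs.span_scale)
  qed
qed

text \<open>Integrality criterion without determinants: a finite-dimensional space that contains 1
  and is stable under multiplication by \<open>u\<close> contains every power of
  \<open>u\<close>.\<close>

lemma algebraicI:
  assumes "finite G" "1 \<in> vs.span G" "\<And>g. g \<in> G \<Longrightarrow> u * g \<in> vs.span G"
  shows "algebraic u"
proof (rule powers_dependent)
  show "u ^ i \<in> vs.span G" for i
  proof (induction i)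
    case (Suc i)
    have "u * u ^ i \<in> vs.span G"
      by (rule span_mult[of u "{u}" "u ^ i" G]) (use Suc assms(3) in \<open>auto intro: vs.span_base\<close>)
    then show ?case by simp
  qed (use assms in simp)
qed (use assms in simp)

text \<open>A relation is cut at its highest nonzero coefficient, which is then inverted. Degree 0
  is excluded because nonzero scalars stay nonzero.\<close>

lemma algebraicE:
  assumes "algebraic u"
  obtains n where "n > 0" "u ^ n \<in> vs.span ((\<lambda>i. u ^ i) ` {..<n})"
proof -
  from assms obtain n a where a: "\<exists>i\<le>n. a i \<noteq> 0" "(\<Sum>i\<le>n. emb (a i) * u ^ i) = 0"
    unfolding algebraic_def by blast
  define N where "N = Max {i. i \<le> n \<and> a i \<noteq> 0}"
  have N: "N \<le> n" "a N \<noteq> 0" and Nmax: "\<And>i. i \<le> n \<Longrightarrow> a i \<noteq> 0 \<Longrightarrow> i \<le> N"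
    using Max_in[of "{i. i \<le> n \<and> a i \<noteq> 0}"] a(1) by (auto simp: N_def)
  have "(\<Sum>i\<le>n. emb (a i) * u ^ i) = (\<Sum>i\<le>N. emb (a i) * u ^ i)"
    by (rule sum.mono_neutral_right) (use N Nmax in \<open>force simp: emb_0\<close>)+
  also have "\<dots> = (\<Sum>i<N. emb (a i) * u ^ i) + emb (a N) * u ^ N"
    by (simp add: lessThan_Suc_atMost[symmetric])
  finally have eq: "emb (a N) * u ^ N = - (\<Sum>i<N. emb (a i) * u ^ i)"
    using a(2) by (simp add: eq_neg_iff_add_eq_0 add.commute)
  show ?thesis
  proof (rule that)
    show "N > 0"
    proof (rule ccontr)
      assume "\<not> N > 0"
      then show False using eq N by (simp add: emb_eq_0_iff)
    qed
    have "u ^ N = emb (inverse (a N)) * (emb (a N) * u ^ N)"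
      using N by (simp add: emb_inverse emb_eq_0_iff)
    also have "\<dots> \<in> vs.span ((\<lambda>i. u ^ i) ` {..<N})"
      unfolding eq
      by (intro vs.span_scale vs.span_neg vs.span_sum) (auto intro: vs.span_base)
    finally show "u ^ N \<in> vs.span ((\<lambda>i. u ^ i) ` {..<N})" .
  qed
qed

lemma algebraic_mult:
  assumes "algebraic u" "algebraic v"
  shows "algebraic (u * v)"
proof -
  obtain m where m: "m > 0" "u ^ m \<in> vs.span ((\<lambda>i. u ^ i) ` {..<m})"
    using assms(1) by (rule algebraicE)
  obtain n where n: "n > 0" "v ^ n \<in> vs.span ((\<lambda>i. v ^ i) ` {..<n})"
    using assms(2) by (rule algebraicE)
  have u: "u * u ^ i \<in> vs.span ((\<lambda>i. u ^ i) ` {..<m})" if "i < m" for i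
  proof (cases "Suc i = m")
    case True
    then show ?thesis using m(2) by auto
  next
    case False
    then have "u ^ Suc i \<in> (\<lambda>i. u ^ i) ` {..<m}" using that by (intro imageI) simp
    then show ?thesis by (auto intro: vs.span_base)
  qed
  have v: "v * v ^ i \<in> vs.span ((\<lambda>i. v ^ i) ` {..<n})" if "i < n" for i
  proof (cases "Suc i = n")
    case True
    then show ?thesis using n(2) by auto
  next
    case False
    then have "v ^ Suc i \<in> (\<lambda>i. v ^ i) ` {..<n}" using that by (intro imageI) simp
    then show ?thesis by (auto intro: vs.span_base)
  qed
  \<comment> \<open>The monomials of bidegree below \<open>(m, n)\<close> span a space stable under
    both \<open>u\<close> and \<open>v\<close>, hence under the product.\<close>
  define G where "G = (\<lambda>(i, j). u ^ i * v ^ j) ` ({..<m} \<times> {..<n})"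
  have G: "u ^ i * v ^ j \<in> vs.span G" if "i < m" "j < n" for i j
    unfolding G_def by (rule vs.span_base) (use that in force)
  show ?thesis
  proof (rule algebraicI[of G])
    show "finite G" by (simp add: G_def)
    show "1 \<in> vs.span G" using G[of 0 0] m n by simp
    fix g assume "g \<in> G"
    then obtain i j where ij: "i < m" "j < n" "g = u ^ i * v ^ j"
      by (auto simp: G_def)
    have "(u * u ^ i) * (v * v ^ j) \<in> vs.span G"
      by (rule span_mult[OF u[OF ij(1)] v[OF ij(2)]]) (use G in auto)
    then show "u * v * g \<in> vs.span G"
      by (simp add: ij mult_ac)
  qed
qed

lemma algebraic_emb: "algebraic (emb a)"
  unfolding algebraic_def
  by (intro exI[of _ 1] exI[of _ "\<lambda>i. if i = 0 then - a else 1"]) (auto simp: emb_minus emb_1)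

lemma algebraic_uminus:
  assumes "algebraic u"
  shows "algebraic (- u)"
  using algebraic_mult[OF algebraic_emb[of "- 1"] assms] by (simp add: emb_minus emb_1)

lemma algebraic_prod_mset:
  assumes "\<And>u. u \<in># M \<Longrightarrow> algebraic u"
  shows "algebraic (prod_mset M)"
  using assms
proof (induction M)
  case empty
  then show ?case using algebraic_emb[of 1] by (simp add: emb_1)
qed (auto intro: algebraic_mult)

text \<open>A domain of finite dimension over a field is a field. In a relation among the powers of
  \<open>h\<close>, cancel the power at the lowest nonzero coefficient: a nonzero scalar becomes a
  multiple of \<open>h\<close> with cofactor in the span.\<close>

lemma inverse_in_finite_subalgebra:
  assumes "finite G" "1 \<in> vs.span G"
    and mult: "\<And>g h. g \<in> G \<Longrightarrow> h \<in> G \<Longrightarrow> g * h \<in> vs.span G"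
    and h: "h \<in> vs.span G"
  shows "inverse h \<in> vs.span G"
proof (cases "h = 0")
  case True
  then show ?thesis by (simp add: vs.span_zero)
next
  case False
  have pow: "h ^ i \<in> vs.span G" for i
    by (induction i) (auto intro: span_mult[OF h _ mult] assms)
  obtain n a where a: "\<exists>i\<le>n. a i \<noteq> 0" "(\<Sum>i\<le>n. emb (a i) * h ^ i) = 0"
    using powers_dependent[OF assms(1) pow] unfolding algebraic_def by blast
  define N where "N = (LEAST i. i \<le> n \<and> a i \<noteq> 0)"
  have N: "N \<le> n" "a N \<noteq> 0"
    using LeastI_ex[of "\<lambda>i. i \<le> n \<and> a i \<noteq> 0"] a(1) by (auto simp: N_def)
  have less: "a i = 0" if "i < N" for i
    using not_less_Least[of i "\<lambda>i. i \<le> n \<and> a i \<noteq> 0"] that N by (auto simp: N_def)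
  have "(\<Sum>i\<le>n. emb (a i) * h ^ i) = (\<Sum>i\<in>insert N {Suc N..n}. emb (a i) * h ^ i)"
    by (rule sum.mono_neutral_right) (use N less in \<open>auto simp: emb_0 not_less_eq_eq not_le le_less\<close>)
  then have eq: "emb (a N) * h ^ N + (\<Sum>i\<in>{Suc N..n}. emb (a i) * h ^ i) = 0"
    using a(2) by simp
  define s where "s = (\<Sum>i\<in>{Suc N..n}. emb (a i) * h ^ (i - Suc N))"
  have "(\<Sum>i\<in>{Suc N..n}. emb (a i) * h ^ i) = h ^ N * (h * s)"
    unfolding s_def sum_distrib_left
  proof (rule sum.cong)
    fix i assume "i \<in> {Suc N..n}"
    then have "h ^ i = h ^ N * (h * h ^ (i - Suc N))"
      by (metis atLeastAtMost_iff le_add_diff_inverse mult.assoc power_Suc2 power_add)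
    then show "emb (a i) * h ^ i = h ^ N * (h * (emb (a i) * h ^ (i - Suc N)))"
      by (simp add: mult_ac)
  qed simp
  then have "h ^ N * (emb (a N) + h * s) = 0"
    using eq by (simp add: algebra_simps)
  then have "h * s = - emb (a N)"
    using False by (simp add: eq_neg_iff_add_eq_0 add.commute)
  then have "emb (- inverse (a N)) * (h * s) = 1"
    using N by (simp add: emb_minus emb_inverse emb_eq_0_iff)
  then have "h * (emb (- inverse (a N)) * s) = 1"
    by (simp add: mult_ac)
  then have "inverse h = emb (- inverse (a N)) * s"
    by (rule inverse_unique)
  also have "\<dots> \<in> vs.span G"
    unfolding s_def by (intro vs.span_scale vs.span_sum pow)
  finally show ?thesis .
qed

end


subsection \<open>Rational spans and derivations\<close>

interpretation rf: field_embedding "ratfun_embed :: 'a::idom poly fract \<Rightarrow> 'a fps fract"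
  by unfold_locales (rule ratfun_embed_add ratfun_embed_mult ratfun_embed_1)+

text \<open>The trace on the series ring of a span in the fraction field. Derivations and
  coefficient extraction are maps on series only, so membership is kept at that level.\<close>

definition rat_span :: "'a::idom fps set \<Rightarrow> 'a fps set" where
  "rat_span G = {g. to_fract g \<in> ratfun.span (to_fract ` G)}"

lemma rf_span: "rf.vs.span = ratfun.span"
  by (simp add: ratfun_scale_def[abs_def])

lemma rat_span_base: "g \<in> G \<Longrightarrow> g \<in> rat_span G"
  by (auto simp: rat_span_def intro: ratfun.span_base)

lemma rat_span_0 [simp]: "0 \<in> rat_span G"
  by (simp add: rat_span_def ratfun.span_zero)

lemma rat_span_add: "f \<in> rat_span G \<Longrightarrow> g \<in> rat_span G \<Longrightarrow> f + g \<in> rat_span G"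
  by (simp add: rat_span_def ratfun.span_add)

lemma rat_span_diff: "f \<in> rat_span G \<Longrightarrow> g \<in> rat_span G \<Longrightarrow> f - g \<in> rat_span G"
  by (simp add: rat_span_def ratfun.span_diff)

lemma rat_span_uminus: "f \<in> rat_span G \<Longrightarrow> - f \<in> rat_span G"
  by (simp add: rat_span_def ratfun.span_neg)

lemma rat_span_sum: "(\<And>i. i \<in> I \<Longrightarrow> f i \<in> rat_span G) \<Longrightarrow> sum f I \<in> rat_span G"
  by (induction I rule: infinite_finite_induct) (simp_all add: rat_span_add)

lemma to_fract_poly: "to_fract (fps_of_poly p) = ratfun_embed (to_fract p)"
  by (simp add: ratfun_embed_Fract to_fract_def)

lemma rat_span_poly_mult: "g \<in> rat_span G \<Longrightarrow> fps_of_poly p * g \<in> rat_span G"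
  using ratfun.span_scale[of "to_fract g" "to_fract ` G" "to_fract p"]
  by (simp add: rat_span_def ratfun_scale_def to_fract_poly)

text \<open>Division by a nonzero polynomial is scaling by a rational function. This is what allows
  identities to be treated after clearing denominators.\<close>

lemma rat_span_saturated:
  assumes "q \<noteq> 0" "fps_of_poly q * g \<in> rat_span G"
  shows "g \<in> rat_span G"
proof -
  have "ratfun_scale (inverse (to_fract q)) (to_fract (fps_of_poly q * g)) \<in> ratfun.span (to_fract ` G)"
    using assms(2) by (intro ratfun.span_scale) (simp add: rat_span_def)
  also have "ratfun_scale (inverse (to_fract q)) (to_fract (fps_of_poly q * g)) = to_fract g"
    using assms(1) by (simp add: ratfun_scale_def to_fract_poly rf.emb_inverse rf.emb_eq_0_iff
        del: inverse_fract mult_fract)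
  finally show ?thesis by (simp add: rat_span_def)
qed

lemma rat_span_mono: "G \<subseteq> H \<Longrightarrow> rat_span G \<subseteq> rat_span H"
  unfolding rat_span_def using ratfun.span_mono[of "to_fract ` G" "to_fract ` H"] by blast

lemma common_denominator:
  fixes c :: "'v \<Rightarrow> 'a::idom fract"
  assumes "finite S"
  shows "\<exists>d p. d \<noteq> 0 \<and> (\<forall>v\<in>S. to_fract d * c v = to_fract (p v))"
  using assms
proof (induction S rule: finite_induct)
  case empty
  then show ?case by (intro exI[of _ 1]) auto
next
  case (insert x S)
  then obtain d p where d: "d \<noteq> 0" "\<forall>v\<in>S. to_fract d * c v = to_fract (p v)" by blast
  obtain a b where ab: "c x = Fract a b" "b \<noteq> 0" by (cases "c x")
  have cx: "to_fract b * c x = to_fract a"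
    using ab by (simp add: eq_fract to_fract_def)
  have "to_fract (b * d) * c v = to_fract (if v = x then d * a else b * p v)" if "v \<in> insert x S" for v
  proof (cases "v = x")
    case True
    have "to_fract (b * d) * c x = to_fract d * (to_fract b * c x)"
      by (simp only: to_fract_mult mult_ac)
    then show ?thesis using True cx by simp
  next
    case False
    then have "to_fract d * c v = to_fract (p v)" using that d by auto
    then have "to_fract (b * d) * c v = to_fract b * to_fract (p v)"
      by (simp only: to_fract_mult mult_ac)
    then show ?thesis using False by simp
  qed
  moreover have "b * d \<noteq> 0" using ab d by simp
  ultimately show ?case
    by (intro exI[of _ "b * d"] exI[of _ "\<lambda>v. if v = x then d * a else b * p v"] conjI ballI)
qed

text \<open>Turns membership into an identity between series with polynomial coefficients, a form to
  which derivations, lifting and nonnegative parts can be applied.\<close>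

lemma rat_spanE:
  assumes "g \<in> rat_span G" "finite G"
  obtains q p where "q \<noteq> 0" "fps_of_poly q * g = (\<Sum>h\<in>G. fps_of_poly (p h) * h)"
proof -
  have inj: "inj_on to_fract G" by (auto simp: inj_on_def)
  have "to_fract g \<in> ratfun.span (to_fract ` G)"
    using assms by (simp add: rat_span_def)
  then obtain u where "to_fract g = (\<Sum>v\<in>to_fract ` G. ratfun_scale (u v) v)"
    using assms(2) by (auto simp: ratfun.span_finite)
  then have u: "to_fract g = (\<Sum>h\<in>G. ratfun_embed (u (to_fract h)) * to_fract h)"
    by (simp add: sum.reindex[OF inj] ratfun_scale_def)
  obtain d p where d: "d \<noteq> 0" "\<forall>h\<in>G. to_fract d * u (to_fract h) = to_fract (p h)"
    using common_denominator[OF assms(2), of "\<lambda>h. u (to_fract h)"] by blast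
  have *: "ratfun_embed (to_fract d) * (ratfun_embed (u (to_fract h)) * to_fract h)
      = to_fract (fps_of_poly (p h) * h)" if "h \<in> G" for h
    using d(2) that by (metis mult.assoc ratfun_embed_mult to_fract_mult to_fract_poly)
  have "to_fract (fps_of_poly d * g) = ratfun_embed (to_fract d) * to_fract g"
    by (simp add: to_fract_poly)
  also have "\<dots> = (\<Sum>h\<in>G. to_fract (fps_of_poly (p h) * h))"
    unfolding u sum_distrib_left by (rule sum.cong) (use * in auto)
  finally have "to_fract (fps_of_poly d * g) = (\<Sum>h\<in>G. to_fract (fps_of_poly (p h) * h))" .
  then have "to_fract (fps_of_poly d * g) = to_fract (\<Sum>h\<in>G. fps_of_poly (p h) * h)"
    by (simp only: to_fract_sum)
  then have "fps_of_poly d * g = (\<Sum>h\<in>G. fps_of_poly (p h) * h)"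
    by (simp only: to_fract_eq_iff)
  then show ?thesis using d(1) that by blast
qed

lemma rat_span_mult:
  assumes "f \<in> rat_span A" "g \<in> rat_span B"
    and "\<And>a b. a \<in> A \<Longrightarrow> b \<in> B \<Longrightarrow> a * b \<in> rat_span C"
  shows "f * g \<in> rat_span C"
proof -
  have *: "u * v \<in> rf.vs.span (to_fract ` C)" if "u \<in> to_fract ` A" "v \<in> to_fract ` B" for u v
    using that assms(3) unfolding rat_span_def rf_span by force
  have "to_fract f * to_fract g \<in> rf.vs.span (to_fract ` C)"
    by (rule rf.span_mult[OF _ _ *]) (use assms(1,2) in \<open>simp_all add: rat_span_def rf_span\<close>)
  then show ?thesis by (simp add: rat_span_def rf_span)
qed

text \<open>Multiplicative closure makes the span in the fraction field a field, so it contains the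
  inverse of \<open>h\<close>. The quotient \<open>f\<close> is a series from the outset, so nothing
  is lost on the way back.\<close>

lemma rat_span_exact_division:
  assumes "finite G" "1 \<in> rat_span G"
    and mult: "\<And>g h. g \<in> G \<Longrightarrow> h \<in> G \<Longrightarrow> g * h \<in> rat_span G"
    and h: "h \<in> rat_span G" "h \<noteq> 0" and hf: "h * f \<in> rat_span G"
  shows "f \<in> rat_span G"
proof -
  have mult': "a * b \<in> rf.vs.span (to_fract ` G)" if "a \<in> to_fract ` G" "b \<in> to_fract ` G" for a b
    using that mult unfolding rat_span_def rf_span by force
  have "1 \<in> rf.vs.span (to_fract ` G)" and "to_fract h \<in> rf.vs.span (to_fract ` G)"
    using assms(2) h(1) by (simp_all add: rat_span_def rf_span)
  then have "inverse (to_fract h) \<in> rf.vs.span (to_fract ` G)"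
    using rf.inverse_in_finite_subalgebra[OF _ _ mult'] assms(1) by blast
  then have "inverse (to_fract h) * to_fract (h * f) \<in> rf.vs.span (to_fract ` G)"
    by (rule rf.span_mult[OF _ _ mult']) (use hf in \<open>simp_all add: rat_span_def rf_span\<close>)
  also have "inverse (to_fract h) * to_fract (h * f) = to_fract f"
    using h(2) by (simp del: inverse_fract mult_fract)
  finally show ?thesis by (simp add: rat_span_def rf_span)
qed

section \<open>Derivations on series and their action on rational spans\<close>

definition derivation :: "('a::comm_ring_1 \<Rightarrow> 'a) \<Rightarrow> bool" where
  "derivation \<delta> \<longleftrightarrow> (\<forall>a b. \<delta> (a + b) = \<delta> a + \<delta> b) \<and> (\<forall>a b. \<delta> (a * b) = \<delta> a * b + a * \<delta> b)"

lemma derivation_add: "derivation \<delta> \<Longrightarrow> \<delta> (a + b) = \<delta> a + \<delta> b"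
  and derivation_mult: "derivation \<delta> \<Longrightarrow> \<delta> (a * b) = \<delta> a * b + a * \<delta> b"
  by (auto simp: derivation_def)

lemma derivation_0: "derivation \<delta> \<Longrightarrow> \<delta> 0 = 0"
  using derivation_add[of \<delta> 0 0] by simp

lemma derivation_1: "derivation \<delta> \<Longrightarrow> \<delta> 1 = 0"
  using derivation_mult[of \<delta> 1 1] by simp

lemma derivation_sum: "derivation \<delta> \<Longrightarrow> \<delta> (sum f A) = (\<Sum>i\<in>A. \<delta> (f i))"
  by (induction A rule: infinite_finite_induct) (simp_all add: derivation_0 derivation_add)

lemma derivation_power: "derivation \<delta> \<Longrightarrow> \<delta> (a ^ n) = of_nat n * a ^ (n - 1) * \<delta> a"
proof (induction n)
  case (Suc n)
  then show ?case
    by (cases n) (simp_all add: derivation_mult algebra_simps)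
qed (simp add: derivation_1)

text \<open>A derivation of the series ring has to preserve polynomials in order to act on rational
  coefficients.\<close>

definition ratfun_derivation :: "('a::idom fps \<Rightarrow> 'a fps) \<Rightarrow> bool" where
  "ratfun_derivation \<delta> \<longleftrightarrow> derivation \<delta> \<and> (\<forall>p. \<exists>p'. \<delta> (fps_of_poly p) = fps_of_poly p')"

text \<open>Differentiating the cleared identity and solving for
  \<open>fps_of_poly q * \<delta> f\<close> replaces the quotient rule, so \<delta> is never
  extended to fractions.\<close>

lemma rat_span_derivation:
  assumes \<delta>: "ratfun_derivation \<delta>" and "finite G" "\<And>g. g \<in> G \<Longrightarrow> \<delta> g \<in> rat_span G"
    and f: "f \<in> rat_span G"
  shows "\<delta> f \<in> rat_span G"
proof -
  have d: "derivation \<delta>" using \<delta> by (simp add: ratfun_derivation_def)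
  obtain D where D: "\<And>p. \<delta> (fps_of_poly p) = fps_of_poly (D p)"
    using \<delta> unfolding ratfun_derivation_def by metis
  obtain q p where q: "q \<noteq> 0" "fps_of_poly q * f = (\<Sum>h\<in>G. fps_of_poly (p h) * h)"
    using f assms(2) by (rule rat_spanE)
  have "fps_of_poly q * \<delta> f = \<delta> (fps_of_poly q * f) - fps_of_poly (D q) * f"
    by (simp add: derivation_mult[OF d] D)
  also have "\<delta> (fps_of_poly q * f) = (\<Sum>h\<in>G. fps_of_poly (D (p h)) * h + fps_of_poly (p h) * \<delta> h)"
    unfolding q by (simp add: derivation_sum[OF d] derivation_mult[OF d] D)
  also have "\<dots> - fps_of_poly (D q) * f \<in> rat_span G"
    by (intro rat_span_diff rat_span_sum rat_span_add rat_span_poly_mult f assms rat_span_base)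
  finally show ?thesis
    by (rule rat_span_saturated[OF q(1)])
qed

section \<open>First-order linear systems over the rational functions\<close>

definition deriv_closed :: "('a::idom fps \<Rightarrow> 'a fps) set \<Rightarrow> 'a fps set \<Rightarrow> bool" where
  "deriv_closed \<Delta> G \<longleftrightarrow> finite G \<and> (\<forall>\<delta>\<in>\<Delta>. \<forall>g\<in>G. \<delta> g \<in> rat_span G)"

text \<open>The witness may be any finite closed set around \<open>f\<close>, not only one generated
  by the derivatives of \<open>f\<close>. Unions and lifts of witnesses are then witnesses
  again.\<close>

definition finite_rank :: "('a::idom fps \<Rightarrow> 'a fps) set \<Rightarrow> 'a fps \<Rightarrow> bool" where
  "finite_rank \<Delta> f \<longleftrightarrow> (\<exists>G. deriv_closed \<Delta> G \<and> f \<in> rat_span G)"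

text \<open>A witness may span more than the derivatives of \<open>f\<close> do. A maximal
  independent set of derivatives lies in a finite-dimensional space, so it is finite, and it
  generates exactly the span that \<open>D_finite\<close> speaks of.\<close>

lemma D_finite_if_finite_rank:
  assumes "\<forall>\<delta>\<in>\<Delta>. ratfun_derivation \<delta>" "finite_rank \<Delta> f"
  shows "D_finite \<Delta> f"
proof -
  obtain G where G: "finite G" "\<And>\<delta> g. \<delta> \<in> \<Delta> \<Longrightarrow> g \<in> G \<Longrightarrow> \<delta> g \<in> rat_span G" "f \<in> rat_span G"
    using assms(2) unfolding finite_rank_def deriv_closed_def by blast
  have "g \<in> rat_span G" if "g \<in> iterated_derivs \<Delta> f" for g
    using that
  proof induction
    case base
    show ?case by (rule G(3))
  next
    case (step g \<delta>)
    then show ?case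
      using rat_span_derivation[of \<delta> G g] G(1,2) assms(1) by auto
  qed
  then have sub: "to_fract ` iterated_derivs \<Delta> f \<subseteq> ratfun.span (to_fract ` G)"
    by (auto simp: rat_span_def)
  let ?V = "to_fract ` iterated_derivs \<Delta> f"
  obtain B where B: "B \<subseteq> ?V" "ratfun.independent B" "?V \<subseteq> ratfun.span B"
    by (rule ratfun.maximal_independent_subset)
  have "finite B"
    using ratfun.independent_span_bound[of "to_fract ` G" B] B sub G(1) by blast
  moreover have "ratfun.span ?V = ratfun.span B"
    using B(1,3) by (meson ratfun.span_mono ratfun.span_minimal ratfun.subspace_span subset_antisym)
  ultimately show ?thesis
    unfolding D_finite_def to_fract_def by blast
qed

lemma deriv_closed_Un:
  assumes "deriv_closed \<Delta> G" "deriv_closed \<Delta> H"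
  shows "deriv_closed \<Delta> (G \<union> H)"
  using assms rat_span_mono[of G "G \<union> H"] rat_span_mono[of H "G \<union> H"]
  unfolding deriv_closed_def by blast

lemma finite_rank_diff:
  assumes "finite_rank \<Delta> f" "finite_rank \<Delta> g"
  shows "finite_rank \<Delta> (f - g)"
proof -
  from assms obtain G H where *: "deriv_closed \<Delta> G" "f \<in> rat_span G" "deriv_closed \<Delta> H" "g \<in> rat_span H"
    unfolding finite_rank_def by blast
  then have "f \<in> rat_span (G \<union> H)" "g \<in> rat_span (G \<union> H)"
    using rat_span_mono[of G "G \<union> H"] rat_span_mono[of H "G \<union> H"] by auto
  then show ?thesis
    unfolding finite_rank_def using deriv_closed_Un[OF *(1,3)] rat_span_diff by blast
qed

lemma finite_rank_0: "finite_rank \<Delta> 0"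
  unfolding finite_rank_def deriv_closed_def by (intro exI[of _ "{}"]) auto

lemma finite_rank_uminus: "finite_rank \<Delta> f \<Longrightarrow> finite_rank \<Delta> (- f)"
  using finite_rank_diff[OF finite_rank_0] by fastforce

text \<open>Meant for logarithms of polynomials. The generator 1 carries the rational functions and
  is killed by every derivation.\<close>

lemma finite_rank_if_rational_derivatives:
  assumes "\<forall>\<delta>\<in>\<Delta>. ratfun_derivation \<delta>" "\<And>\<delta>. \<delta> \<in> \<Delta> \<Longrightarrow> \<delta> f \<in> rat_span {1}"
  shows "finite_rank \<Delta> f"
proof -
  have "deriv_closed \<Delta> {f, 1}"
    unfolding deriv_closed_def
  proof (intro conjI ballI)
    fix \<delta> g assume *: "\<delta> \<in> \<Delta>" "g \<in> {f, 1}"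
    then have "\<delta> 1 = 0" using assms(1) by (auto simp: ratfun_derivation_def derivation_1)
    then show "\<delta> g \<in> rat_span {f, 1}"
      using * assms(2) rat_span_mono[of "{1}" "{f, 1}"] by auto
  qed simp
  then show ?thesis
    unfolding finite_rank_def by (intro exI[of _ "{f, 1}"]) (auto intro: rat_span_base)
qed


subsection \<open>Laurent polynomials\<close>

lemma poly_mapping_sum_singles:
  "p = (\<Sum>k\<in>Poly_Mapping.keys p. Poly_Mapping.single k (Poly_Mapping.lookup p k))"
proof (rule poly_mapping_eqI)
  fix k
  show "Poly_Mapping.lookup p k = Poly_Mapping.lookup
      (\<Sum>k\<in>Poly_Mapping.keys p. Poly_Mapping.single k (Poly_Mapping.lookup p k)) k"
    by (auto simp: lookup_sum lookup_single when_def in_keys_iff)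
qed

lemma poly_mapping_additive_induct [case_names zero single add]:
  fixes p :: "'k \<Rightarrow>\<^sub>0 'a::comm_monoid_add"
  assumes "P 0" "\<And>k c. P (Poly_Mapping.single k c)" "\<And>p q. P p \<Longrightarrow> P q \<Longrightarrow> P (p + q)"
  shows "P p"
proof -
  have "P (\<Sum>k\<in>K. Poly_Mapping.single k (Poly_Mapping.lookup p k))" for K
    by (induction K rule: infinite_finite_induct) (use assms in auto)
  then show ?thesis
    by (subst poly_mapping_sum_singles)
qed

lemma lookup_single_mult:
  fixes p :: "'a::comm_ring_1 laurent"
  shows "Poly_Mapping.lookup (Poly_Mapping.single v c * p) k = c * Poly_Mapping.lookup p (k - v)"
proof (induction p rule: poly_mapping_additive_induct)
  case (single j d)
  then show ?case by (auto simp: mult_single lookup_single when_def)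
qed (simp_all add: distrib_left lookup_add)

lemma lookup_mult_sum:
  fixes p q :: "'a::comm_ring_1 laurent"
  shows "Poly_Mapping.lookup (p * q) k =
    (\<Sum>i\<in>Poly_Mapping.keys p. Poly_Mapping.lookup p i * Poly_Mapping.lookup q (k - i))"
proof -
  have "p * q = (\<Sum>i\<in>Poly_Mapping.keys p. Poly_Mapping.single i (Poly_Mapping.lookup p i) * q)"
    by (subst poly_mapping_sum_singles[of p]) (simp add: sum_distrib_right)
  then show ?thesis
    by (simp add: lookup_sum lookup_single_mult)
qed

lemma lookup_laurent_deriv:
  "Poly_Mapping.lookup (laurent_deriv p) k = of_int (k + 1) * Poly_Mapping.lookup p (k + 1)"
proof -
  have "Poly_Mapping.lookup (laurent_deriv p) k =
      (\<Sum>i\<in>Poly_Mapping.keys p. if i = k + 1 then of_int i * Poly_Mapping.lookup p i else 0)"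
    unfolding laurent_deriv_def lookup_sum
    by (intro sum.cong) (auto simp: lookup_single when_def)
  also have "\<dots> = of_int (k + 1) * Poly_Mapping.lookup p (k + 1)"
    by (simp add: in_keys_iff del: of_int_add)
  finally show ?thesis .
qed

lemma laurent_deriv_single:
  "laurent_deriv (Poly_Mapping.single k c) = Poly_Mapping.single (k - 1) (of_int k * c)"
  by (rule poly_mapping_eqI) (auto simp: lookup_laurent_deriv lookup_single when_def)

lemma laurent_deriv_add: "laurent_deriv (p + q) = laurent_deriv p + laurent_deriv q"
  by (rule poly_mapping_eqI) (simp add: lookup_laurent_deriv lookup_add algebra_simps)

text \<open>Both sides of the product rule are biadditive, and monomials generate the ring
  additively.\<close>

lemma derivation_by_additivity:
  fixes \<delta> :: "'a::comm_ring_1 laurent \<Rightarrow> 'a laurent"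
  assumes add: "\<And>p q. \<delta> (p + q) = \<delta> p + \<delta> q"
    and single: "\<And>i c j d. \<delta> (Poly_Mapping.single i c * Poly_Mapping.single j d) =
      \<delta> (Poly_Mapping.single i c) * Poly_Mapping.single j d +
      Poly_Mapping.single i c * \<delta> (Poly_Mapping.single j d)"
  shows "derivation \<delta>"
  unfolding derivation_def
proof (intro conjI allI add)
  fix p q
  have 0: "\<delta> 0 = 0" using add[of 0 0] by simp
  have *: "\<delta> (Poly_Mapping.single i c * q) =
      \<delta> (Poly_Mapping.single i c) * q + Poly_Mapping.single i c * \<delta> q" for i c
    by (induction q rule: poly_mapping_additive_induct)
       (simp_all add: 0 single add distrib_left)
  show "\<delta> (p * q) = \<delta> p * q + p * \<delta> q"
    by (induction p rule: poly_mapping_additive_induct)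
       (simp_all add: 0 * add distrib_right)
qed

lemma derivation_laurent_deriv: "derivation laurent_deriv"
proof (rule derivation_by_additivity)
  show "laurent_deriv (Poly_Mapping.single i c * Poly_Mapping.single j d) =
      laurent_deriv (Poly_Mapping.single i c) * Poly_Mapping.single j d +
      Poly_Mapping.single i c * laurent_deriv (Poly_Mapping.single j d)"
    for i j and c d :: 'a
    by (simp add: mult_single laurent_deriv_single single_add[symmetric] algebra_simps)
qed (rule laurent_deriv_add)

lemma lookup_map_0: "f 0 = 0 \<Longrightarrow> Poly_Mapping.lookup (Poly_Mapping.map f p) k = f (Poly_Mapping.lookup p k)"
  by (simp add: Poly_Mapping.map.rep_eq when_def)

lemma derivation_map:
  fixes \<delta> :: "'a::comm_ring_1 \<Rightarrow> 'a"
  assumes "derivation \<delta>"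
  shows "derivation (Poly_Mapping.map \<delta> :: 'a laurent \<Rightarrow> 'a laurent)"
proof (rule derivation_by_additivity)
  show "Poly_Mapping.map \<delta> (p + q) = Poly_Mapping.map \<delta> p + Poly_Mapping.map \<delta> q" for p q :: "'a laurent"
    by (rule poly_mapping_eqI)
       (simp add: lookup_map_0 lookup_add derivation_0[OF assms] derivation_add[OF assms])
next
  have s: "Poly_Mapping.map \<delta> (Poly_Mapping.single i c) = Poly_Mapping.single i (\<delta> c)" for i :: int and c
    by (rule poly_mapping_eqI) (simp add: lookup_map_0 lookup_single when_def derivation_0[OF assms])
  show "Poly_Mapping.map \<delta> (Poly_Mapping.single i c * Poly_Mapping.single j d) =
      Poly_Mapping.map \<delta> (Poly_Mapping.single i c) * Poly_Mapping.single j d +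
      Poly_Mapping.single i c * Poly_Mapping.map \<delta> (Poly_Mapping.single j d)" for i j :: int and c d
    by (simp add: mult_single s single_add[symmetric] derivation_mult[OF assms])
qed


subsection \<open>Coefficientwise maps on power series\<close>

lemma fps_map_nth [simp]: "fps_nth (fps_map h f) n = h (fps_nth f n)"
  by (simp add: fps_map_def)

lemma derivation_fps_map:
  fixes \<delta> :: "'a::comm_ring_1 \<Rightarrow> 'a"
  assumes "derivation \<delta>"
  shows "derivation (fps_map \<delta>)"
  unfolding derivation_def
  by (auto simp: fps_eq_iff fps_mult_nth derivation_add[OF assms] derivation_mult[OF assms]
      derivation_sum[OF assms] sum.distrib)

lemma ratfun_derivation_fps_map:
  fixes \<delta> :: "'a::idom \<Rightarrow> 'a"
  assumes "derivation \<delta>"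
  shows "ratfun_derivation (fps_map \<delta>)"
  unfolding ratfun_derivation_def
proof (intro conjI allI derivation_fps_map assms)
  fix p :: "'a poly"
  show "\<exists>p'. fps_map \<delta> (fps_of_poly p) = fps_of_poly p'"
    by (rule exI[of _ "map_poly \<delta> p"]) (simp add: fps_eq_iff coeff_map_poly derivation_0[OF assms])
qed

lemma derivation_fps_deriv: "derivation (fps_deriv :: 'a::comm_ring_1 fps \<Rightarrow> 'a fps)"
  by (simp add: derivation_def mult_ac)

lemma ratfun_derivation_fps_deriv: "ratfun_derivation (fps_deriv :: 'a::idom fps \<Rightarrow> 'a fps)"
  unfolding ratfun_derivation_def
  by (metis derivation_fps_deriv fps_of_poly_pderiv)

lemma derivation_of_nat_mult:
  assumes "derivation \<delta>"
  shows "\<delta> (of_nat n * a) = of_nat n * \<delta> a"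
  by (induction n) (simp_all add: derivation_0[OF assms] derivation_add[OF assms] distrib_right)

lemma fps_map_fps_deriv_commute:
  assumes "derivation \<delta>"
  shows "fps_map \<delta> (fps_deriv f) = fps_deriv (fps_map \<delta> f)"
  by (simp add: fps_eq_iff derivation_of_nat_mult[OF assms] del: of_nat_Suc)

lemma laurent_const_0 [simp]: "laurent_const 0 = 0"
  and laurent_const_1 [simp]: "laurent_const 1 = 1"
  and laurent_const_add: "laurent_const (a + b) = laurent_const a + laurent_const b"
  and laurent_const_mult: "laurent_const (c * d) = laurent_const c * laurent_const d"
  by (simp_all add: laurent_const_def single_add mult_single)

lemma lookup_laurent_const: "Poly_Mapping.lookup (laurent_const c) k = (if k = 0 then c else 0)"
  by (simp add: laurent_const_def lookup_single when_def)

lemma lookup_laurent_const_mult: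
  fixes p :: "'a::comm_ring_1 laurent"
  shows "Poly_Mapping.lookup (laurent_const c * p) k = c * Poly_Mapping.lookup p k"
  by (simp add: laurent_const_def lookup_single_mult)

lemma laurent_const_sum: "laurent_const (sum f A) = (\<Sum>i\<in>A. laurent_const (f i))"
  by (induction A rule: infinite_finite_induct) (simp_all add: laurent_const_add)

lemma fps_lift_nth [simp]: "fps_nth (fps_lift f) n = laurent_const (fps_nth f n)"
  by (simp add: fps_lift_def)

lemma fps_lift_0 [simp]: "fps_lift 0 = 0"
  and fps_lift_1 [simp]: "fps_lift 1 = 1"
  and fps_lift_add: "fps_lift (f + g) = fps_lift f + fps_lift g"
  and fps_lift_mult: "fps_lift (u * v) = fps_lift u * fps_lift v"
  by (simp_all add: fps_eq_iff laurent_const_add fps_mult_nth laurent_const_sum laurent_const_mult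
      fps_one_def)

lemma fps_lift_sum: "fps_lift (sum f A) = (\<Sum>i\<in>A. fps_lift (f i))"
  by (induction A rule: infinite_finite_induct) (simp_all add: fps_lift_add)

lemma fps_lift_diff: "fps_lift (f - g :: 'a::comm_ring_1 fps) = fps_lift f - fps_lift g"
  by (simp add: fps_eq_iff laurent_const_def single_diff)

lemma fps_lift_fps_deriv: "fps_lift (fps_deriv f) = fps_deriv (fps_lift f :: 'a::comm_ring_1 laurent fps)"
proof -
  have "laurent_const (of_nat n :: 'a) = of_nat n" for n
    by (simp add: laurent_const_def)
  then show ?thesis by (simp add: fps_eq_iff laurent_const_mult del: of_nat_Suc)
qed

lemma fps_lift_poly: "\<exists>p'. fps_lift (fps_of_poly p) = fps_of_poly p' \<and> (p \<noteq> 0 \<longrightarrow> p' \<noteq> 0)"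
proof (intro exI[of _ "map_poly laurent_const p"] conjI impI)
  show "fps_lift (fps_of_poly p) = fps_of_poly (map_poly laurent_const p)"
    by (simp add: fps_eq_iff coeff_map_poly)
  assume "p \<noteq> 0"
  then show "map_poly laurent_const p \<noteq> 0"
    by (subst map_poly_eq_0_iff) (auto simp: laurent_const_def dest: arg_cong[of _ _ "\<lambda>p. Poly_Mapping.lookup p 0"])
qed

lemma fps_map_laurent_deriv_lift: "fps_map laurent_deriv (fps_lift f) = 0"
  by (simp add: fps_eq_iff laurent_const_def laurent_deriv_single)

lemma fps_map_map_lift:
  assumes "\<delta> 0 = 0"
  shows "fps_map (Poly_Mapping.map \<delta>) (fps_lift f) = fps_lift (fps_map \<delta> f)"
proof -
  have "Poly_Mapping.map \<delta> (laurent_const c) = laurent_const (\<delta> c)" for c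
    by (rule poly_mapping_eqI) (simp add: assms lookup_map_0 lookup_laurent_const)
  then show ?thesis by (simp add: fps_eq_iff)
qed


subsection \<open>Coefficient extraction and supports\<close>

definition xcoeff :: "int \<Rightarrow> 'a::zero laurent fps \<Rightarrow> 'a fps" where
  "xcoeff k = fps_map (\<lambda>p. Poly_Mapping.lookup p k)"

lemma xcoeff_nth [simp]: "fps_nth (xcoeff k f) n = Poly_Mapping.lookup (fps_nth f n) k"
  by (simp add: xcoeff_def)

lemma laurent_fps_eqI: "(\<And>k. xcoeff k f = xcoeff k g) \<Longrightarrow> f = g"
  by (metis fps_ext poly_mapping_eqI xcoeff_nth)

lemma xcoeff_0 [simp]: "xcoeff k 0 = 0"
  and xcoeff_add: "xcoeff k (f + g) = xcoeff k f + xcoeff k g"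
  by (simp_all add: fps_eq_iff lookup_add)

lemma xcoeff_diff: "xcoeff k (f - g :: 'a::comm_ring_1 laurent fps) = xcoeff k f - xcoeff k g"
  by (simp add: fps_eq_iff lookup_minus)

lemma xcoeff_sum: "xcoeff k (sum f A) = (\<Sum>i\<in>A. xcoeff k (f i))"
  by (induction A rule: infinite_finite_induct) (simp_all add: xcoeff_add)

lemma xcoeff_lift: "xcoeff k (fps_lift f) = (if k = 0 then f else 0)"
  by (simp add: fps_eq_iff lookup_laurent_const)

lemma xcoeff_1: "xcoeff k (1 :: 'a::comm_ring_1 laurent fps) = (if k = 0 then 1 else 0)"
  using xcoeff_lift[of k "1 :: 'a fps"] by simp

lemma xcoeff_lift_mult: "xcoeff k (fps_lift f * g :: 'a::comm_ring_1 laurent fps) = f * xcoeff k g"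
  by (simp add: fps_eq_iff fps_mult_nth lookup_sum lookup_laurent_const_mult)

lemma xcoeff_fps_deriv: "xcoeff k (fps_deriv f) = fps_deriv (xcoeff k f :: 'a::comm_ring_1 fps)"
proof -
  have "Poly_Mapping.lookup (of_nat n * p) k = of_nat n * Poly_Mapping.lookup p k" for n and p :: "'a laurent"
    by (induction n) (simp_all add: distrib_right lookup_add)
  then show ?thesis by (simp add: fps_eq_iff del: of_nat_Suc)
qed

definition x_monom :: "int \<Rightarrow> 'a::comm_ring_1 laurent fps" where
  "x_monom v = fps_const (Poly_Mapping.single v 1)"

lemma xcoeff_x_monom_mult: "xcoeff k (x_monom v * f) = xcoeff (k - v) f"
  by (simp add: fps_eq_iff x_monom_def lookup_single_mult)

definition supp_in :: "int set \<Rightarrow> 'a::zero laurent fps \<Rightarrow> bool" where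
  "supp_in A f \<longleftrightarrow> (\<forall>n. Poly_Mapping.keys (fps_nth f n) \<subseteq> A)"

lemma supp_in_iff: "supp_in A f \<longleftrightarrow> (\<forall>k. k \<notin> A \<longrightarrow> xcoeff k f = 0)"
  unfolding supp_in_def fps_eq_iff by (auto simp: in_keys_iff subset_iff)

lemma supp_in_mono: "supp_in A f \<Longrightarrow> A \<subseteq> B \<Longrightarrow> supp_in B f"
  by (auto simp: supp_in_def)

lemma supp_in_add: "supp_in A f \<Longrightarrow> supp_in A g \<Longrightarrow> supp_in A (f + g)"
  by (simp add: supp_in_iff xcoeff_add)

lemma supp_in_diff: "supp_in A f \<Longrightarrow> supp_in A g \<Longrightarrow> supp_in A (f - g :: 'a::comm_ring_1 laurent fps)"
  by (simp add: supp_in_iff xcoeff_diff)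

lemma supp_in_lift: "0 \<in> A \<Longrightarrow> supp_in A (fps_lift f)"
  by (auto simp: supp_in_iff xcoeff_lift)

lemma supp_in_1: "0 \<in> A \<Longrightarrow> supp_in A (1 :: 'a::comm_ring_1 laurent fps)"
  using supp_in_lift[of A "1 :: 'a fps"] by simp

lemma supp_in_fps_deriv: "supp_in A f \<Longrightarrow> supp_in A (fps_deriv f :: 'a::comm_ring_1 laurent fps)"
  by (simp add: supp_in_iff xcoeff_fps_deriv)

lemma keys_mult_subset:
  fixes p q :: "'a::comm_ring_1 laurent"
  assumes "Poly_Mapping.keys p \<subseteq> A" "Poly_Mapping.keys q \<subseteq> B" "\<And>a b. a \<in> A \<Longrightarrow> b \<in> B \<Longrightarrow> a + b \<in> C"
  shows "Poly_Mapping.keys (p * q) \<subseteq> C"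
  using keys_mult[of p q] assms by blast

lemma keys_sum_subset:
  assumes "\<And>i. i \<in> I \<Longrightarrow> Poly_Mapping.keys (f i) \<subseteq> C"
  shows "Poly_Mapping.keys (sum f I) \<subseteq> C"
  using assms
proof (induction I rule: infinite_finite_induct)
  case (insert x I)
  then show ?case
    using keys_add[of "f x" "sum f I"] by auto
qed auto

lemma supp_in_mult:
  fixes f g :: "'a::comm_ring_1 laurent fps"
  assumes "supp_in A f" "supp_in B g" "\<And>a b. a \<in> A \<Longrightarrow> b \<in> B \<Longrightarrow> a + b \<in> C"
  shows "supp_in C (f * g)"
  unfolding supp_in_def fps_mult_nth
proof (intro allI keys_sum_subset keys_mult_subset)
  fix n i
  show "Poly_Mapping.keys (fps_nth f i) \<subseteq> A" "Poly_Mapping.keys (fps_nth g (n - i)) \<subseteq> B"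
    using assms(1,2) by (auto simp: supp_in_def)
qed (rule assms(3))

lemma supp_in_nonneg_mult: "supp_in {0..} f \<Longrightarrow> supp_in {0..} g \<Longrightarrow> supp_in {0..} (f * g :: 'a::comm_ring_1 laurent fps)"
  by (rule supp_in_mult) auto

lemma supp_in_nonpos_mult: "supp_in {..0} f \<Longrightarrow> supp_in {..0} g \<Longrightarrow> supp_in {..0} (f * g :: 'a::comm_ring_1 laurent fps)"
  by (rule supp_in_mult) auto

text \<open>Two exponents of the same sign sum to 0 only if both are 0. So extracting the constant
  term is multiplicative on each half line, though not on all Laurent polynomials.\<close>

lemma lookup_0_mult:
  fixes p q :: "'a::comm_ring_1 laurent"
  assumes "Poly_Mapping.keys p \<subseteq> {0..} \<and> Poly_Mapping.keys q \<subseteq> {0..} \<or>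
    Poly_Mapping.keys p \<subseteq> {..0} \<and> Poly_Mapping.keys q \<subseteq> {..0}"
  shows "Poly_Mapping.lookup (p * q) 0 = Poly_Mapping.lookup p 0 * Poly_Mapping.lookup q 0"
proof -
  have "Poly_Mapping.lookup p i * Poly_Mapping.lookup q (0 - i) =
      (if i = 0 then Poly_Mapping.lookup p 0 * Poly_Mapping.lookup q 0 else 0)" for i
  proof (cases "i \<in> Poly_Mapping.keys p \<and> - i \<in> Poly_Mapping.keys q")
    case True
    then have "i = 0" using assms by force
    then show ?thesis by simp
  qed (auto simp: in_keys_iff)
  then have "Poly_Mapping.lookup (p * q) 0 = (\<Sum>i\<in>Poly_Mapping.keys p.
      if i = 0 then Poly_Mapping.lookup p 0 * Poly_Mapping.lookup q 0 else 0)"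
    by (simp only: lookup_mult_sum)
  then show ?thesis by (auto simp: in_keys_iff)
qed

lemma xcoeff_0_mult:
  fixes f g :: "'a::comm_ring_1 laurent fps"
  assumes "supp_in {0..} f \<and> supp_in {0..} g \<or> supp_in {..0} f \<and> supp_in {..0} g"
  shows "xcoeff 0 (f * g) = xcoeff 0 f * xcoeff 0 g"
  using assms unfolding supp_in_def fps_eq_iff
  by (auto simp: fps_mult_nth lookup_sum intro!: sum.cong lookup_0_mult)

section \<open>Reciprocals of series with constant coefficient 1\<close>

definition fps_recip :: "'a::comm_ring_1 fps \<Rightarrow> 'a fps" where
  "fps_recip f = fps_right_inverse f 1"

lemma fps_recip: "fps_nth f 0 = 1 \<Longrightarrow> f * fps_recip f = 1"
  unfolding fps_recip_def by (rule fps_right_inverse) simp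

lemma fps_recip_nth_0: "fps_nth (fps_recip f) 0 = 1"
  by (simp add: fps_recip_def)

text \<open>The coefficients of the reciprocal arise from those of \<open>f\<close> by sums and
  products, so every additive submonoid of exponents is preserved.\<close>

lemma supp_in_recip:
  fixes f :: "'a::comm_ring_1 laurent fps"
  assumes "supp_in A f" "0 \<in> A" "\<And>a b. a \<in> A \<Longrightarrow> b \<in> A \<Longrightarrow> a + b \<in> A"
  shows "supp_in A (fps_recip f)"
  unfolding supp_in_def
proof
  fix n
  show "Poly_Mapping.keys (fps_nth (fps_recip f) n) \<subseteq> A"
  proof (induction n rule: less_induct)
    case (less n)
    show ?case
    proof (cases n)
      case 0
      then show ?thesis using assms(2) by (simp add: fps_recip_nth_0)
    next
      case (Suc m)
      have "fps_nth (fps_recip f) n = - (\<Sum>i = 1..n. fps_nth f i * fps_nth (fps_recip f) (n - i))"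
        by (simp add: fps_recip_def Suc)
      also have "Poly_Mapping.keys \<dots> \<subseteq> A"
        unfolding keys_minus
      proof (intro keys_sum_subset keys_mult_subset[OF _ _ assms(3)])
        fix i assume "i \<in> {1..n}"
        then show "Poly_Mapping.keys (fps_nth (fps_recip f) (n - i)) \<subseteq> A"
          using Suc by (intro less.IH) auto
        show "Poly_Mapping.keys (fps_nth f i) \<subseteq> A"
          using assms(1) by (simp add: supp_in_def)
      qed
      finally show ?thesis .
    qed
  qed
qed


subsection \<open>Logarithms\<close>

lemma fps_log_nth_0: "fps_nth (fps_log \<iota> f) 0 = \<iota> 0"
  by (simp add: fps_log_def fps_ln_def)

text \<open>The identity \<open>(1 + X) ln'(1 + X) = 1\<close> over the reals is carried to the
  coefficient ring by \<iota> and then evaluated at \<open>X = f - 1\<close>. The multiplied form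
  avoids inverting \<open>f\<close>.\<close>

lemma fps_log_deriv:
  fixes f :: "'a::idom fps"
  assumes f: "fps_nth f 0 = 1"
    and \<iota>: "\<iota> 0 = 0" "\<iota> 1 = 1" "\<And>a b. \<iota> (a + b) = \<iota> a + \<iota> b" "\<And>a b. \<iota> (a * b) = \<iota> a * \<iota> b"
  shows "f * fps_deriv (fps_log \<iota> f) = fps_deriv f"
proof -
  let ?l = "fps_map \<iota> (fps_ln 1)"
  have sum: "\<iota> (sum g A) = (\<Sum>i\<in>A. \<iota> (g i))" for g :: "nat \<Rightarrow> real" and A
    by (induction A rule: infinite_finite_induct) (simp_all add: \<iota>)
  have nat: "\<iota> (of_nat n) = of_nat n" for n
    by (induction n) (simp_all add: \<iota>)
  have "(1 + fps_X) * fps_deriv (fps_ln 1 :: real fps) = 1"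
    by (simp add: fps_ln_deriv inverse_mult_eq_1')
  then have "fps_map \<iota> ((1 + fps_X) * fps_deriv (fps_ln 1)) = fps_map \<iota> 1"
    by simp
  also have "fps_map \<iota> ((1 + fps_X) * fps_deriv (fps_ln 1)) =
      fps_map \<iota> (1 + fps_X) * fps_map \<iota> (fps_deriv (fps_ln 1))"
    by (simp add: fps_eq_iff fps_mult_nth sum \<iota>)
  also have "fps_map \<iota> (1 + fps_X) = 1 + fps_X"
    by (simp add: fps_eq_iff fps_X_def fps_one_def \<iota>)
  also have "fps_map \<iota> (fps_deriv (fps_ln 1)) = fps_deriv ?l"
    by (simp add: fps_eq_iff \<iota> nat del: of_nat_Suc)
  also have "fps_map \<iota> 1 = 1"
    by (simp add: fps_eq_iff fps_one_def \<iota>)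
  finally have 1: "(1 + fps_X) * fps_deriv ?l = 1" .
  have "fps_compose ((1 + fps_X) * fps_deriv ?l) (f - 1) = 1"
    unfolding 1 by simp
  then have 2: "f * fps_compose (fps_deriv ?l) (f - 1) = 1"
    using f by (simp add: fps_compose_mult_distrib fps_compose_add_distrib)
  have "fps_deriv (fps_log \<iota> f) = fps_compose (fps_deriv ?l) (f - 1) * fps_deriv f"
    unfolding fps_log_def using f by (simp add: fps_compose_deriv)
  then show ?thesis
    using 2 by (simp add: mult.assoc[symmetric])
qed

lemma log_derivative_unique:
  fixes f g h :: "'a::{idom,ring_char_0} fps"
  assumes "fps_nth f 0 = 1" "f * fps_deriv g = f * fps_deriv h" "fps_nth g 0 = fps_nth h 0"
  shows "g = h"
proof -
  have "f \<noteq> 0" using assms(1) by auto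
  then have "fps_deriv g = fps_deriv h" using assms(2) by simp
  then show ?thesis using assms(3) by (auto simp: fps_deriv_eq_iff)
qed

text \<open>The equation in \<open>t\<close> determines the other derivatives of the logarithm too.
  The defect \<open>D\<close> satisfies \<open>f D' = f' D\<close>, so \<open>D / f\<close> has
  derivative 0 in \<open>t\<close>; its constant coefficient is 0 because \<delta> kills 0 and
  1.\<close>

lemma log_partial_derivative:
  fixes f l :: "'a::{idom,ring_char_0} fps"
  assumes \<delta>: "derivation \<delta>" and f: "fps_nth f 0 = 1" and l: "fps_nth l 0 = 0"
    and ode: "f * fps_deriv l = fps_deriv f"
  shows "f * fps_map \<delta> l = fps_map \<delta> f"
proof -
  let ?\<delta> = "fps_map \<delta>"
  note d = derivation_fps_map[OF \<delta>]
  define D where "D = f * ?\<delta> l - ?\<delta> f"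
  define g where "g = fps_recip f"
  have fg: "f * g = 1" using f by (simp add: g_def fps_recip)
  have e: "?\<delta> f * fps_deriv l + f * fps_deriv (?\<delta> l) = fps_deriv (?\<delta> f)"
    using arg_cong[OF ode, of ?\<delta>]
    unfolding derivation_mult[OF d] fps_map_fps_deriv_commute[OF \<delta>] .
  have "fps_deriv D = fps_deriv f * ?\<delta> l + f * fps_deriv (?\<delta> l) - fps_deriv (?\<delta> f)"
    by (simp add: D_def)
  then have D': "fps_deriv D = fps_deriv f * ?\<delta> l - ?\<delta> f * fps_deriv l"
    unfolding e[symmetric] by simp
  have "f * fps_deriv D = fps_deriv f * (f * ?\<delta> l) - ?\<delta> f * (f * fps_deriv l)"
    unfolding D' by (simp add: algebra_simps)
  also have "\<dots> = fps_deriv f * D"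
    unfolding ode D_def by (simp add: algebra_simps)
  finally have fD: "f * fps_deriv D = fps_deriv f * D" .
  have "fps_deriv (f * g) = 0" unfolding fg by simp
  then have g': "f * fps_deriv g = - (fps_deriv f * g)"
    by (simp add: eq_neg_iff_add_eq_0 add.commute)
  have "f * fps_deriv (g * D) = (f * fps_deriv g) * D + g * (f * fps_deriv D)"
    by (simp add: algebra_simps)
  also have "\<dots> = 0"
    unfolding g' fD by (simp add: algebra_simps)
  finally have "fps_deriv (g * D) = 0"
    using f by auto
  moreover have "fps_nth (g * D) 0 = 0"
    by (simp add: D_def f l derivation_0[OF \<delta>] derivation_1[OF \<delta>])
  ultimately have "g * D = 0"
    by (metis fps_const_0_eq_0 fps_deriv_eq_0_iff)
  moreover have "g \<noteq> 0"
    using fg by auto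
  ultimately show ?thesis by (simp add: D_def)
qed


subsection \<open>Counting walks that avoid a set\<close>

text \<open>The start is exempt, so the closed slit, which contains the origin, is admissible. The
  empty \<open>H\<close> gives all walks.\<close>

definition avoiding_walks :: "(int \<times> int) set \<Rightarrow> (int \<times> int) set \<Rightarrow> (int \<times> int) list set" where
  "avoiding_walks \<SS> H = {w \<in> walks \<SS>. \<forall>k\<in>{1..walk_length w}. w ! k \<notin> H}"

definition walks_to :: "(int \<times> int) list set \<Rightarrow> nat \<Rightarrow> int \<times> int \<Rightarrow> (int \<times> int) list set" where
  "walks_to W n p = {w \<in> W. walk_length w = n \<and> last w = p}"

lemma num_walks_eq: "num_walks W n p = card (walks_to W n p)"
  by (simp add: num_walks_def walks_to_def)

lemma walks_to_0: "walks_to (avoiding_walks \<SS> H) 0 p = (if p = (0, 0) then {[(0, 0)]} else {})"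
proof -
  have "w \<in> avoiding_walks \<SS> H \<and> walk_length w = 0 \<longleftrightarrow> w = [(0, 0)]" for w
    by (cases w) (auto simp: avoiding_walks_def walks_def walk_length_def)
  then have "walks_to (avoiding_walks \<SS> H) 0 p = {w. w = [(0, 0)] \<and> last w = p}"
    unfolding walks_to_def by (metis (no_types, lifting))
  also have "\<dots> = (if p = (0, 0) then {[(0, 0)]} else {})"
    by (simp cong: conj_cong)
  finally show ?thesis .
qed

lemma snoc_in_avoiding_walks_iff:
  assumes "w \<noteq> []"
  shows "w @ [p] \<in> avoiding_walks \<SS> H \<longleftrightarrow> w \<in> avoiding_walks \<SS> H \<and> p - last w \<in> \<SS> \<and> p \<notin> H"
proof -
  obtain m where m: "length w = Suc m" using assms by (cases w) auto
  have ins: "{1..<Suc (Suc m)} = insert (Suc m) {1..<Suc m}" "{1..Suc m} = insert (Suc m) {1..m}"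
    by auto
  have nth: "(w @ [p]) ! k = w ! k" if "k < Suc m" for k
    using that m by (simp add: nth_append)
  have nth': "(w @ [p]) ! (k - Suc 0) = w ! (k - Suc 0)" if "k < Suc m" for k
    using that by (intro nth) simp
  have last: "(w @ [p]) ! Suc m = p" "last w = w ! m"
    using assms m by (simp_all add: last_conv_nth nth_append)
  have "(\<forall>k\<in>{1..<Suc (Suc m)}. (w @ [p]) ! k - (w @ [p]) ! (k - 1) \<in> \<SS>) \<longleftrightarrow>
      p - last w \<in> \<SS> \<and> (\<forall>k\<in>{1..<Suc m}. w ! k - w ! (k - 1) \<in> \<SS>)"
    unfolding ins by (simp add: last nth nth')
  moreover have "(\<forall>k\<in>{1..Suc m}. (w @ [p]) ! k \<notin> H) \<longleftrightarrow> p \<notin> H \<and> (\<forall>k\<in>{1..m}. w ! k \<notin> H)"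
    unfolding ins by (simp add: last nth nth')
  ultimately show ?thesis
    unfolding avoiding_walks_def walks_def walk_length_def
    using assms nth[of 0] m by simp blast
qed

lemma walks_to_Suc:
  "walks_to (avoiding_walks \<SS> H) (Suc n) p =
    (if p \<in> H then {} else (\<lambda>w. w @ [p]) ` (\<Union>s\<in>\<SS>. walks_to (avoiding_walks \<SS> H) n (p - s)))"
    (is "?L = ?R")
proof (rule Set.set_eqI)
  fix v
  show "v \<in> ?L \<longleftrightarrow> v \<in> ?R"
  proof
    assume v: "v \<in> ?L"
    then have "length v = Suc (Suc n)" "last v = p"
      by (auto simp: walks_to_def walk_length_def)
    then obtain w where w: "v = w @ [p]" "length w = Suc n"
      by (cases v rule: rev_cases) auto
    then have "w \<noteq> []" by auto
    then have "w \<in> avoiding_walks \<SS> H" "p - last w \<in> \<SS>" "p \<notin> H"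
      using v w by (auto simp: walks_to_def snoc_in_avoiding_walks_iff)
    then show "v \<in> ?R"
      using w by (auto simp: walks_to_def walk_length_def intro!: image_eqI[of _ _ w] bexI[of _ "p - last w"])
  next
    assume "v \<in> ?R"
    then obtain w s where w: "p \<notin> H" "v = w @ [p]" "s \<in> \<SS>" "w \<in> walks_to (avoiding_walks \<SS> H) n (p - s)"
      by (auto split: if_splits)
    have ne: "w \<noteq> []" using w(4) by (auto simp: walks_to_def avoiding_walks_def walks_def)
    then show "v \<in> ?L"
      using w by (auto simp: walks_to_def snoc_in_avoiding_walks_iff[OF ne] walk_length_def Suc_diff_le)
  qed
qed

lemma finite_walks_to:
  assumes "finite \<SS>"
  shows "finite (walks_to (avoiding_walks \<SS> H) n p)"
  by (induction n arbitrary: p) (auto simp: walks_to_0 walks_to_Suc assms)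

lemma num_walks_avoiding_0: "num_walks (avoiding_walks \<SS> H) 0 p = (if p = (0, 0) then 1 else 0)"
  by (simp add: num_walks_eq walks_to_0)

lemma num_walks_avoiding_Suc:
  assumes "finite \<SS>"
  shows "num_walks (avoiding_walks \<SS> H) (Suc n) p =
    (if p \<in> H then 0 else (\<Sum>s\<in>\<SS>. num_walks (avoiding_walks \<SS> H) n (p - s)))"
proof -
  have "card ((\<lambda>w. w @ [p]) ` (\<Union>s\<in>\<SS>. walks_to (avoiding_walks \<SS> H) n (p - s))) =
      card (\<Union>s\<in>\<SS>. walks_to (avoiding_walks \<SS> H) n (p - s))"
    by (rule card_image) (auto simp: inj_on_def)
  also have "\<dots> = (\<Sum>s\<in>\<SS>. card (walks_to (avoiding_walks \<SS> H) n (p - s)))"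
    by (rule card_UN_disjoint) (use assms in \<open>auto simp: finite_walks_to, auto simp: walks_to_def\<close>)
  finally show ?thesis
    by (simp add: num_walks_eq walks_to_Suc)
qed

text \<open>Guards the sums that define the generating functions: over an infinite index set they
  would default to 0.\<close>

lemma finite_endpoints:
  assumes "finite \<SS>"
  shows "finite {p. num_walks (avoiding_walks \<SS> H) n p \<noteq> 0}"
proof (induction n)
  case 0
  have "{p. num_walks (avoiding_walks \<SS> H) 0 p \<noteq> 0} \<subseteq> {(0, 0)}"
    by (auto simp: num_walks_avoiding_0 split: if_splits)
  then show ?case by (rule finite_subset) simp
next
  case (Suc n)
  let ?E = "{p. num_walks (avoiding_walks \<SS> H) n p \<noteq> 0}"
  have "p \<in> (\<lambda>(q, s). q + s) ` (?E \<times> \<SS>)"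
    if "num_walks (avoiding_walks \<SS> H) (Suc n) p \<noteq> 0" for p
  proof -
    have "(\<Sum>s\<in>\<SS>. num_walks (avoiding_walks \<SS> H) n (p - s)) \<noteq> 0"
      using that by (auto simp: num_walks_avoiding_Suc[OF assms] split: if_splits)
    then obtain s where "s \<in> \<SS>" "num_walks (avoiding_walks \<SS> H) n (p - s) \<noteq> 0"
      by (meson sum.not_neutral_contains_not_neutral)
    then show ?thesis
      by (intro image_eqI[of _ _ "(p - s, s)"]) auto
  qed
  then have "{p. num_walks (avoiding_walks \<SS> H) (Suc n) p \<noteq> 0} \<subseteq> (\<lambda>(q, s). q + s) ` (?E \<times> \<SS>)"
    by blast
  then show ?case
    by (rule finite_subset) (use Suc assms in auto)
qed

lemma lookup_sum_singles:
  assumes "finite A"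
  shows "Poly_Mapping.lookup (\<Sum>i\<in>A. Poly_Mapping.single i (c i)) k = (if k \<in> A then c k else 0)"
  using assms by (auto simp: lookup_sum lookup_single when_def)

lemma lookup_gf_xy:
  assumes "finite {p. num_walks W n p \<noteq> 0}"
  shows "Poly_Mapping.lookup (Poly_Mapping.lookup (fps_nth (gf_xy W) n) j) i = real (num_walks W n (i, j))"
proof -
  have set: "{x. case x of (i, j) \<Rightarrow> num_walks W n (i, j) \<noteq> 0} = {p. num_walks W n p \<noteq> 0}"
    by auto
  have "Poly_Mapping.lookup (Poly_Mapping.lookup (fps_nth (gf_xy W) n) j) i =
      (\<Sum>p | num_walks W n p \<noteq> 0. if p = (i, j) then real (num_walks W n (i, j)) else 0)"
    unfolding gf_xy_def fps_nth_Abs_fps lookup_sum set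
    by (intro sum.cong) (auto simp: lookup_single when_def split: if_splits)
  also have "\<dots> = real (num_walks W n (i, j))"
    using assms by auto
  finally show ?thesis .
qed

lemma lookup_gf_x:
  assumes "finite {p. num_walks W n p \<noteq> 0}"
  shows "Poly_Mapping.lookup (fps_nth (gf_x W) n) i = real (num_walks W n (i, 0))"
proof -
  have "{i. num_walks W n (i, 0) \<noteq> 0} \<subseteq> fst ` {p. num_walks W n p \<noteq> 0}"
    by force
  then have "finite {i. num_walks W n (i, 0) \<noteq> 0}"
    by (rule finite_subset) (use assms in simp)
  then show ?thesis
    unfolding gf_x_def fps_nth_Abs_fps by (subst lookup_sum_singles) auto
qed

lemma gf_x_eq_xcoeff:
  assumes "\<And>n. finite {p. num_walks W n p \<noteq> 0}"
  shows "gf_x W = xcoeff 0 (gf_xy W)"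
  by (intro fps_ext poly_mapping_eqI) (simp add: lookup_gf_x[OF assms] lookup_gf_xy[OF assms])

section \<open>The kernel equation\<close>

definition step_poly :: "(int \<times> int) set \<Rightarrow> real laurent laurent" where
  "step_poly \<SS> = (\<Sum>(i, j)\<in>\<SS>. Poly_Mapping.single j (Poly_Mapping.single i 1))"

lemma walk_kernel_eq: "walk_kernel \<SS> = 1 - fps_X * fps_const (step_poly \<SS>)"
  by (simp add: walk_kernel_def step_poly_def)

lemma lookup_step_poly_mult:
  "Poly_Mapping.lookup (Poly_Mapping.lookup (step_poly \<SS> * q) j) i =
    (\<Sum>(a, b)\<in>\<SS>. Poly_Mapping.lookup (Poly_Mapping.lookup q (j - b)) (i - a))"
  unfolding step_poly_def sum_distrib_right lookup_sum
  by (intro sum.cong) (auto simp: lookup_single_mult)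

text \<open>Outside \<open>H\<close> the recurrence by the last step holds without exception, and
  the kernel encodes precisely this recurrence. At points of \<open>H\<close> the count is forced to
  0 and the product is left undetermined.\<close>

lemma kernel_equation:
  assumes "finite \<SS>" "(i, j) \<notin> H"
  shows "xcoeff i (xcoeff j (gf_xy (avoiding_walks \<SS> H) * walk_kernel \<SS>)) = xcoeff i (xcoeff j 1)"
proof (rule fps_ext)
  fix n
  let ?N = "num_walks (avoiding_walks \<SS> H)"
  let ?F = "gf_xy (avoiding_walks \<SS> H)"
  note fin = finite_endpoints[OF assms(1), of H]
  have eq: "?F * walk_kernel \<SS> = ?F - fps_X * (fps_const (step_poly \<SS>) * ?F)"
    by (simp add: walk_kernel_eq algebra_simps)
  show "fps_nth (xcoeff i (xcoeff j (?F * walk_kernel \<SS>))) n = fps_nth (xcoeff i (xcoeff j 1)) n"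
  proof (cases n)
    case 0
    then show ?thesis
      by (auto simp: eq lookup_minus lookup_gf_xy[OF fin] num_walks_avoiding_0 lookup_one when_def)
  next
    case (Suc m)
    have "real (?N (Suc m) (i, j)) = (\<Sum>(a, b)\<in>\<SS>. real (?N m (i - a, j - b)))"
      using assms by (simp add: num_walks_avoiding_Suc case_prod_beta' minus_prod_def)
    then show ?thesis
      by (simp add: eq Suc lookup_minus lookup_gf_xy[OF fin] lookup_step_poly_mult)
  qed
qed

lemma walks_eq: "walks \<SS> = avoiding_walks \<SS> {}"
  by (simp add: avoiding_walks_def)

lemma gf_walks_mult_kernel:
  assumes "finite \<SS>"
  shows "gf_xy (walks \<SS>) * walk_kernel \<SS> = 1"
  unfolding walks_eq by (intro laurent_fps_eqI) (simp add: kernel_equation[OF assms])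

lemma supp_in_0_eq_lift: "supp_in {0} f \<Longrightarrow> f = fps_lift (xcoeff 0 f)"
  by (rule laurent_fps_eqI) (auto simp: supp_in_iff xcoeff_lift)

text \<open>As \<open>H\<close> lies on the axis, the defect \<open>T\<close> is free of
  \<open>y\<close>, so it passes through the extraction of \<open>y^0\<close> like a scalar.\<close>

lemma avoiding_axis_factor:
  assumes "finite \<SS>" "H = {(i, 0) | i. i \<in> A}"
  obtains \<tau> where "fps_nth \<tau> 0 = 0" "supp_in A \<tau>"
    "gf_xy (avoiding_walks \<SS> H) = (1 - fps_lift \<tau>) * gf_xy (walks \<SS>)"
    "xcoeff 0 (gf_xy (avoiding_walks \<SS> H)) = (1 - \<tau>) * xcoeff 0 (gf_xy (walks \<SS>))"
proof -
  let ?F = "gf_xy (avoiding_walks \<SS> H)" and ?W = "gf_xy (walks \<SS>)"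
  define T where "T = 1 - ?F * walk_kernel \<SS>"
  define \<tau> where "\<tau> = xcoeff 0 T"
  have *: "xcoeff i (xcoeff j T) = 0" if "(i, j) \<notin> H" for i j
    using kernel_equation[OF assms(1) that] by (simp add: T_def xcoeff_diff)
  have "supp_in {0} T"
    unfolding supp_in_iff by (intro allI impI laurent_fps_eqI) (use * assms(2) in auto)
  then have T: "T = fps_lift \<tau>"
    unfolding \<tau>_def by (rule supp_in_0_eq_lift)
  have "?F = ?F * (?W * walk_kernel \<SS>)"
    by (simp add: gf_walks_mult_kernel[OF assms(1)])
  also have "\<dots> = (1 - T) * ?W"
    by (simp add: T_def algebra_simps)
  finally have F: "?F = (1 - fps_lift \<tau>) * ?W"
    unfolding T .
  show thesis
  proof (rule that[OF _ _ F])
    show "supp_in A \<tau>"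
      unfolding supp_in_iff \<tau>_def using * assms(2) by auto
    have "fps_nth ?F 0 = 1"
      by (intro poly_mapping_eqI)
         (auto simp: lookup_gf_xy[OF finite_endpoints[OF assms(1)]] num_walks_avoiding_0 lookup_one when_def)
    then have "fps_nth T 0 = 0"
      by (simp add: T_def walk_kernel_eq)
    then show "fps_nth \<tau> 0 = 0"
      by (simp add: \<tau>_def)
    show "xcoeff 0 ?F = (1 - \<tau>) * xcoeff 0 ?W"
      unfolding F by (simp add: xcoeff_diff xcoeff_lift_mult algebra_simps)
  qed
qed

lemma num_walks_restrict:
  assumes "\<And>w. last w = p \<Longrightarrow> w \<in> V \<longleftrightarrow> w \<in> W"
  shows "num_walks V n p = num_walks W n p"
proof -
  have "walks_to V n p = walks_to W n p" using assms by (auto simp: walks_to_def)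
  then show ?thesis by (simp add: num_walks_eq)
qed

lemma gf_x_cong:
  assumes "\<And>w i. last w = (i, 0) \<Longrightarrow> w \<in> V \<longleftrightarrow> w \<in> W"
  shows "gf_x V = gf_x W"
proof -
  have "num_walks V n (i, 0) = num_walks W n (i, 0)" for n i
    by (rule num_walks_restrict) (rule assms)
  then show ?thesis by (simp add: gf_x_def)
qed

lemma gf_x_avoiding: "finite \<SS> \<Longrightarrow> gf_x (avoiding_walks \<SS> H) = xcoeff 0 (gf_xy (avoiding_walks \<SS> H))"
  by (rule gf_x_eq_xcoeff) (rule finite_endpoints)

lemma gf_bilateral: "finite \<SS> \<Longrightarrow> gf_x (bilateral_walks \<SS>) = xcoeff 0 (gf_xy (walks \<SS>))"
  using gf_x_cong[of "bilateral_walks \<SS>" "walks \<SS>"] gf_x_avoiding[of \<SS> "{}"]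
  by (simp add: bilateral_walks_def bilateral_def walks_eq)

definition slit :: "(int \<times> int) set" where "slit = {(i, 0) | i. i \<in> {..0}}"

definition open_slit :: "(int \<times> int) set" where "open_slit = {(i, 0) | i. i \<in> {..<0}}"

lemma slit_walks_eq: "slit_walks \<SS> = avoiding_walks \<SS> slit"
  by (auto simp: slit_walks_def avoiding_walks_def on_slit_plane_def slit_def)

lemma gf_bilateral_slit:
  assumes "finite \<SS>"
  shows "gf_x (bilateral_slit_walks \<SS>) = xcoeff 0 (gf_xy (avoiding_walks \<SS> slit))"
proof -
  have "gf_x (bilateral_slit_walks \<SS>) = gf_x (slit_walks \<SS>)"
    by (rule gf_x_cong) (simp add: bilateral_slit_walks_def slit_walks_def bilateral_def)
  then show ?thesis
    unfolding slit_walks_eq gf_x_avoiding[OF assms] .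
qed

lemma gf_loops:
  assumes "finite \<SS>"
  shows "gf_t (loops \<SS>) = xcoeff 0 (xcoeff 0 (gf_xy (avoiding_walks \<SS> open_slit)))"
proof -
  have "num_walks (loops \<SS>) n (0, 0) = num_walks (avoiding_walks \<SS> open_slit) n (0, 0)" for n
  proof (rule num_walks_restrict)
    fix w :: "(int \<times> int) list" assume "last w = (0, 0)"
    \<comment> \<open>The index 0 makes no difference: the origin is not on the open slit.\<close>
    have "(\<forall>k\<in>{0..walk_length w}. w ! k \<notin> {(i, 0) |i. i < 0}) \<longleftrightarrow>
        (\<forall>k\<in>{1..walk_length w}. w ! k \<notin> open_slit)" if "w ! 0 = (0, 0)"
    proof -
      have "{0..walk_length w} = insert 0 {1..walk_length w}" by auto
      then show ?thesis using that by (simp add: open_slit_def)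
    qed
    then show "w \<in> loops \<SS> \<longleftrightarrow> w \<in> avoiding_walks \<SS> open_slit"
      using \<open>last w = (0, 0)\<close> by (auto simp: loops_def avoiding_walks_def walks_def is_loop_def)
  qed
  then show ?thesis
    by (simp add: fps_eq_iff gf_t_def lookup_gf_xy[OF finite_endpoints[OF assms]])
qed

section \<open>Comparing signs of exponents in the factorization\<close>

lemma supp_in_0I: "supp_in {0..} f \<Longrightarrow> supp_in {..0} f \<Longrightarrow> supp_in {0} f"
  unfolding supp_in_def by (metis Int_greatest atLeastAtMost_def atLeastAtMost_singleton)

text \<open>A Liouville argument: \<open>u\<close> has nonpositive exponents by assumption and
  nonnegative ones as \<open>w / v\<close>, so it is free of \<open>x\<close>.\<close>

lemma nonpos_factor_eq_lift:
  fixes u v w :: "'a::comm_ring_1 laurent fps"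
  assumes "u * v = w" "supp_in {..0} u" "supp_in {0..} v" "supp_in {0..} w" "fps_nth v 0 = 1"
  shows "u = fps_lift (xcoeff 0 u)"
proof -
  have "u = u * (v * fps_recip v)"
    by (simp add: fps_recip[OF assms(5)])
  also have "\<dots> = w * fps_recip v"
    by (simp add: assms(1)[symmetric] mult.assoc)
  also have "supp_in {0..} \<dots>"
    by (intro supp_in_nonneg_mult assms supp_in_recip) auto
  finally have "supp_in {0} u"
    using assms(2) by (rule supp_in_0I)
  then show ?thesis
    by (rule supp_in_0_eq_lift)
qed

lemma slit_plane_factorization:
  assumes "finite \<SS>" and B: "canonical_factorization (gf_x (bilateral_walks \<SS>)) B0 Bp Bm"
  shows "gf_t (loops \<SS>) = B0" "gf_x (bilateral_slit_walks \<SS>) = Bp"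
    "gf_xy (slit_walks \<SS>) * (walk_kernel \<SS> * fps_lift (fps_lift B0) * fps_lift Bm) = 1"
proof -
  let ?W = "gf_xy (walks \<SS>)"
  let ?S = "gf_xy (avoiding_walks \<SS> slit)" and ?L = "gf_xy (avoiding_walks \<SS> open_slit)"
  have fact: "xcoeff 0 ?W = fps_lift B0 * Bp * Bm"
    and Bp: "supp_in {0..} Bp" "fps_nth Bp 0 = 1" "xcoeff 0 Bp = 1"
    and Bm: "supp_in {..0} Bm" "fps_nth Bm 0 = 1" "xcoeff 0 Bm = 1"
    and B0: "fps_nth B0 0 = 1"
    using B unfolding canonical_factorization_def gf_bilateral[OF assms(1)]
    by (simp_all add: supp_in_def xcoeff_def)
  have vanish: "Poly_Mapping.lookup (fps_nth (xcoeff 0 (gf_xy (avoiding_walks \<SS> H))) n) i = (if n = 0 \<and> i = 0 then 1 else 0)"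
    if "(i, 0) \<in> H \<or> n = 0" for H i n
    using that by (cases n)
      (auto simp: lookup_gf_xy[OF finite_endpoints[OF assms(1)]] num_walks_avoiding_0 num_walks_avoiding_Suc[OF assms(1)])

  obtain \<tau> where \<tau>: "supp_in {..0} \<tau>" "?S = (1 - fps_lift \<tau>) * ?W" "xcoeff 0 ?S = (1 - \<tau>) * xcoeff 0 ?W"
    using avoiding_axis_factor[OF assms(1) slit_def] by metis
  \<comment> \<open>What is left of the slit series on the axis after dividing by \<open>Bp\<close>.
    Only the empty walk ends on the closed slit, so the product \<open>U * Bp\<close> has no
    negative exponents and constant coefficient 1 in \<open>x\<close>; this forces
    \<open>U = 1\<close>.\<close>
  define U where "U = (1 - \<tau>) * fps_lift B0 * Bm"
  have US: "U * Bp = xcoeff 0 ?S"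
    by (simp add: U_def \<tau>(3) fact algebra_simps)
  have suppU: "supp_in {..0} U"
    unfolding U_def by (intro supp_in_nonpos_mult supp_in_diff supp_in_1 supp_in_lift \<tau> Bm) auto
  have suppS: "supp_in {0..} (xcoeff 0 ?S)"
    unfolding supp_in_iff fps_eq_iff xcoeff_nth[of _ "xcoeff 0 _"] by (auto simp: vanish slit_def open_slit_def simp del: xcoeff_nth)
  have S0: "xcoeff 0 (xcoeff 0 ?S) = 1"
    unfolding fps_eq_iff xcoeff_nth[of _ "xcoeff 0 _"] by (auto simp: vanish slit_def open_slit_def simp del: xcoeff_nth)
  have U_lift: "U = fps_lift (xcoeff 0 U)"
    by (rule nonpos_factor_eq_lift[OF US suppU Bp(1) suppS Bp(2)])
  then have "xcoeff 0 (U * Bp) = xcoeff 0 U * xcoeff 0 Bp"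
    by (metis xcoeff_lift_mult)
  then have U: "U = 1"
    using U_lift by (simp add: US S0 Bp)
  show "gf_x (bilateral_slit_walks \<SS>) = Bp"
    using US by (simp add: U gf_bilateral_slit[OF assms(1)])
  have liftU: "fps_lift U = (1 - fps_lift \<tau>) * fps_lift (fps_lift B0) * fps_lift Bm"
    by (simp add: U_def fps_lift_mult fps_lift_diff)
  have "?S * (walk_kernel \<SS> * fps_lift (fps_lift B0) * fps_lift Bm) = (?W * walk_kernel \<SS>) * fps_lift U"
    unfolding \<tau>(2) liftU by (simp only: mult_ac)
  then show "gf_xy (slit_walks \<SS>) * (walk_kernel \<SS> * fps_lift (fps_lift B0) * fps_lift Bm) = 1"
    by (simp add: U gf_walks_mult_kernel[OF assms(1)] slit_walks_eq)

  obtain \<sigma> where \<sigma>: "supp_in {..<0} \<sigma>" "xcoeff 0 ?L = (1 - \<sigma>) * xcoeff 0 ?W"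
    using avoiding_axis_factor[OF assms(1) open_slit_def] by metis
  have \<sigma>': "supp_in {..0} \<sigma>" by (rule supp_in_mono[OF \<sigma>(1)]) auto
  have \<sigma>0: "xcoeff 0 \<sigma> = 0" using \<sigma>(1) by (simp add: supp_in_iff)
  have supp1: "supp_in {..0} (1 - \<sigma>)" by (intro supp_in_diff supp_in_1 \<sigma>') auto
  \<comment> \<open>Loops may return to the origin, so the coefficient of \<open>x^0\<close> in the
    product is not known in advance. It is the nonpositive factor whose constant coefficient is
    known: \<sigma> has only negative exponents, which gives 1. Hence \<open>B0\<close> is grouped
    with \<open>Bp\<close>.\<close>
  have UL: "((1 - \<sigma>) * Bm) * (fps_lift B0 * Bp) = xcoeff 0 ?L"
    by (simp add: \<sigma>(2) fact algebra_simps)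
  have "(1 - \<sigma>) * Bm = fps_lift (xcoeff 0 ((1 - \<sigma>) * Bm))"
  proof (rule nonpos_factor_eq_lift[OF UL])
    show "supp_in {..0} ((1 - \<sigma>) * Bm)" by (intro supp_in_nonpos_mult supp1 Bm)
    show "supp_in {0..} (fps_lift B0 * Bp)" by (intro supp_in_nonneg_mult supp_in_lift Bp) auto
    show "supp_in {0..} (xcoeff 0 ?L)"
      unfolding supp_in_iff fps_eq_iff xcoeff_nth[of _ "xcoeff 0 _"] by (auto simp: vanish slit_def open_slit_def simp del: xcoeff_nth)
    show "fps_nth (fps_lift B0 * Bp) 0 = 1" by (simp add: B0 Bp)
  qed
  also have "xcoeff 0 ((1 - \<sigma>) * Bm) = 1"
    by (subst xcoeff_0_mult) (use supp1 Bm \<sigma>0 in \<open>auto simp: xcoeff_diff xcoeff_1\<close>)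
  finally have "xcoeff 0 ?L = fps_lift B0 * Bp"
    using UL by simp
  then show "gf_t (loops \<SS>) = B0"
    by (simp add: gf_loops[OF assms(1)] xcoeff_lift_mult Bp)
qed


subsection \<open>Wiener--Hopf factorization of the kernel\<close>

definition restrict_keys :: "int set \<Rightarrow> 'a::comm_monoid_add laurent \<Rightarrow> 'a laurent" where
  "restrict_keys A p = (\<Sum>k\<in>Poly_Mapping.keys p \<inter> A. Poly_Mapping.single k (Poly_Mapping.lookup p k))"

lemma lookup_restrict_keys:
  "Poly_Mapping.lookup (restrict_keys A p) k = (if k \<in> A then Poly_Mapping.lookup p k else 0)"
  unfolding restrict_keys_def by (subst lookup_sum_singles) (auto simp: in_keys_iff)

lemma keys_restrict_keys: "Poly_Mapping.keys (restrict_keys A p) = Poly_Mapping.keys p \<inter> A"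
  by (auto simp: in_keys_iff lookup_restrict_keys split: if_splits)

text \<open>The sum of the \<open>n\<close>-th coefficients of the two factors. In a product of
  series with constant coefficient 1 this is what remains after removing the mixed terms, and the
  sign of the exponents separates the two summands; exponent 0 goes to the second.\<close>

fun wh_coeff :: "'a::comm_ring_1 laurent fps \<Rightarrow> nat \<Rightarrow> 'a laurent" where
  "wh_coeff f n = fps_nth f n -
    (\<Sum>i\<in>{1..<n}. restrict_keys {..<0} (wh_coeff f i) * restrict_keys {0..} (wh_coeff f (n - i)))"

declare wh_coeff.simps [simp del]

text \<open>Direct recursion instead of splitting a logarithm: it works over any commutative ring
  and keeps the exponent bounds visible, which later makes both factors polynomials after a
  shift.\<close>

lemma wiener_hopf:
  fixes f :: "'a::comm_ring_1 laurent fps"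
  assumes f: "fps_nth f 0 = 1" "supp_in {- int a..int b} f"
  obtains g h where "f = g * h" "fps_nth g 0 = 1" "fps_nth h 0 = 1"
    "supp_in {- int a..0} g" "xcoeff 0 g = 1" "supp_in {0..int b} h"
proof
  define r where "r = wh_coeff f"
  define g where "g = Abs_fps (\<lambda>n. if n = 0 then 1 else restrict_keys {..<0} (r n))"
  define h where "h = Abs_fps (\<lambda>n. if n = 0 then 1 else restrict_keys {0..} (r n))"
  have r: "r n = fps_nth f n - (\<Sum>i\<in>{1..<n}. restrict_keys {..<0} (r i) * restrict_keys {0..} (r (n - i)))" for n
    unfolding r_def by (subst wh_coeff.simps) rule
  have split: "restrict_keys {..<0} p + restrict_keys {0..} p = p" for p :: "'a laurent"
    by (rule poly_mapping_eqI) (simp add: lookup_add lookup_restrict_keys)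
  show "f = g * h"
  proof (rule fps_ext)
    fix n
    show "fps_nth f n = fps_nth (g * h) n"
    proof (cases "n = 0")
      case True
      then show ?thesis by (simp add: g_def h_def f)
    next
      case False
      then have "{0..n} = insert 0 (insert n {1..<n})" by auto
      then have "fps_nth (g * h) n = fps_nth g 0 * fps_nth h n + fps_nth g n * fps_nth h 0 +
          (\<Sum>i\<in>{1..<n}. fps_nth g i * fps_nth h (n - i))"
        using False by (simp add: fps_mult_nth add.assoc)
      also have "(\<Sum>i\<in>{1..<n}. fps_nth g i * fps_nth h (n - i)) =
          (\<Sum>i\<in>{1..<n}. restrict_keys {..<0} (r i) * restrict_keys {0..} (r (n - i)))"
        by (intro sum.cong) (auto simp: g_def h_def)
      also have "fps_nth g 0 * fps_nth h n + fps_nth g n * fps_nth h 0 = r n"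
        using False split[of "r n"] by (simp add: g_def h_def add.commute)
      finally show ?thesis
        unfolding r[of n] by simp
    qed
  qed
  \<comment> \<open>Exponents in \<open>[-a, -1]\<close> and \<open>[0, b]\<close> add up to
    exponents in \<open>[-a, b]\<close>, so the mixed terms respect the bounds of
    \<open>f\<close>.\<close>
  have keys: "Poly_Mapping.keys (r n) \<subseteq> {- int a..int b}" for n
  proof (induction n rule: less_induct)
    case (less n)
    have "Poly_Mapping.keys (\<Sum>i\<in>{1..<n}. restrict_keys {..<0} (r i) * restrict_keys {0..} (r (n - i)))
        \<subseteq> {- int a..int b}"
    proof (intro keys_sum_subset keys_mult_subset)
      fix i assume i: "i \<in> {1..<n}"
      show "Poly_Mapping.keys (restrict_keys {..<0} (r i)) \<subseteq> {- int a..<0}"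
        using less[of i] i by (force simp: keys_restrict_keys)
      show "Poly_Mapping.keys (restrict_keys {0..} (r (n - i))) \<subseteq> {0..int b}"
        using less[of "n - i"] i by (force simp: keys_restrict_keys)
    qed auto
    moreover have "Poly_Mapping.keys (fps_nth f n) \<subseteq> {- int a..int b}"
      using f(2) by (simp add: supp_in_def)
    ultimately show ?case
      unfolding r[of n] by (intro subset_trans[OF keys_diff] Un_least)
  qed
  show "supp_in {- int a..0} g" "supp_in {0..int b} h"
    using keys by (force simp: supp_in_def g_def h_def keys_restrict_keys)+
  show "xcoeff 0 g = 1"
    by (simp add: fps_eq_iff g_def lookup_restrict_keys)
qed (simp_all add: f)

lemma fps_X_eq_lift: "fps_X = fps_lift fps_X"
  by (simp add: fps_eq_iff fps_X_def)

text \<open>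
  The derivation rests on \<open>1/K = 1 - t K'/K\<close> for \<open>K = 1 - t P\<close>: the right-hand side is a logarithmic
  derivative, so it is additive over the factors of \<open>K\<close>.
\<close>

lemma bilateral_eq_log_derivative:
  fixes K :: "'a::comm_ring_1 laurent fps"
  assumes W: "W * K = 1" and K: "K - fps_X * fps_deriv K = 1" and gh: "K = g * h"
    and g: "fps_nth g 0 = 1" "supp_in {..0} g" "xcoeff 0 g = 1"
    and h: "fps_nth h 0 = 1" "supp_in {0..} h"
  shows "xcoeff 0 h * xcoeff 0 W = xcoeff 0 h - fps_X * fps_deriv (xcoeff 0 h)"
proof -
  let ?g = "fps_recip g" and ?h = "fps_recip h"
  have "W = W * ((g * ?g) * (h * ?h))"
    by (simp add: fps_recip g h)
  also have "\<dots> = (W * K) * (?g * ?h)"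
    by (simp add: gh mult_ac)
  finally have W_eq: "W = ?g * ?h"
    by (simp add: W)
  have "W = W * (K - fps_X * fps_deriv K)"
    by (simp add: K)
  also have "\<dots> = 1 - fps_X * (W * fps_deriv K)"
    using W by (simp add: algebra_simps)
  also have "W * fps_deriv K = (h * ?h) * (?g * fps_deriv g) + (g * ?g) * (?h * fps_deriv h)"
    unfolding W_eq gh by (simp add: algebra_simps)
  also have "\<dots> = ?g * fps_deriv g + ?h * fps_deriv h"
    by (simp add: fps_recip g h)
  finally have Weq: "W = 1 - fps_X * (?g * fps_deriv g + ?h * fps_deriv h)" .
  have sg: "supp_in {..0} ?g" and sh: "supp_in {0..} ?h"
    by (auto intro!: supp_in_recip g h)
  \<comment> \<open>The factor \<open>g\<close> contributes nothing to the constant coefficient,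
    since its own constant coefficient 1 has derivative 0.\<close>
  have "xcoeff 0 (?g * fps_deriv g) = xcoeff 0 ?g * xcoeff 0 (fps_deriv g)"
    by (rule xcoeff_0_mult) (use sg g(2) supp_in_fps_deriv in blast)
  then have g0: "xcoeff 0 (?g * fps_deriv g) = 0"
    by (simp add: xcoeff_fps_deriv g)
  have h0: "xcoeff 0 (?h * fps_deriv h) = xcoeff 0 ?h * fps_deriv (xcoeff 0 h)"
    using xcoeff_0_mult[of ?h "fps_deriv h"] sh h(2) by (simp add: xcoeff_fps_deriv supp_in_fps_deriv)
  have hh: "xcoeff 0 h * xcoeff 0 ?h = 1"
    using xcoeff_0_mult[of h ?h] sh h by (simp add: fps_recip xcoeff_1)
  have "xcoeff 0 (fps_X * u) = fps_X * xcoeff 0 u" for u :: "'a laurent fps"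
    by (subst fps_X_eq_lift) (rule xcoeff_lift_mult)
  then have "xcoeff 0 W = 1 - fps_X * (xcoeff 0 ?h * fps_deriv (xcoeff 0 h))"
    by (subst Weq) (simp add: xcoeff_diff xcoeff_add xcoeff_1 g0 h0)
  then have "xcoeff 0 h * xcoeff 0 W =
      xcoeff 0 h - fps_X * ((xcoeff 0 h * xcoeff 0 ?h) * fps_deriv (xcoeff 0 h))"
    by (simp only: right_diff_distrib mult_ac mult_1_left mult_1_right)
  then show ?thesis by (simp add: hh)
qed


subsection \<open>Algebraicity of the constant factor\<close>

lemma xcoeff_mult_nonneg:
  fixes f g :: "'a::comm_ring_1 laurent fps"
  assumes "supp_in {0..} f" "supp_in {0..} g"
  shows "xcoeff (int n) (f * g) = (\<Sum>i\<le>n. xcoeff (int i) f * xcoeff (int (n - i)) g)"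
proof -
  have *: "Poly_Mapping.lookup (p * q) (int n) =
      (\<Sum>i\<le>n. Poly_Mapping.lookup p (int i) * Poly_Mapping.lookup q (int (n - i)))"
    if "Poly_Mapping.keys p \<subseteq> {0..}" "Poly_Mapping.keys q \<subseteq> {0..}" for p q :: "'a laurent"
  proof -
    have "Poly_Mapping.lookup (p * q) (int n) =
        (\<Sum>i\<in>Poly_Mapping.keys p. Poly_Mapping.lookup p i * Poly_Mapping.lookup q (int n - i))"
      by (rule lookup_mult_sum)
    also have "\<dots> = (\<Sum>i\<in>Poly_Mapping.keys p \<union> int ` {..n}. Poly_Mapping.lookup p i * Poly_Mapping.lookup q (int n - i))"
      by (rule sum.mono_neutral_left) (auto simp: in_keys_iff)
    also have "\<dots> = (\<Sum>i\<in>int ` {..n}. Poly_Mapping.lookup p i * Poly_Mapping.lookup q (int n - i))"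
    proof (rule sum.mono_neutral_right)
      show "\<forall>i\<in>Poly_Mapping.keys p \<union> int ` {..n} - int ` {..n}.
          Poly_Mapping.lookup p i * Poly_Mapping.lookup q (int n - i) = 0"
      proof
        fix i assume i: "i \<in> Poly_Mapping.keys p \<union> int ` {..n} - int ` {..n}"
        then have "i \<ge> 0" using that(1) by auto
        then have "i > int n" using i by (metis DiffD2 atMost_iff image_eqI int_nat_eq nat_le_iff not_le)
        then have "int n - i \<notin> Poly_Mapping.keys q" using that(2) by auto
        then show "Poly_Mapping.lookup p i * Poly_Mapping.lookup q (int n - i) = 0"
          by (simp add: in_keys_iff)
      qed
    qed auto
    also have "\<dots> = (\<Sum>i\<le>n. Poly_Mapping.lookup p (int i) * Poly_Mapping.lookup q (int (n - i)))"
      by (subst sum.reindex) (auto simp: of_nat_diff intro!: sum.cong)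
    finally show ?thesis .
  qed
  have "fps_nth (xcoeff (int n) (f * g)) m = (\<Sum>j=0..m. \<Sum>i\<le>n.
      Poly_Mapping.lookup (fps_nth f j) (int i) * Poly_Mapping.lookup (fps_nth g (m - j)) (int (n - i)))" for m
    using assms by (simp add: fps_mult_nth lookup_sum * supp_in_def)
  then show ?thesis
    by (intro fps_ext) (simp add: fps_sum_nth fps_mult_nth sum.swap[of _ "{..n}"])
qed

lemma poly_of_bounded_supp:
  fixes f :: "'a::comm_ring_1 laurent fps"
  assumes "supp_in {0..int b} f"
  obtains p where "\<And>i. Polynomial.coeff p i = xcoeff (int i) f"
proof
  fix i
  have "Polynomial.coeff (\<Sum>j\<le>b. Polynomial.monom (xcoeff (int j) f) j) i = (if i \<le> b then xcoeff (int i) f else 0)"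
    by (simp add: coeff_sum)
  then show "Polynomial.coeff (\<Sum>j\<le>b. Polynomial.monom (xcoeff (int j) f) j) i = xcoeff (int i) f"
    using assms by (auto simp: supp_in_iff)
qed

lemma fract_alg_closure_embedding:
  "field_embedding (\<lambda>r. to_ac (ratfun_embed (r :: 'a::idom poly fract)))"
  by unfold_locales (simp_all add: ratfun_embed_add ratfun_embed_mult ratfun_embed_1)

text \<open>A shift by \<open>a\<close> turns \<open>K = g h\<close> into an equation
  \<open>Q = N M\<close> between polynomials in the outer variable. Roots of \<open>M\<close> are
  roots of \<open>Q\<close>, so they are algebraic over the rational functions, and
  \<open>M(0)\<close> is the leading coefficient of \<open>M\<close> times the product of the
  negated roots.\<close>

lemma constant_coeff_of_factor_algebraic:
  fixes K g h :: "'a::idom laurent fps"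
  assumes K: "K = g * h" "fps_nth K 0 = 1" "supp_in {- int a..int b} K"
    and Kpoly: "\<And>k. \<exists>p. xcoeff k K = fps_of_poly p"
    and g: "supp_in {- int a..0} g" "xcoeff 0 g = 1"
    and h: "supp_in {0..int b} h"
  obtains n p where "\<exists>i\<le>n. p i \<noteq> 0" "(\<Sum>i\<le>n. fps_of_poly (p i) * xcoeff 0 h ^ i) = 0"
proof -
  define emb where "emb = (\<lambda>r. to_ac (ratfun_embed (r :: 'a poly fract)))"
  interpret L: field_embedding emb
    unfolding emb_def by (rule fract_alg_closure_embedding)
  define \<iota> where "\<iota> = (\<lambda>f :: 'a fps. to_ac (to_fract f))"
  have \<iota>: "\<iota> 0 = 0" "\<iota> (u + v) = \<iota> u + \<iota> v" "\<iota> (u * v) = \<iota> u * \<iota> v" "\<iota> (fps_of_poly p) = emb (to_fract p)"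
    "\<iota> u = 0 \<longleftrightarrow> u = 0" for u v p
    by (simp_all add: \<iota>_def emb_def to_fract_poly)
  have \<iota>_sum: "\<iota> (sum u A) = (\<Sum>i\<in>A. \<iota> (u i))" for u and A :: "nat set"
    by (induction A rule: infinite_finite_induct) (simp_all add: \<iota>)
  have \<iota>_mult: "map_poly \<iota> (p * q) = map_poly \<iota> p * map_poly \<iota> q" for p q
    by (rule poly_eqI) (simp add: coeff_map_poly coeff_mult \<iota> \<iota>_sum)

  have supp_mult: "supp_in {0..int (a + c)} (x_monom (int a) * f)" if "supp_in {- int a..int c} f"
    for f :: "'a laurent fps" and c
    using that by (auto simp: supp_in_iff xcoeff_x_monom_mult)
  obtain Q where Q: "\<And>i. Polynomial.coeff Q i = xcoeff (int i) (x_monom (int a) * K)"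
    using poly_of_bounded_supp[OF supp_mult[OF K(3)]] by blast
  have g': "supp_in {0..int (a + 0)} (x_monom (int a) * g)"
    by (rule supp_mult) (use g in simp)
  obtain N where N: "\<And>i. Polynomial.coeff N i = xcoeff (int i) (x_monom (int a) * g)"
    using poly_of_bounded_supp[OF g'] by blast
  obtain M where M: "\<And>i. Polynomial.coeff M i = xcoeff (int i) h"
    using poly_of_bounded_supp[OF h] by blast
  have QNM: "Q = N * M"
  proof (rule poly_eqI)
    fix n
    have "Polynomial.coeff Q n = xcoeff (int n) ((x_monom (int a) * g) * h)"
      by (simp add: Q K(1) mult.assoc)
    also have "\<dots> = (\<Sum>i\<le>n. Polynomial.coeff N i * Polynomial.coeff M (n - i))"
      unfolding N M by (rule xcoeff_mult_nonneg) (use supp_in_mono[OF g'] supp_in_mono[OF h] in auto)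
    finally show "Polynomial.coeff Q n = Polynomial.coeff (N * M) n"
      by (simp add: coeff_mult)
  qed
  \<comment> \<open>\<open>N\<close> is monic of degree \<open>a\<close> because \<open>g\<close>
    has constant coefficient 1. So the leading coefficient of \<open>M\<close> is that of
    \<open>Q\<close>, a polynomial in \<open>t\<close>.\<close>
  have "Polynomial.coeff N a = 1" by (simp add: N xcoeff_x_monom_mult g)
  moreover have "Polynomial.coeff N i = 0" if "i > a" for i
    using g(1) that by (simp add: N xcoeff_x_monom_mult supp_in_iff)
  ultimately have "Polynomial.degree N = a" "Polynomial.lead_coeff N = 1"
    by (metis (full_types) degree_le leI le_degree le_less_linear order_antisym zero_neq_one)+
  then have lead: "Polynomial.lead_coeff M = Polynomial.lead_coeff Q"
    by (simp add: QNM lead_coeff_mult)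
  have "Polynomial.coeff Q a = xcoeff 0 K" by (simp add: Q xcoeff_x_monom_mult)
  moreover have "xcoeff 0 K \<noteq> 0"
    by (metis K(2) fps_zero_nth lookup_one_zero xcoeff_nth zero_neq_one)
  ultimately have "Q \<noteq> 0" by auto
  then have "M \<noteq> 0" using QNM by auto
  define m where "m = map_poly \<iota> M"
  have "m \<noteq> 0" unfolding m_def using \<open>M \<noteq> 0\<close> by (subst map_poly_eq_0_iff) (auto simp: \<iota>)
  then obtain A where A: "m = Polynomial.smult (Polynomial.lead_coeff m) (\<Prod>x\<in>#A. [:-x, 1:])"
    using alg_closed_imp_factorization[of m] by blast
  have coeffs: "\<exists>p. Polynomial.coeff Q i = fps_of_poly p" for i
    unfolding Q xcoeff_x_monom_mult by (rule Kpoly)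
  then obtain q where q: "\<And>i. Polynomial.coeff Q i = fps_of_poly (q i)"
    by metis
  have root: "L.algebraic s" if s: "poly m s = 0" for s
  proof -
    have "poly (map_poly \<iota> Q) s = 0"
      by (simp add: QNM \<iota>_mult m_def[symmetric] s)
    moreover have "Polynomial.degree (map_poly \<iota> Q) = Polynomial.degree Q"
      by (rule degree_map_poly) (simp_all add: \<iota>)
    ultimately have "(\<Sum>i\<le>Polynomial.degree Q. emb (to_fract (q i)) * s ^ i) = 0"
      by (simp add: poly_altdef coeff_map_poly \<iota> q)
    moreover have "to_fract (q (Polynomial.degree Q)) \<noteq> 0"
      using \<open>Q \<noteq> 0\<close> q[of "Polynomial.degree Q"] by auto
    ultimately show ?thesis
      unfolding L.algebraic_def by (intro exI[of _ "Polynomial.degree Q"] exI[of _ "\<lambda>i. to_fract (q i)"]) blast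
  qed
  have "poly m 0 = Polynomial.lead_coeff m * (\<Prod>x\<in>#A. - x)"
    by (subst A) (simp add: poly_prod_mset image_mset.compositionality o_def)
  moreover have "Polynomial.lead_coeff m = emb (to_fract (q (Polynomial.degree Q)))"
  proof -
    have "Polynomial.degree m = Polynomial.degree M"
      unfolding m_def by (rule degree_map_poly) (simp_all add: \<iota>)
    then have "Polynomial.lead_coeff m = \<iota> (Polynomial.lead_coeff M)"
      by (simp add: m_def coeff_map_poly \<iota>)
    then show ?thesis by (simp add: lead q \<iota>)
  qed
  moreover have "L.algebraic (- x)" if "x \<in># A" for x
  proof (rule L.algebraic_uminus[OF root])
    have "poly (\<Prod>x\<in>#A. [:-x, 1:]) x = 0"
      using that by (auto simp: poly_prod_mset prod_mset_zero_iff)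
    then show "poly m x = 0" by (subst A) simp
  qed
  ultimately have "L.algebraic (poly m 0)"
    by (auto intro!: L.algebraic_mult L.algebraic_emb L.algebraic_prod_mset)
  also have "poly m 0 = \<iota> (xcoeff 0 h)"
    using M[of 0] by (simp add: m_def poly_0_coeff_0 coeff_map_poly \<iota>)
  finally obtain n c where c: "\<exists>i\<le>n. c i \<noteq> 0" "(\<Sum>i\<le>n. emb (c i) * \<iota> (xcoeff 0 h) ^ i) = 0"
    unfolding L.algebraic_def by blast
  \<comment> \<open>The relation has rational coefficients; clearing denominators makes it a
    relation between series, which the injectivity of \<iota> brings back from the algebraic
    closure.\<close>
  obtain d p where d: "d \<noteq> 0" "\<forall>i\<in>{..n}. to_fract d * c i = to_fract (p i)"
    using common_denominator[of "{..n}" c] by auto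
  have \<iota>_pow: "\<iota> (u ^ i) = \<iota> u ^ i" for u i
    by (induction i) (simp_all add: \<iota>, simp add: \<iota>_def)
  have "\<iota> (\<Sum>i\<le>n. fps_of_poly (p i) * xcoeff 0 h ^ i) = (\<Sum>i\<le>n. emb (to_fract (p i)) * \<iota> (xcoeff 0 h) ^ i)"
    by (simp add: \<iota>_sum \<iota> \<iota>_pow)
  also have "\<dots> = (\<Sum>i\<le>n. emb (to_fract d) * (emb (c i) * \<iota> (xcoeff 0 h) ^ i))"
  proof (rule sum.cong)
    fix i assume "i \<in> {..n}"
    then have "to_fract (p i) = to_fract d * c i" using d by simp
    then show "emb (to_fract (p i)) * \<iota> (xcoeff 0 h) ^ i = emb (to_fract d) * (emb (c i) * \<iota> (xcoeff 0 h) ^ i)"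
      by (simp only: L.emb_mult mult.assoc)
  qed simp
  also have "\<dots> = 0"
    unfolding sum_distrib_left[symmetric] c(2) by simp
  finally have "(\<Sum>i\<le>n. fps_of_poly (p i) * xcoeff 0 h ^ i) = 0"
    by (simp add: \<iota>)
  moreover obtain i where "i \<le> n" "c i \<noteq> 0" using c(1) by blast
  then have "p i \<noteq> 0"
    using d by (metis atMost_iff mult_eq_0_iff to_fract_eq_0_iff)
  ultimately show ?thesis
    using that \<open>i \<le> n\<close> by blast
qed

lemma fps_of_poly_of_nat: "fps_of_poly (of_nat n) = of_nat n"
  by (induction n) (simp_all add: fps_of_poly_add)

text \<open>Powers below the degree of a minimal relation span a finite field extension. It is
  closed under every derivation because differentiating the relation expresses
  \<open>\<delta> f\<close> as a quotient of elements of that field.\<close>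

lemma algebraic_generates_finite_ring:
  fixes f :: "'a::{idom,ring_char_0} fps"
  assumes "\<exists>i\<le>n. p i \<noteq> 0" "(\<Sum>i\<le>n. fps_of_poly (p i) * f ^ i) = 0"
  obtains G where "finite G" "1 \<in> rat_span G" "f \<in> rat_span G"
    "\<And>u v. u \<in> G \<Longrightarrow> v \<in> G \<Longrightarrow> u * v \<in> rat_span G"
    "\<And>\<delta> u. ratfun_derivation \<delta> \<Longrightarrow> u \<in> G \<Longrightarrow> \<delta> u \<in> rat_span G"
proof -
  \<comment> \<open>The top coefficient is required to be nonzero, so the least such index is the
    degree of \<open>f\<close>.\<close>
  define P where "P = (\<lambda>n. \<exists>p. p n \<noteq> 0 \<and> (\<Sum>i\<le>n. fps_of_poly (p i) * f ^ i) = 0)"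
  have "\<exists>n. P n"
  proof -
    define N where "N = Max {i. i \<le> n \<and> p i \<noteq> 0}"
    have N: "N \<le> n" "p N \<noteq> 0" and Nmax: "\<And>i. i \<le> n \<Longrightarrow> p i \<noteq> 0 \<Longrightarrow> i \<le> N"
      using Max_in[of "{i. i \<le> n \<and> p i \<noteq> 0}"] assms(1) by (auto simp: N_def)
    have "(\<Sum>i\<le>n. fps_of_poly (p i) * f ^ i) = (\<Sum>i\<le>N. fps_of_poly (p i) * f ^ i)"
      by (rule sum.mono_neutral_right) (use N Nmax in force)+
    then show ?thesis
      unfolding P_def using N assms(2) by (intro exI[of _ N] exI[of _ p]) auto
  qed
  define d where "d = (LEAST n. P n)"
  have "P d" unfolding d_def using \<open>\<exists>n. P n\<close> by (rule LeastI_ex)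
  have least: "\<not> P m" if "m < d" for m using that unfolding d_def by (rule not_less_Least)
  obtain q where q: "q d \<noteq> 0" "(\<Sum>i\<le>d. fps_of_poly (q i) * f ^ i) = 0"
    using \<open>P d\<close> unfolding P_def by blast
  have "d > 0"
  proof (rule ccontr)
    assume "\<not> d > 0"
    then show False using q fps_of_poly_nonzero[of "q 0"] by simp
  qed
  define G where "G = (\<lambda>i. f ^ i) ` {..<d}"
  have top: "fps_of_poly (q d) * f ^ d = - (\<Sum>i<d. fps_of_poly (q i) * f ^ i)"
    using q(2) by (simp add: lessThan_Suc_atMost[symmetric] eq_neg_iff_add_eq_0 add.commute)
  have pow: "f ^ m \<in> rat_span G" for m
  proof (induction m rule: less_induct)
    case (less m)
    show ?case
    proof (cases "m < d")
      case True
      then show ?thesis by (intro rat_span_base) (auto simp: G_def)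
    next
      case False
      then obtain e where e: "m = d + e" using le_Suc_ex not_less by blast
      have "fps_of_poly (q d) * f ^ m = (fps_of_poly (q d) * f ^ d) * f ^ e"
        by (simp add: e power_add mult.assoc)
      also have "\<dots> = - (\<Sum>i<d. fps_of_poly (q i) * f ^ (i + e))"
        unfolding top by (simp add: sum_distrib_right power_add mult.assoc)
      also have "\<dots> \<in> rat_span G"
        by (intro rat_span_uminus rat_span_sum rat_span_poly_mult less) (simp add: e)
      finally show ?thesis by (rule rat_span_saturated[OF q(1)])
    qed
  qed
  have fin: "finite G" by (simp add: G_def)
  have one: "1 \<in> rat_span G" using pow[of 0] by simp
  have f: "f \<in> rat_span G" using pow[of 1] by simp
  have mult: "u * v \<in> rat_span G" if uv: "u \<in> G" "v \<in> G" for u v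
  proof -
    obtain i j where "u = f ^ i" "v = f ^ j" using uv unfolding G_def by blast
    then show ?thesis by (simp add: power_add[symmetric] pow)
  qed
  have deriv: "\<delta> u \<in> rat_span G" if \<delta>: "ratfun_derivation \<delta>" and u: "u \<in> G" for \<delta> u
  proof -
    have der: "derivation \<delta>" using \<delta> by (simp add: ratfun_derivation_def)
    obtain D where D: "\<And>p. \<delta> (fps_of_poly p) = fps_of_poly (D p)"
      using \<delta> unfolding ratfun_derivation_def by metis
    \<comment> \<open>The derivative of the minimal polynomial, evaluated at \<open>f\<close>. It is
      nonzero: in characteristic 0 its vanishing would be a relation of smaller degree.\<close>
    define h where "h = (\<Sum>i<d. fps_of_poly (of_nat (Suc i) * q (Suc i)) * f ^ i)"
    have "h \<noteq> 0"
    proof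
      assume "h = 0"
      obtain e where e: "d = Suc e" using \<open>d > 0\<close> gr0_implies_Suc by blast
      have "P e"
        unfolding P_def
      proof (intro exI[of _ "\<lambda>i. of_nat (Suc i) * q (Suc i)"] conjI)
        show "of_nat (Suc e) * q (Suc e) \<noteq> 0"
          using q(1) e by (simp del: of_nat_Suc)
        show "(\<Sum>i\<le>e. fps_of_poly (of_nat (Suc i) * q (Suc i)) * f ^ i) = 0"
          using \<open>h = 0\<close> by (simp add: h_def e lessThan_Suc_atMost)
      qed
      then show False using least[of e] e by simp
    qed
    have "0 = \<delta> (\<Sum>i\<le>d. fps_of_poly (q i) * f ^ i)"
      by (simp add: q derivation_0[OF der])
    also have "\<dots> = (\<Sum>i\<le>d. fps_of_poly (D (q i)) * f ^ i) + (\<Sum>i\<le>d. fps_of_poly (q i) * \<delta> (f ^ i))"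
      by (simp add: derivation_sum[OF der] derivation_mult[OF der] D sum.distrib)
    also have "(\<Sum>i\<le>d. fps_of_poly (q i) * \<delta> (f ^ i)) = (\<Sum>i<d. fps_of_poly (q (Suc i)) * \<delta> (f ^ Suc i))"
      unfolding lessThan_Suc_atMost[symmetric] sum.lessThan_Suc_shift
      by (simp add: derivation_1[OF der] del: power_Suc)
    also have "\<dots> = h * \<delta> f"
      unfolding h_def sum_distrib_right derivation_power[OF der] fps_of_poly_mult
      by (intro sum.cong) (simp_all add: fps_of_poly_of_nat mult_ac del: of_nat_Suc)
    finally have "h * \<delta> f = - (\<Sum>i\<le>d. fps_of_poly (D (q i)) * f ^ i)"
      by (simp add: eq_neg_iff_add_eq_0 add.commute)
    also have "\<dots> \<in> rat_span G"
      by (intro rat_span_uminus rat_span_sum rat_span_poly_mult pow)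
    finally have h\<delta>: "h * \<delta> f \<in> rat_span G" .
    have h: "h \<in> rat_span G"
      unfolding h_def by (intro rat_span_sum rat_span_poly_mult pow)
    have \<delta>f: "\<delta> f \<in> rat_span G"
      by (rule rat_span_exact_division[OF fin one mult h \<open>h \<noteq> 0\<close> h\<delta>])
    obtain i where i: "u = f ^ i" using u unfolding G_def by blast
    have "fps_of_poly (of_nat i) * (f ^ (i - 1) * \<delta> f) \<in> rat_span G"
      by (intro rat_span_poly_mult rat_span_mult[OF pow \<delta>f mult])
    then show ?thesis
      by (simp add: i derivation_power[OF der] fps_of_poly_of_nat mult.assoc)
  qed
  show ?thesis
    by (rule that[of G]) (fact fin one f mult deriv)+
qed


subsection \<open>Coefficients of D-finite series\<close>

text \<open>
  Lipshitz' argument. The elements \<open>t^i \<partial>\<^sub>t^j \<partial>\<^sub>x^l f\<close> with \<open>i, j, l < N\<close> number \<open>N^3\<close>, but after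
  multiplication by a fixed polynomial they lie in a real vector space of dimension \<open>O(N^2)\<close>. This
  yields a nonzero differential operator without \<open>x\<close> that annihilates \<open>f\<close>.
\<close>

abbreviation x_deriv :: "real laurent fps \<Rightarrow> real laurent fps" where
  "x_deriv \<equiv> fps_map laurent_deriv"

text \<open>One number bounds the degree in \<open>t\<close> and the exponents of \<open>x\<close>
  on both sides. Such series form a real space of dimension \<open>(d + 1) * (2 * d + 1)\<close>,
  quadratic in \<open>d\<close>.\<close>

definition box :: "nat \<Rightarrow> real laurent fps \<Rightarrow> bool" where
  "box d f \<longleftrightarrow> (\<forall>n>d. fps_nth f n = 0) \<and> supp_in {- int d..int d} f"

lemma box_mono: "box d f \<Longrightarrow> d \<le> e \<Longrightarrow> box e f"
  unfolding box_def by (auto intro: supp_in_mono)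

lemma box_add: "box d f \<Longrightarrow> box d g \<Longrightarrow> box d (f + g)"
  by (auto simp: box_def intro: supp_in_add)

lemma box_diff: "box d f \<Longrightarrow> box d g \<Longrightarrow> box d (f - g)"
  by (auto simp: box_def intro: supp_in_diff)

lemma box_0: "box d 0"
  by (simp add: box_def supp_in_def)

lemma box_mult:
  assumes "box d f" "box e g"
  shows "box (d + e) (f * g)"
  unfolding box_def
proof (intro conjI allI impI)
  fix n assume n: "n > d + e"
  have "fps_nth f i * fps_nth g (n - i) = 0" for i
    by (cases "i > d") (use assms n in \<open>auto simp: box_def\<close>)
  then show "fps_nth (f * g) n = 0"
    unfolding fps_mult_nth by (intro sum.neutral) blast
next
  show "supp_in {- int (d + e)..int (d + e)} (f * g)"
    by (rule supp_in_mult[of "{- int d..int d}" _ "{- int e..int e}"]) (use assms in \<open>auto simp: box_def\<close>)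
qed

lemma box_1: "box 0 1"
  by (auto simp: box_def supp_in_def)

lemma box_power: "box d f \<Longrightarrow> box (n * d) (f ^ n)"
  by (induction n) (auto simp: box_1 intro: box_mult)

lemma box_fps_X_power: "box i (fps_X ^ i)"
  by (auto simp: box_def supp_in_def fps_X_power_iff)

lemma box_of_nat: "box 0 (of_nat n)"
  by (induction n) (auto simp: box_0 box_1 intro: box_add)

lemma box_x_monom: "box (nat \<bar>k\<bar>) (x_monom k)"
  by (auto simp: box_def supp_in_def x_monom_def)

text \<open>The bound is generous; its form matches the \<open>x\<close>-derivative so that both
  satisfy the hypothesis of \<open>box_span_derivative\<close>.\<close>

lemma box_fps_deriv: "box d f \<Longrightarrow> box (d + 1) (fps_deriv f)"
  by (rule box_mono[of d]) (auto simp: box_def intro: supp_in_fps_deriv)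

lemma xcoeff_x_deriv: "xcoeff k (x_deriv f) = fps_const (of_int (k + 1)) * xcoeff (k + 1) f"
  by (simp add: fps_eq_iff lookup_laurent_deriv)

lemma box_x_deriv: "box d f \<Longrightarrow> box (d + 1) (x_deriv f)"
  unfolding box_def supp_in_iff xcoeff_x_deriv
  by (auto simp: derivation_0[OF derivation_laurent_deriv])

lemma box_poly: "\<exists>d. box d (fps_of_poly p)"
proof -
  let ?A = "\<Union>n\<le>Polynomial.degree p. Poly_Mapping.keys (Polynomial.coeff p n)"
  have fin: "finite ?A" by auto
  define d where "d = Polynomial.degree p + (\<Sum>k\<in>?A. nat \<bar>k\<bar>)"
  have "nat \<bar>k\<bar> \<le> d" if "k \<in> ?A" for k
    using member_le_sum[OF that _ fin, of "\<lambda>k. nat \<bar>k\<bar>"] by (simp add: d_def)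
  then have A: "?A \<subseteq> {- int d..int d}" by force
  have "Poly_Mapping.keys (Polynomial.coeff p n) \<subseteq> {- int d..int d}" for n
    by (cases "n \<le> Polynomial.degree p") (use A in \<open>auto simp: coeff_eq_0\<close>)
  then have "box d (fps_of_poly p)"
    by (auto simp: box_def supp_in_def coeff_eq_0 d_def)
  then show ?thesis ..
qed

lemma box_common:
  assumes "finite S" "\<And>f. f \<in> S \<Longrightarrow> \<exists>p. f = fps_of_poly p"
  obtains d where "\<And>f. f \<in> S \<Longrightarrow> box d f"
proof -
  have "\<forall>f\<in>S. \<exists>d. box d f" using assms(2) box_poly by blast
  then obtain D where D: "\<And>f. f \<in> S \<Longrightarrow> box (D f) f" by metis
  have "box (\<Sum>f\<in>S. D f) f" if "f \<in> S" for f
    by (rule box_mono[OF D[OF that]]) (use member_le_sum[OF that, of D] assms(1) in auto)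
  then show ?thesis using that by blast
qed

section \<open>Combinations with coefficients of bounded degree\<close>

definition box_span :: "real laurent fps set \<Rightarrow> nat \<Rightarrow> real laurent fps \<Rightarrow> bool" where
  "box_span G d f \<longleftrightarrow> (\<exists>p. (\<forall>h\<in>G. box d (p h)) \<and> f = (\<Sum>h\<in>G. p h * h))"

lemma box_span_mono: "box_span G d f \<Longrightarrow> d \<le> e \<Longrightarrow> box_span G e f"
  unfolding box_span_def using box_mono by blast

lemma box_span_add:
  assumes "box_span G d f" "box_span G d g"
  shows "box_span G d (f + g)"
proof -
  from assms obtain p q where "\<forall>h\<in>G. box d (p h)" "f = (\<Sum>h\<in>G. p h * h)" "\<forall>h\<in>G. box d (q h)" "g = (\<Sum>h\<in>G. q h * h)"
    unfolding box_span_def by blast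
  then show ?thesis
    unfolding box_span_def
    by (intro exI[of _ "\<lambda>h. p h + q h"]) (simp add: box_add sum.distrib distrib_right)
qed

lemma box_span_diff:
  assumes "box_span G d f" "box_span G d g"
  shows "box_span G d (f - g)"
proof -
  from assms obtain p q where "\<forall>h\<in>G. box d (p h)" "f = (\<Sum>h\<in>G. p h * h)" "\<forall>h\<in>G. box d (q h)" "g = (\<Sum>h\<in>G. q h * h)"
    unfolding box_span_def by blast
  then show ?thesis
    unfolding box_span_def
    by (intro exI[of _ "\<lambda>h. p h - q h"]) (simp add: box_diff sum_subtractf left_diff_distrib)
qed

lemma box_span_sum: "(\<And>i. i \<in> I \<Longrightarrow> box_span G d (f i)) \<Longrightarrow> box_span G d (sum f I)"
proof (induction I rule: infinite_finite_induct)
  case (insert x F)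
  then show ?case by (simp add: box_span_add)
qed (auto simp: box_span_def intro!: exI[of _ "\<lambda>_. 0"] box_0)

lemma box_span_mult:
  assumes "box c u" "box_span G d f"
  shows "box_span G (c + d) (u * f)"
proof -
  from assms(2) obtain p where "\<forall>h\<in>G. box d (p h)" "f = (\<Sum>h\<in>G. p h * h)"
    unfolding box_span_def by blast
  then show ?thesis
    unfolding box_span_def using assms(1)
    by (intro exI[of _ "\<lambda>h. u * p h"]) (simp add: box_mult sum_distrib_left mult.assoc)
qed

lemma box_span_base:
  assumes "finite G" "e \<in> G" "box d u"
  shows "box_span G d (u * e)"
  unfolding box_span_def
proof (intro exI[of _ "\<lambda>h. if h = e then u else 0"] conjI)
  have "(\<Sum>h\<in>G. (if h = e then u else 0) * h) = (\<Sum>h\<in>G. if h = e then u * e else 0)"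
    by (intro sum.cong) auto
  then show "u * e = (\<Sum>h\<in>G. (if h = e then u else 0) * h)"
    using assms by simp
qed (use assms box_0 in auto)

lemma rat_span_common_denominator:
  assumes "finite F" "finite G" "F \<subseteq> rat_span G"
  shows "\<exists>q. q \<noteq> 0 \<and> (\<forall>f\<in>F. \<exists>p. fps_of_poly q * f = (\<Sum>h\<in>G. fps_of_poly (p h) * h))"
  using assms(1,3)
proof (induction F rule: finite_induct)
  case empty
  then show ?case by (intro exI[of _ 1]) auto
next
  case (insert f F)
  then obtain q where q: "q \<noteq> 0" "\<And>g. g \<in> F \<Longrightarrow> \<exists>p. fps_of_poly q * g = (\<Sum>h\<in>G. fps_of_poly (p h) * h)"
    by auto
  obtain r p where r: "r \<noteq> 0" "fps_of_poly r * f = (\<Sum>h\<in>G. fps_of_poly (p h) * h)"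
    using insert.prems assms(2) by (auto elim: rat_spanE)
  have mult: "\<exists>p'. fps_of_poly (s * s') * g = (\<Sum>h\<in>G. fps_of_poly (p' h) * h)"
    if "fps_of_poly s * g = (\<Sum>h\<in>G. fps_of_poly (p h) * h)" for s s' g p
  proof (intro exI[of _ "\<lambda>h. s' * p h"])
    have "fps_of_poly (s * s') * g = fps_of_poly s' * (fps_of_poly s * g)"
      by (simp add: fps_of_poly_mult mult_ac)
    then show "fps_of_poly (s * s') * g = (\<Sum>h\<in>G. fps_of_poly (s' * p h) * h)"
      by (simp add: that sum_distrib_left fps_of_poly_mult mult.assoc)
  qed
  have "\<exists>p. fps_of_poly (q * r) * g = (\<Sum>h\<in>G. fps_of_poly (p h) * h)" if g: "g \<in> insert f F" for g
  proof (cases "g = f")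
    case True
    then show ?thesis using mult[OF r(2), of q] by (simp add: mult.commute)
  next
    case False
    then obtain p where "fps_of_poly q * g = (\<Sum>h\<in>G. fps_of_poly (p h) * h)"
      using q(2) g by blast
    then show ?thesis by (rule mult)
  qed
  moreover have "q * r \<noteq> 0" using q r by simp
  ultimately show ?case by blast
qed

text \<open>Each derivation costs one factor \<open>q\<close> and enlarges the box by the fixed
  amount \<open>D + 1\<close>: \<open>q^(j+1) \<delta> f\<close> is \<open>q \<delta>(q^j f)\<close>
  minus \<open>j (\<delta> q) q^j f\<close>. Growth that is linear in the order is what makes the
  dimension count succeed.\<close>

lemma box_span_derivative:
  assumes "finite G" and \<delta>: "derivation \<delta>"
    and box_\<delta>: "\<And>d p. box d p \<Longrightarrow> box (d + 1) (\<delta> p)"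
    and q: "box D q" and \<delta>G: "\<And>h. h \<in> G \<Longrightarrow> box_span G D (q * \<delta> h)"
    and f: "box_span G d (q ^ j * f)"
  shows "box_span G (d + (D + 1)) (q ^ Suc j * \<delta> f)"
proof -
  have *: "box_span G (d + (D + 1)) (q * \<delta> u)" if u: "box_span G d u" for u
  proof -
    obtain p where p: "\<And>h. h \<in> G \<Longrightarrow> box d (p h)" "u = (\<Sum>h\<in>G. p h * h)"
      using u unfolding box_span_def by blast
    have "q * \<delta> u = (\<Sum>h\<in>G. (q * \<delta> (p h)) * h + p h * (q * \<delta> h))"
      unfolding p(2) derivation_sum[OF \<delta>] derivation_mult[OF \<delta>] sum_distrib_left
      by (intro sum.cong) (simp_all add: algebra_simps)
    also have "box_span G (d + (D + 1)) \<dots>"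
    proof (intro box_span_sum box_span_add)
      fix h assume h: "h \<in> G"
      show "box_span G (d + (D + 1)) (q * \<delta> (p h) * h)"
        by (rule box_span_base[OF assms(1) h], rule box_mono[OF box_mult[OF q box_\<delta>[OF p(1)[OF h]]]]) simp
      show "box_span G (d + (D + 1)) (p h * (q * \<delta> h))"
        by (rule box_span_mono[OF box_span_mult[OF p(1)[OF h] \<delta>G[OF h]]]) simp
    qed
    finally show ?thesis .
  qed
  have "q * \<delta> (q ^ j) = of_nat j * \<delta> q * q ^ j"
  proof (cases j)
    case (Suc m)
    show ?thesis
      unfolding Suc derivation_power[OF \<delta>] by (simp add: mult_ac)
  qed (simp add: derivation_1[OF \<delta>])
  then have "q ^ Suc j * \<delta> f = q * \<delta> (q ^ j * f) - (of_nat j * \<delta> q) * (q ^ j * f)"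
    by (simp add: derivation_mult[OF \<delta>] distrib_left mult.assoc[symmetric])
  moreover have "box_span G (d + (D + 1)) ((of_nat j * \<delta> q) * (q ^ j * f))"
    using box_span_mult[OF box_mult[OF box_of_nat box_\<delta>[OF q]] f] by (simp add: add_ac)
  ultimately show ?thesis
    using box_span_diff[OF *[OF f]] by simp
qed

lemma real_combination_zero:
  fixes c :: "'i \<Rightarrow> real" and u :: "'i \<Rightarrow> real laurent fps"
  assumes "\<And>i. i \<in> I \<Longrightarrow> box d (u i)"
    and "\<And>n v. n \<le> d \<Longrightarrow> v \<in> {- int d..int d} \<Longrightarrow>
      (\<Sum>i\<in>I. c i * Poly_Mapping.lookup (fps_nth (u i) n) v) = 0"
  shows "(\<Sum>i\<in>I. fps_lift (fps_const (c i)) * u i) = 0"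
proof (intro fps_ext poly_mapping_eqI)
  fix n v
  have lift: "fps_nth (fps_lift (fps_const a) * w) n = laurent_const a * fps_nth w n" for a :: real and w
  proof -
    have "fps_lift (fps_const a) = fps_const (laurent_const a)"
      by (simp add: fps_eq_iff)
    then show ?thesis by simp
  qed
  have "(\<Sum>i\<in>I. c i * Poly_Mapping.lookup (fps_nth (u i) n) v) = 0"
  proof (cases "n \<le> d \<and> v \<in> {- int d..int d}")
    case True
    then show ?thesis using assms(2) by blast
  next
    case False
    have "Poly_Mapping.lookup (fps_nth (u i) n) v = 0" if "i \<in> I" for i
    proof (cases "n \<le> d")
      case True
      then have "v \<notin> Poly_Mapping.keys (fps_nth (u i) n)"
        using False assms(1)[OF that] unfolding box_def supp_in_def by blast
      then show ?thesis by (simp add: in_keys_iff)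
    next
      case False
      then show ?thesis using assms(1)[OF that] by (simp add: box_def)
    qed
    then show ?thesis by simp
  qed
  then show "Poly_Mapping.lookup (fps_nth (\<Sum>i\<in>I. fps_lift (fps_const (c i)) * u i) n) v =
      Poly_Mapping.lookup (fps_nth 0 n) v"
    by (simp add: fps_sum_nth lookup_sum lift lookup_laurent_const_mult)
qed

section \<open>The annihilating operator\<close>

abbreviation mixed_deriv :: "nat \<Rightarrow> nat \<Rightarrow> real laurent fps \<Rightarrow> real laurent fps" where
  "mixed_deriv j l f \<equiv> (fps_deriv ^^ j) ((x_deriv ^^ l) f)"

lemma lipshitz_relation:
  assumes G: "deriv_closed {fps_deriv, x_deriv} G" and e: "e \<in> G"
  obtains N c where "\<exists>i<N. \<exists>j<N. \<exists>l<N. c i j l \<noteq> (0::real)"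
    "(\<Sum>i<N. \<Sum>j<N. \<Sum>l<N. fps_lift (fps_const (c i j l)) * (fps_X ^ i * mixed_deriv j l (x_monom k * e))) = 0"
proof -
  have fin: "finite G" and closed: "\<And>g. g \<in> G \<Longrightarrow> fps_deriv g \<in> rat_span G \<and> x_deriv g \<in> rat_span G"
    using G by (auto simp: deriv_closed_def)
  let ?F = "fps_deriv ` G \<union> x_deriv ` G"
  have F: "finite ?F" "?F \<subseteq> rat_span G" using fin closed by auto
  obtain q' where q': "q' \<noteq> 0" "\<And>f. f \<in> ?F \<Longrightarrow> \<exists>p. fps_of_poly q' * f = (\<Sum>h\<in>G. fps_of_poly (p h) * h)"
    using rat_span_common_denominator[OF F(1) fin F(2)] by blast
  have "\<forall>f\<in>?F. \<exists>p. fps_of_poly q' * f = (\<Sum>h\<in>G. fps_of_poly (p h) * h)"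
    using q'(2) by (rule ballI)
  from bchoice[OF this]
  obtain P where P': "\<forall>f\<in>?F. fps_of_poly q' * f = (\<Sum>h\<in>G. fps_of_poly (P f h) * h)" ..
  have P: "fps_of_poly q' * f = (\<Sum>h\<in>G. fps_of_poly (P f h) * h)" if "f \<in> ?F" for f
    using P' that by (rule bspec)
  define q where "q = fps_of_poly q'"
  have "q \<noteq> 0" using q'(1) by (simp add: q_def fps_of_poly_nonzero)
  \<comment> \<open>One bound \<open>D\<close> for the common denominator and for all coefficients
    of the first-order system.\<close>
  let ?S = "insert q ((\<lambda>(f, h). fps_of_poly (P f h)) ` (?F \<times> G))"
  obtain D where D: "\<And>s. s \<in> ?S \<Longrightarrow> box D s"
    by (rule box_common[of ?S]) (use F(1) fin q_def in auto)
  have qD: "box D q" using D by simp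
  have qF: "box_span G D (q * f)" if "f \<in> ?F" for f
    unfolding box_span_def q_def P[OF that]
    by (intro exI[of _ "\<lambda>h. fps_of_poly (P f h)"] conjI ballI D refl) (use that in auto)
  define f0 where "f0 = x_monom k * e"
  define s where "s = nat \<bar>k\<bar>"
  have x_step: "box_span G (s + l * (D + 1)) (q ^ l * (x_deriv ^^ l) f0)" for l
  proof (induction l)
    case 0
    show ?case using box_span_base[OF fin e box_x_monom] by (simp add: f0_def s_def)
  next
    case (Suc l)
    have "box_span G (s + l * (D + 1) + (D + 1)) (q ^ Suc l * x_deriv ((x_deriv ^^ l) f0))"
      by (rule box_span_derivative[OF fin _ box_x_deriv qD _ Suc])
         (auto intro: qF derivation_fps_map derivation_laurent_deriv)
    then show ?case by (simp add: add_ac)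
  qed
  have t_step: "box_span G (s + (j + l) * (D + 1)) (q ^ (j + l) * mixed_deriv j l f0)" for j l
  proof (induction j)
    case 0
    show ?case using x_step[of l] by simp
  next
    case (Suc j)
    have "box_span G (s + (j + l) * (D + 1) + (D + 1)) (q ^ Suc (j + l) * fps_deriv (mixed_deriv j l f0))"
      by (rule box_span_derivative[OF fin derivation_fps_deriv box_fps_deriv qD _ Suc]) (auto intro: qF)
    then show ?case by (simp add: add_ac)
  qed
  \<comment> \<open>The box needed is at most \<open>N + 2 * N * (D + 1) + s\<close>, which is at
    most \<open>E\<close>. There are \<open>card G * (E + 1) * (2 * E + 1)\<close> equations, at
    most \<open>45 * card G * D1\<^sup>2 * N\<^sup>2\<close>, and \<open>N\<close> is chosen to make
    this less than the number \<open>N^3\<close> of unknowns.\<close>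
  define D1 where "D1 = D + 1 + s"
  define N where "N = 45 * card G * D1\<^sup>2 + 1"
  define E where "E = 4 * N * D1"
  have "N \<ge> 1" "D1 \<ge> 1" by (simp_all add: N_def D1_def)
  define m where "m = (\<lambda>(i, j, l). fps_X ^ i * mixed_deriv j l f0)"
  define I where "I = {..<N} \<times> {..<N} \<times> {..<N}"
  \<comment> \<open>The common factor \<open>q ^ (2 * N)\<close> clears all denominators at once, as
    the total order \<open>j + l\<close> stays below \<open>2 * N\<close>.\<close>
  have bs: "box_span G E (q ^ (2 * N) * (fps_X ^ i * mixed_deriv j l f0))" if "i < N" "j < N" "l < N" for i j l
  proof -
    have "q ^ (2 * N) = q ^ (2 * N - (j + l)) * q ^ (j + l)"
      using that by (simp add: power_add[symmetric])
    then have eq: "q ^ (2 * N) * (fps_X ^ i * mixed_deriv j l f0) =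
        (fps_X ^ i * q ^ (2 * N - (j + l))) * (q ^ (j + l) * mixed_deriv j l f0)"
      by (simp add: mult_ac)
    have "box_span G (i + (2 * N - (j + l)) * D + (s + (j + l) * (D + 1))) (q ^ (2 * N) * (fps_X ^ i * mixed_deriv j l f0))"
      unfolding eq by (intro box_span_mult t_step box_mult box_fps_X_power box_power qD)
    moreover have "i + (2 * N - (j + l)) * D + (s + (j + l) * (D + 1)) \<le> E"
    proof -
      have "(2 * N - (j + l)) * D \<le> (2 * N - (j + l)) * (D + 1)" by simp
      moreover have "(2 * N - (j + l)) * (D + 1) + (j + l) * (D + 1) = 2 * N * (D + 1)"
        using that by (simp add: add_mult_distrib[symmetric])
      moreover have "s \<le> N * s" using \<open>N \<ge> 1\<close> by simp
      moreover have "N \<le> N * (D + 1)" by simp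
      moreover have "E = 4 * (N * (D + 1)) + 4 * (N * s)" by (simp add: E_def D1_def algebra_simps)
      ultimately show ?thesis using that(1) by linarith
    qed
    ultimately show ?thesis by (rule box_span_mono)
  qed
  have "\<forall>\<alpha>\<in>I. \<exists>p. (\<forall>h\<in>G. box E (p h)) \<and> q ^ (2 * N) * m \<alpha> = (\<Sum>h\<in>G. p h * h)"
    using bs unfolding box_span_def I_def m_def by auto
  from bchoice[OF this] obtain p where
    p: "\<forall>\<alpha>\<in>I. (\<forall>h\<in>G. box E (p \<alpha> h)) \<and> q ^ (2 * N) * m \<alpha> = (\<Sum>h\<in>G. p \<alpha> h * h)" ..
  define J where "J = G \<times> {..E} \<times> {- int E..int E}"
  have "card J = card G * ((E + 1) * (2 * E + 1))"
    by (simp add: J_def card_cartesian_product nat_add_distrib nat_mult_distrib)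
  also have "\<dots> \<le> card G * ((5 * N * D1) * (9 * N * D1))"
  proof (intro mult_le_mono le_refl)
    have "1 \<le> N * D1" using \<open>N \<ge> 1\<close> \<open>D1 \<ge> 1\<close> by simp
    then show "E + 1 \<le> 5 * N * D1" "2 * E + 1 \<le> 9 * N * D1"
      by (simp_all add: E_def)
  qed
  also have "\<dots> = N * N * (45 * card G * D1\<^sup>2)"
    by (simp add: power2_eq_square algebra_simps)
  also have "\<dots> < N * N * N"
    using \<open>N \<ge> 1\<close> by (intro mult_strict_left_mono) (simp_all add: N_def)
  also have "\<dots> = card I"
    by (simp add: I_def card_cartesian_product)
  finally have "card J < card I" .
  then obtain c where c: "\<exists>\<alpha>\<in>I. c \<alpha> \<noteq> (0::real)"
    "\<forall>\<beta>\<in>J. (\<Sum>\<alpha>\<in>I. c \<alpha> * Poly_Mapping.lookup (fps_nth (p \<alpha> (fst \<beta>)) (fst (snd \<beta>))) (snd (snd \<beta>))) = 0"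
    using homogeneous_system_nontrivial[of J I "\<lambda>\<alpha> \<beta>.
       Poly_Mapping.lookup (fps_nth (p \<alpha> (fst \<beta>)) (fst (snd \<beta>))) (snd (snd \<beta>))"] fin
    unfolding I_def J_def by blast
  have zero: "(\<Sum>\<alpha>\<in>I. fps_lift (fps_const (c \<alpha>)) * p \<alpha> h) = 0" if "h \<in> G" for h
  proof (rule real_combination_zero[of _ E])
    show "box E (p \<alpha> h)" if "\<alpha> \<in> I" for \<alpha>
      using that \<open>h \<in> G\<close> p by blast
    fix n v assume "n \<le> E" "v \<in> {- int E..int E}"
    then have "(h, n, v) \<in> J" using \<open>h \<in> G\<close> by (simp add: J_def)
    from c(2)[rule_format, OF this] show "(\<Sum>\<alpha>\<in>I. c \<alpha> * Poly_Mapping.lookup (fps_nth (p \<alpha> h) n) v) = 0"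
      by simp
  qed
  have "q ^ (2 * N) * (\<Sum>\<alpha>\<in>I. fps_lift (fps_const (c \<alpha>)) * m \<alpha>) =
      (\<Sum>\<alpha>\<in>I. fps_lift (fps_const (c \<alpha>)) * (q ^ (2 * N) * m \<alpha>))"
    by (simp add: sum_distrib_left mult_ac)
  also have "\<dots> = (\<Sum>\<alpha>\<in>I. fps_lift (fps_const (c \<alpha>)) * (\<Sum>h\<in>G. p \<alpha> h * h))"
    by (intro sum.cong) (use p in simp_all)
  also have "\<dots> = (\<Sum>h\<in>G. (\<Sum>\<alpha>\<in>I. fps_lift (fps_const (c \<alpha>)) * p \<alpha> h) * h)"
    unfolding sum_distrib_left sum_distrib_right
    by (subst sum.swap) (simp add: mult.assoc)
  also have "\<dots> = 0"
    using zero by simp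
  finally have "(\<Sum>\<alpha>\<in>I. fps_lift (fps_const (c \<alpha>)) * m \<alpha>) = 0"
    using \<open>q \<noteq> 0\<close> by simp
  then have "(\<Sum>i<N. \<Sum>j<N. \<Sum>l<N. fps_lift (fps_const (c (i, j, l))) * (fps_X ^ i * mixed_deriv j l f0)) = 0"
    unfolding I_def sum.cartesian_product[symmetric] by (simp add: m_def sum.cartesian_product case_prod_beta')
  moreover have "\<exists>i<N. \<exists>j<N. \<exists>l<N. c (i, j, l) \<noteq> 0"
    using c(1) by (auto simp: I_def)
  ultimately show ?thesis
    using that[of N "\<lambda>i j l. c (i, j, l)"] unfolding f0_def by blast
qed

section \<open>From the annihilating operator to an equation in \<open>t\<close>\<close>

lemma xcoeff_funpow_fps_deriv: "xcoeff k ((fps_deriv ^^ j) f) = (fps_deriv ^^ j) (xcoeff k f :: 'a::comm_ring_1 fps)"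
  by (induction j) (simp_all add: xcoeff_fps_deriv)

text \<open>The constant factor vanishes exactly for \<open>k\<close> between \<open>- l\<close> and
  \<open>- 1\<close>, the exponents that \<open>l\<close>-fold differentiation cannot
  produce.\<close>

lemma xcoeff_funpow_x_deriv:
  "xcoeff k ((x_deriv ^^ l) f) = fps_const (\<Prod>r\<in>{1..l}. of_int (k + int r)) * xcoeff (k + int l) f"
proof (induction l arbitrary: k)
  case (Suc l)
  have "(\<Prod>r\<in>{1..Suc l}. real_of_int (k + int r)) = of_int (k + 1) * (\<Prod>r\<in>{1..l}. of_int (k + 1 + int r))"
    by (subst prod.atLeast_Suc_atMost, simp, subst prod.shift_bounds_cl_Suc_ivl) (simp add: add_ac)
  then have "fps_const (\<Prod>r\<in>{1..Suc l}. real_of_int (k + int r)) =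
      fps_const (of_int (k + 1)) * fps_const (\<Prod>r\<in>{1..l}. of_int (k + 1 + int r))"
    by (simp only: fps_const_mult)
  moreover have "k + int (Suc l) = k + 1 + int l" by simp
  ultimately show ?case
    by (simp only: funpow.simps o_def xcoeff_x_deriv Suc[of "k + 1"] mult.assoc)
qed simp

lemma funpow_fps_deriv_const_mult: "(fps_deriv ^^ j) (fps_const c * f) = fps_const (c::'a::comm_ring_1) * (fps_deriv ^^ j) f"
  by (induction j) simp_all

text \<open>The derivatives below the highest order with nonzero coefficient form a closed set.
  Order 0 gives the empty set and \<open>g = 0\<close>.\<close>

lemma ode_imp_finite_rank:
  fixes g :: "'a::idom fps"
  assumes "\<exists>j<N. P j \<noteq> 0" "(\<Sum>j<N. fps_of_poly (P j) * (fps_deriv ^^ j) g) = 0"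
  shows "finite_rank {fps_deriv} g"
proof -
  define r where "r = Max {j. j < N \<and> P j \<noteq> 0}"
  have r: "r < N" "P r \<noteq> 0" and rmax: "\<And>j. j < N \<Longrightarrow> P j \<noteq> 0 \<Longrightarrow> j \<le> r"
    using Max_in[of "{j. j < N \<and> P j \<noteq> 0}"] assms(1) by (auto simp: r_def)
  have "(\<Sum>j<N. fps_of_poly (P j) * (fps_deriv ^^ j) g) = (\<Sum>j<Suc r. fps_of_poly (P j) * (fps_deriv ^^ j) g)"
  proof (rule sum.mono_neutral_right)
    show "\<forall>j\<in>{..<N} - {..<Suc r}. fps_of_poly (P j) * (fps_deriv ^^ j) g = 0"
      using rmax by fastforce
  qed (use r in auto)
  then have eq: "fps_of_poly (P r) * (fps_deriv ^^ r) g = - (\<Sum>j<r. fps_of_poly (P j) * (fps_deriv ^^ j) g)"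
    using assms(2) by (simp add: eq_neg_iff_add_eq_0 add.commute)
  define G where "G = (\<lambda>j. (fps_deriv ^^ j) g) ` {..<r}"
  have base: "(fps_deriv ^^ j) g \<in> rat_span G" if "j < r" for j
    by (rule rat_span_base) (use that in \<open>auto simp: G_def\<close>)
  have "fps_of_poly (P r) * (fps_deriv ^^ r) g \<in> rat_span G"
    unfolding eq by (intro rat_span_uminus rat_span_sum rat_span_poly_mult base) simp
  then have top: "(fps_deriv ^^ r) g \<in> rat_span G"
    by (rule rat_span_saturated[OF r(2)])
  have all: "(fps_deriv ^^ j) g \<in> rat_span G" if "j \<le> r" for j
    using base[of j] top that by (cases "j = r") auto
  have "deriv_closed {fps_deriv} G"
    unfolding deriv_closed_def
  proof (intro conjI ballI)
    fix \<delta> u :: "'a fps \<Rightarrow> 'a fps" and v assume "\<delta> \<in> {fps_deriv :: 'a fps \<Rightarrow> 'a fps}" "v \<in> G"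
    then obtain j where "j < r" "\<delta> v = (fps_deriv ^^ Suc j) g" by (auto simp: G_def)
    then show "\<delta> v \<in> rat_span G" using all[of "Suc j"] by simp
  qed (simp add: G_def)
  moreover have "g \<in> rat_span G" using all[of 0] by simp
  ultimately show ?thesis
    unfolding finite_rank_def by blast
qed

text \<open>
  Let \<open>a\<close> be the least order in \<open>\<partial>\<^sub>x\<close> that occurs in the annihilating operator. Since \<open>\<partial>\<^sub>x^l\<close> never produces
  \<open>x^(-1-a)\<close> for \<open>l > a\<close>, extracting that coefficient leaves an ordinary differential equation in \<open>t\<close>.
\<close>

lemma xcoeff_finite_rank:
  assumes "deriv_closed {fps_deriv, x_deriv} G" "e \<in> G"
  shows "finite_rank {fps_deriv} (xcoeff k e)"
proof -
  obtain N c where c: "\<exists>i<N. \<exists>j<N. \<exists>l<N. c i j l \<noteq> (0::real)"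
    and rel: "(\<Sum>i<N. \<Sum>j<N. \<Sum>l<N. fps_lift (fps_const (c i j l)) *
      (fps_X ^ i * mixed_deriv j l (x_monom (- 1 - k) * e))) = 0"
    by (rule lipshitz_relation[OF assms])
  \<comment> \<open>The shift places the coefficient under study at exponent -1, next to the
    exponents that derivatives miss.\<close>
  define f where "f = x_monom (- 1 - k) * e"
  define g where "g = xcoeff k e"
  have fg: "xcoeff (- 1) f = g" by (simp add: f_def g_def xcoeff_x_monom_mult)
  define a where "a = (LEAST l. l < N \<and> (\<exists>i<N. \<exists>j<N. c i j l \<noteq> 0))"
  have a: "a < N" "\<exists>i<N. \<exists>j<N. c i j a \<noteq> 0"
    using LeastI_ex[of "\<lambda>l. l < N \<and> (\<exists>i<N. \<exists>j<N. c i j l \<noteq> 0)"] c unfolding a_def by blast+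
  have below: "c i j l = 0" if "l < a" "i < N" "j < N" for i j l
    using not_less_Least[of l "\<lambda>l. l < N \<and> (\<exists>i<N. \<exists>j<N. c i j l \<noteq> 0)"] that a(1) unfolding a_def by fastforce
  \<comment> \<open>For \<open>l > a\<close> the product contains the factor 0 at
    \<open>r = a + 1\<close>; for \<open>l = a\<close> it is \<open>a!\<close> up to sign.\<close>
  define w where "w = (\<lambda>l. \<Prod>r\<in>{1..l}. real_of_int (- 1 - int a + int r))"
  have w_above: "w l = 0" if "l > a" for l
    unfolding w_def by (rule prod_zero) (use that in \<open>auto intro!: bexI[of _ "Suc a"]\<close>)
  have w_a: "w a \<noteq> 0"
    unfolding w_def by (auto simp: prod_zero_iff)
  have summand: "xcoeff (- 1 - int a) (fps_lift (fps_const (c i j l)) * (fps_X ^ i * mixed_deriv j l f)) =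
      (if l = a then fps_const (w a * c i j a) * (fps_X ^ i * (fps_deriv ^^ j) g) else 0)" if "i < N" "j < N" for i j l
  proof -
    have lift: "fps_lift (fps_const (c i j l)) * (fps_X ^ i * u) = fps_lift (fps_const (c i j l) * fps_X ^ i) * u" for u
    proof -
      have "fps_lift (fps_X ^ i :: real fps) = fps_X ^ i"
        by (induction i) (simp_all add: fps_lift_mult fps_X_eq_lift[symmetric])
      then show ?thesis by (simp add: fps_lift_mult mult.assoc)
    qed
    have "xcoeff (- 1 - int a) (fps_lift (fps_const (c i j l)) * (fps_X ^ i * mixed_deriv j l f)) =
        fps_const (c i j l) * fps_X ^ i * (fps_const (w l) * (fps_deriv ^^ j) (xcoeff (- 1 - int a + int l) f))"
      unfolding lift xcoeff_lift_mult xcoeff_funpow_fps_deriv xcoeff_funpow_x_deriv w_def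
        funpow_fps_deriv_const_mult ..
    also have "\<dots> = (if l = a then fps_const (w a * c i j a) * (fps_X ^ i * (fps_deriv ^^ j) g) else 0)"
    proof (cases "l = a")
      case True
      then show ?thesis by (simp add: fg fps_const_mult[symmetric] mult_ac del: fps_const_mult)
    next
      case False
      then have "c i j l = 0 \<or> w l = 0" using below[of l i j] w_above[of l] \<open>i < N\<close> \<open>j < N\<close> by linarith
      then show ?thesis using False by auto
    qed
    finally show ?thesis .
  qed
  define P where "P = (\<lambda>j. \<Sum>i<N. Polynomial.monom (w a * c i j a) i)"
  have "0 = xcoeff (- 1 - int a) (\<Sum>i<N. \<Sum>j<N. \<Sum>l<N. fps_lift (fps_const (c i j l)) * (fps_X ^ i * mixed_deriv j l f))"
    using rel by (simp add: f_def)
  also have "\<dots> = (\<Sum>i<N. \<Sum>j<N. \<Sum>l<N.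
      if l = a then fps_const (w a * c i j a) * (fps_X ^ i * (fps_deriv ^^ j) g) else 0)"
    unfolding xcoeff_sum by (intro sum.cong refl summand) auto
  also have "\<dots> = (\<Sum>i<N. \<Sum>j<N. fps_const (w a * c i j a) * (fps_X ^ i * (fps_deriv ^^ j) g))"
    using a(1) by simp
  also have "\<dots> = (\<Sum>j<N. fps_of_poly (P j) * (fps_deriv ^^ j) g)"
    unfolding P_def fps_of_poly_sum sum_distrib_right fps_of_poly_monom
    by (subst sum.swap) (simp add: mult.assoc)
  finally have "(\<Sum>j<N. fps_of_poly (P j) * (fps_deriv ^^ j) g) = 0" by simp
  moreover have "\<exists>j<N. P j \<noteq> 0"
  proof -
    obtain i j where ij: "i < N" "j < N" "c i j a \<noteq> 0" using a(2) by blast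
    have "Polynomial.coeff (P j) i = w a * c i j a"
      using ij by (simp add: P_def coeff_sum)
    then have "P j \<noteq> 0" using ij w_a by auto
    then show ?thesis using ij by blast
  qed
  ultimately show ?thesis
    unfolding g_def[symmetric] by (rule ode_imp_finite_rank[rotated])
qed


subsection \<open>Lifting and nonnegative parts\<close>

lemma rat_span_lift:
  fixes f :: "'a::idom fps"
  assumes "f \<in> rat_span G" "finite G"
  shows "fps_lift f \<in> rat_span (fps_lift ` G)"
proof -
  obtain q p where q: "q \<noteq> 0" "fps_of_poly q * f = (\<Sum>h\<in>G. fps_of_poly (p h) * h)"
    using assms by (rule rat_spanE)
  obtain q' where q': "fps_lift (fps_of_poly q) = fps_of_poly q'" "q' \<noteq> 0"
    using fps_lift_poly[of q] q(1) by blast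
  have "fps_of_poly q' * fps_lift f = (\<Sum>h\<in>G. fps_lift (fps_of_poly (p h)) * fps_lift h)"
    using arg_cong[OF q(2), of fps_lift] by (simp add: fps_lift_mult fps_lift_sum q')
  also have "\<dots> \<in> rat_span (fps_lift ` G)"
  proof (rule rat_span_sum)
    fix h assume h: "h \<in> G"
    obtain p' where "fps_lift (fps_of_poly (p h)) = fps_of_poly p'" using fps_lift_poly by blast
    then show "fps_lift (fps_of_poly (p h)) * fps_lift h \<in> rat_span (fps_lift ` G)"
      using rat_span_poly_mult[OF rat_span_base[OF imageI[OF h]]] by simp
  qed
  finally show ?thesis by (rule rat_span_saturated[OF q'(2)])
qed

text \<open>A lifted series is constant in the new variable: its derivative there is 0, and the
  other derivations act as they did below.\<close>

lemma deriv_closed_lift: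
  fixes G :: "'a::idom fps set"
  assumes "deriv_closed \<Delta> G"
    and lift: "\<And>\<delta>. \<delta> \<in> \<Delta>' \<Longrightarrow> (\<forall>g. \<delta> (fps_lift g) = 0) \<or> (\<exists>\<epsilon>\<in>\<Delta>. \<forall>g. \<delta> (fps_lift g) = fps_lift (\<epsilon> g))"
  shows "deriv_closed \<Delta>' (fps_lift ` G)"
  unfolding deriv_closed_def
proof (intro conjI ballI)
  fix \<delta> u assume \<delta>: "\<delta> \<in> \<Delta>'" and "u \<in> fps_lift ` G"
  then obtain g where g: "g \<in> G" "u = fps_lift g" by blast
  from lift[OF \<delta>] show "\<delta> u \<in> rat_span (fps_lift ` G)"
  proof
    assume "\<exists>\<epsilon>\<in>\<Delta>. \<forall>g. \<delta> (fps_lift g) = fps_lift (\<epsilon> g)"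
    then obtain \<epsilon> where "\<epsilon> \<in> \<Delta>" "\<delta> u = fps_lift (\<epsilon> g)" using g by blast
    then show ?thesis using assms(1) g by (auto simp: deriv_closed_def intro: rat_span_lift)
  qed (use g in simp)
qed (use assms(1) in \<open>simp add: deriv_closed_def\<close>)

lemma finite_rank_lift:
  fixes f :: "'a::idom fps"
  assumes "finite_rank \<Delta> f"
    and lift: "\<And>\<delta>. \<delta> \<in> \<Delta>' \<Longrightarrow> (\<forall>g. \<delta> (fps_lift g) = 0) \<or> (\<exists>\<epsilon>\<in>\<Delta>. \<forall>g. \<delta> (fps_lift g) = fps_lift (\<epsilon> g))"
  shows "finite_rank \<Delta>' (fps_lift f)"
proof -
  obtain G where G: "deriv_closed \<Delta> G" "f \<in> rat_span G"
    using assms(1) unfolding finite_rank_def by blast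
  have "deriv_closed \<Delta>' (fps_lift ` G)"
    by (rule deriv_closed_lift[OF G(1) lift])
  moreover have "fps_lift f \<in> rat_span (fps_lift ` G)"
    using G by (auto simp: deriv_closed_def intro: rat_span_lift)
  ultimately show ?thesis
    unfolding finite_rank_def by blast
qed

lemma lift_commutes_t_xt:
  assumes "\<delta> \<in> {fps_deriv, x_deriv}"
  shows "(\<forall>g. \<delta> (fps_lift g) = 0) \<or> (\<exists>\<epsilon>\<in>{fps_deriv}. \<forall>g. \<delta> (fps_lift g) = fps_lift (\<epsilon> g))"
  using assms by (auto simp: fps_lift_fps_deriv fps_map_laurent_deriv_lift)

section \<open>Nonnegative parts and their commutators\<close>

definition nonneg_part :: "'a::comm_ring_1 laurent fps \<Rightarrow> 'a laurent fps" where
  "nonneg_part = fps_map (restrict_keys {0..})"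

lemma xcoeff_nonneg_part: "xcoeff k (nonneg_part f) = (if k \<ge> 0 then xcoeff k f else 0)"
  by (simp add: fps_eq_iff nonneg_part_def lookup_restrict_keys)

lemma nonneg_part_add: "nonneg_part (f + g) = nonneg_part f + nonneg_part g"
  by (rule laurent_fps_eqI) (simp add: xcoeff_nonneg_part xcoeff_add)

lemma nonneg_part_sum: "nonneg_part (sum f A) = (\<Sum>i\<in>A. nonneg_part (f i))"
proof (induction A rule: infinite_finite_induct)
  case (insert x F)
  then show ?case by (simp add: nonneg_part_add)
qed (auto intro!: laurent_fps_eqI simp: xcoeff_nonneg_part)

lemma nonneg_part_lift_mult: "nonneg_part (fps_lift c * f) = fps_lift c * nonneg_part f"
  by (rule laurent_fps_eqI) (simp add: xcoeff_nonneg_part xcoeff_lift_mult)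

text \<open>The derivative with respect to \<open>x\<close> commutes because it annihilates \<open>x\<^sup>0\<close>.\<close>

lemma nonneg_part_deriv:
  assumes "\<delta> \<in> {fps_deriv, x_deriv}"
  shows "nonneg_part (\<delta> f) = \<delta> (nonneg_part f)"
proof (rule laurent_fps_eqI)
  fix k :: int
  have "k = - 1 \<or> (0 \<le> k + 1) = (0 \<le> k)" by linarith
  then show "xcoeff k (nonneg_part (\<delta> f)) = xcoeff k (\<delta> (nonneg_part f))"
    using assms by (auto simp: xcoeff_nonneg_part xcoeff_fps_deriv xcoeff_x_deriv)
qed

text \<open>Only exponents that cross 0 under the shift by \<open>v\<close> contribute. The
  symmetric range covers both signs of \<open>v\<close>, and the difference of truth values is 0 at
  the exponents that do not cross.\<close>

lemma nonneg_part_x_monom_mult: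
  "x_monom v * nonneg_part f - nonneg_part (x_monom v * f) =
    (\<Sum>k\<in>{-\<bar>v\<bar>..\<bar>v\<bar>}. x_monom (k + v) *
      fps_lift (fps_const (of_bool (0 \<le> k) - of_bool (0 \<le> k + v)) * xcoeff k f))" (is "?L = ?R")
proof (rule laurent_fps_eqI)
  fix m
  have "xcoeff m ?R = (\<Sum>k\<in>{-\<bar>v\<bar>..\<bar>v\<bar>}. if k = m - v then
      fps_const (of_bool (0 \<le> m - v) - of_bool (0 \<le> m)) * xcoeff (m - v) f else 0)"
    unfolding xcoeff_sum by (intro sum.cong) (auto simp: xcoeff_x_monom_mult xcoeff_lift)
  also have "\<dots> = fps_const (of_bool (0 \<le> m - v) - of_bool (0 \<le> m)) * xcoeff (m - v) f"
    by auto
  also have "\<dots> = xcoeff m ?L"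
    by (auto simp: xcoeff_diff xcoeff_x_monom_mult xcoeff_nonneg_part fps_eq_iff)
  finally show "xcoeff m ?L = xcoeff m ?R" ..
qed

lemma xcoeff_x_monom: "xcoeff m (x_monom v) = (if v = m then 1 else 0)"
  using xcoeff_x_monom_mult[of m v "1 :: 'a::comm_ring_1 laurent fps"] by (auto simp: xcoeff_1)

lemma x_monom_eq_poly: "x_monom v = fps_of_poly [:Poly_Mapping.single v 1:]"
  by (simp add: x_monom_def fps_of_poly_const)

text \<open>The set of exponents depends on \<open>p\<close> alone, because the exponents of
  \<open>x\<close> in \<open>p\<close> are bounded. This uniformity lets \<open>H\<close> be
  constructed afterwards from the coefficients it asks for.\<close>

lemma nonneg_part_commutator:
  obtains K where "finite K"
    "\<And>f H. (\<And>k. k \<in> K \<Longrightarrow> fps_lift (xcoeff k f) \<in> rat_span H) \<Longrightarrow>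
      fps_of_poly p * nonneg_part f - nonneg_part (fps_of_poly p * f) \<in> rat_span (H :: real laurent fps set)"
proof -
  obtain d where d: "box d (fps_of_poly p)" using box_poly by blast
  let ?V = "{- int d..int d}"
  have p: "fps_of_poly p = (\<Sum>v\<in>?V. fps_lift (xcoeff v (fps_of_poly p)) * x_monom v)"
  proof (rule laurent_fps_eqI)
    fix m
    have "xcoeff m (\<Sum>v\<in>?V. fps_lift (xcoeff v (fps_of_poly p)) * x_monom v) =
        (\<Sum>v\<in>?V. if v = m then xcoeff m (fps_of_poly p) else 0)"
      unfolding xcoeff_sum xcoeff_lift_mult
      by (intro sum.cong) (auto simp: xcoeff_x_monom)
    also have "\<dots> = xcoeff m (fps_of_poly p)"
      using d by (auto simp: box_def supp_in_iff)
    finally show "xcoeff m (fps_of_poly p) = xcoeff m (\<Sum>v\<in>?V. fps_lift (xcoeff v (fps_of_poly p)) * x_monom v)" ..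
  qed
  have cpoly: "\<exists>r. fps_lift (xcoeff v (fps_of_poly p)) = fps_of_poly r" for v
  proof -
    have "xcoeff v (fps_of_poly p) = fps_of_poly (map_poly (\<lambda>c. Poly_Mapping.lookup c v) p)"
      by (simp add: fps_eq_iff coeff_map_poly)
    then show ?thesis using fps_lift_poly by metis
  qed
  show thesis
  proof (rule that[of "\<Union>v\<in>?V. {-\<bar>v\<bar>..\<bar>v\<bar>}"])
    fix f :: "real laurent fps" and H assume H: "\<And>k. k \<in> (\<Union>v\<in>?V. {-\<bar>v\<bar>..\<bar>v\<bar>}) \<Longrightarrow> fps_lift (xcoeff k f) \<in> rat_span H"
    let ?c = "\<lambda>v. fps_lift (xcoeff v (fps_of_poly p))"
    have "fps_of_poly p * nonneg_part f - nonneg_part (fps_of_poly p * f) =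
        (\<Sum>v\<in>?V. ?c v * (x_monom v * nonneg_part f - nonneg_part (x_monom v * f)))"
      by (subst (1 2) p)
         (simp add: sum_distrib_right nonneg_part_sum mult.assoc nonneg_part_lift_mult right_diff_distrib sum_subtractf)
    also have "\<dots> \<in> rat_span H"
    proof (rule rat_span_sum)
      fix v assume v: "v \<in> ?V"
      obtain r where r: "?c v = fps_of_poly r" using cpoly by blast
      have "x_monom v * nonneg_part f - nonneg_part (x_monom v * f) \<in> rat_span H"
        unfolding nonneg_part_x_monom_mult
      proof (rule rat_span_sum)
        fix k assume k: "k \<in> {-\<bar>v\<bar>..\<bar>v\<bar>}"
        define b :: real where "b = of_bool (0 \<le> k) - of_bool (0 \<le> k + v)"
        have b: "fps_lift (fps_const b) = fps_of_poly [:laurent_const b:]"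
          by (simp add: fps_eq_iff fps_of_poly_const)
        have "fps_lift (xcoeff k f) \<in> rat_span H" using H k v by blast
        then show "x_monom (k + v) * fps_lift (fps_const (of_bool (0 \<le> k) - of_bool (0 \<le> k + v)) * xcoeff k f) \<in> rat_span H"
          unfolding b_def[symmetric] fps_lift_mult b x_monom_eq_poly by (intro rat_span_poly_mult)
      qed
      then show "?c v * (x_monom v * nonneg_part f - nonneg_part (x_monom v * f)) \<in> rat_span H"
        unfolding r by (rule rat_span_poly_mult)
    qed
    finally show "fps_of_poly p * nonneg_part f - nonneg_part (fps_of_poly p * f) \<in> rat_span H" .
  qed simp
qed

text \<open>The nonnegative part of the cleared relation for \<open>\<delta> e\<close> is the same
  relation between nonnegative parts, up to commutators. Quantifying \<open>H\<close> after
  \<open>K\<close> avoids a circular construction.\<close>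

lemma nonneg_part_derivative_in_span:
  assumes "finite G" "\<delta> \<in> {fps_deriv, x_deriv}" "\<delta> e \<in> rat_span G"
  shows "\<exists>K. finite K \<and> (\<forall>H. nonneg_part ` G \<subseteq> H \<longrightarrow>
    (\<forall>k\<in>K. \<forall>h\<in>insert (\<delta> e) G. fps_lift (xcoeff k h) \<in> rat_span H) \<longrightarrow>
    \<delta> (nonneg_part e) \<in> rat_span H)"
proof -
  obtain q p where q: "q \<noteq> 0" "fps_of_poly q * \<delta> e = (\<Sum>h\<in>G. fps_of_poly (p h) * h)"
    using assms(3,1) by (rule rat_spanE)
  have "\<forall>r. \<exists>K. finite K \<and> (\<forall>f H. (\<forall>k\<in>K. fps_lift (xcoeff k f) \<in> rat_span H) \<longrightarrow>
      fps_of_poly r * nonneg_part f - nonneg_part (fps_of_poly r * f) \<in> rat_span (H :: real laurent fps set))"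
    using nonneg_part_commutator by metis
  from choice[OF this] obtain K where
    K: "\<And>r. finite (K r)" "\<And>r f H. (\<forall>k\<in>K r. fps_lift (xcoeff k f) \<in> rat_span H) \<Longrightarrow>
      fps_of_poly r * nonneg_part f - nonneg_part (fps_of_poly r * f) \<in> rat_span (H :: real laurent fps set)"
    by blast
  show ?thesis
  proof (intro exI[of _ "K q \<union> (\<Union>h\<in>G. K (p h))"] conjI allI impI)
    show "finite (K q \<union> (\<Union>h\<in>G. K (p h)))" using K(1) assms(1) by simp
    fix H assume H: "nonneg_part ` G \<subseteq> H"
      "\<forall>k\<in>K q \<union> (\<Union>h\<in>G. K (p h)). \<forall>h\<in>insert (\<delta> e) G. fps_lift (xcoeff k h) \<in> rat_span H"
    have 1: "fps_of_poly q * nonneg_part (\<delta> e) - nonneg_part (fps_of_poly q * \<delta> e) \<in> rat_span H"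
      by (rule K(2)) (use H(2) in blast)
    have 2: "fps_of_poly (p h) * nonneg_part h - (fps_of_poly (p h) * nonneg_part h - nonneg_part (fps_of_poly (p h) * h)) \<in> rat_span H"
      if h: "h \<in> G" for h
    proof (rule rat_span_diff)
      show "fps_of_poly (p h) * nonneg_part h \<in> rat_span H"
        by (intro rat_span_poly_mult rat_span_base) (use H(1) h in blast)
      show "fps_of_poly (p h) * nonneg_part h - nonneg_part (fps_of_poly (p h) * h) \<in> rat_span H"
        by (rule K(2)) (use H(2) h in blast)
    qed
    have "nonneg_part (fps_of_poly q * \<delta> e) \<in> rat_span H"
      unfolding q(2) nonneg_part_sum by (rule rat_span_sum) (use 2 in simp)
    from rat_span_add[OF 1 this] have "fps_of_poly q * \<delta> (nonneg_part e) \<in> rat_span H"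
      by (simp add: nonneg_part_deriv[OF assms(2)])
    then show "\<delta> (nonneg_part e) \<in> rat_span H"
      by (rule rat_span_saturated[OF q(1)])
  qed
qed

text \<open>The closed set consists of the nonnegative parts of \<open>G\<close> and the lifted
  differential systems of the finitely many coefficients that occur in commutators.\<close>

lemma nonneg_part_finite_rank:
  assumes G: "deriv_closed {fps_deriv, x_deriv} G" and e: "e \<in> G"
  shows "finite_rank {fps_deriv, x_deriv} (nonneg_part e)"
proof -
  let ?\<Delta> = "{fps_deriv, x_deriv}"
  have fin: "finite G" using G by (simp add: deriv_closed_def)
  have "\<forall>a\<in>?\<Delta> \<times> G. \<exists>K. finite K \<and> (\<forall>H. nonneg_part ` G \<subseteq> H \<longrightarrow>
      (\<forall>k\<in>K. \<forall>h\<in>insert ((fst a) (snd a)) G. fps_lift (xcoeff k h) \<in> rat_span H) \<longrightarrow>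
      (fst a) (nonneg_part (snd a)) \<in> rat_span H)"
  proof
    fix a assume a: "a \<in> ?\<Delta> \<times> G"
    then have "fst a \<in> ?\<Delta>" "fst a (snd a) \<in> rat_span G"
      using G by (auto simp: deriv_closed_def)
    then show "\<exists>K. finite K \<and> (\<forall>H. nonneg_part ` G \<subseteq> H \<longrightarrow>
        (\<forall>k\<in>K. \<forall>h\<in>insert ((fst a) (snd a)) G. fps_lift (xcoeff k h) \<in> rat_span H) \<longrightarrow>
        (fst a) (nonneg_part (snd a)) \<in> rat_span H)"
      by (rule nonneg_part_derivative_in_span[OF fin])
  qed
  from bchoice[OF this] obtain K where K': "\<forall>a\<in>?\<Delta> \<times> G. finite (K a) \<and> (\<forall>H. nonneg_part ` G \<subseteq> H \<longrightarrow>
      (\<forall>k\<in>K a. \<forall>h\<in>insert ((fst a) (snd a)) G. fps_lift (xcoeff k h) \<in> rat_span H) \<longrightarrow>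
      (fst a) (nonneg_part (snd a)) \<in> rat_span H)" ..
  have K: "finite (K (\<delta>, h))"
    "nonneg_part ` G \<subseteq> H \<Longrightarrow>
      \<forall>k\<in>K (\<delta>, h). \<forall>g\<in>insert (\<delta> h) G. fps_lift (xcoeff k g) \<in> rat_span H \<Longrightarrow>
      \<delta> (nonneg_part h) \<in> rat_span H" if "\<delta> \<in> ?\<Delta>" "h \<in> G" for \<delta> h H
    using bspec[OF K' SigmaI[OF that]] by simp_all
  define K0 where "K0 = (\<Union>a\<in>?\<Delta> \<times> G. K a)"
  have finK0: "finite K0" unfolding K0_def using K(1) fin by (intro finite_UN_I) auto
  \<comment> \<open>Coefficient \<open>k\<close> of an \<open>x\<close>-derivative involves
    coefficient \<open>k + 1\<close> of the series.\<close>
  define K1 where "K1 = K0 \<union> (\<lambda>k. k + 1) ` K0"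
  have "\<forall>a\<in>K1 \<times> G. \<exists>T. deriv_closed {fps_deriv} T \<and> xcoeff (fst a) (snd a) \<in> rat_span T"
    using xcoeff_finite_rank[OF G] unfolding finite_rank_def by auto
  from bchoice[OF this] obtain T where
    T': "\<forall>a\<in>K1 \<times> G. deriv_closed {fps_deriv} (T a) \<and> xcoeff (fst a) (snd a) \<in> rat_span (T a)" ..
  have T: "deriv_closed {fps_deriv} (T (k, h)) \<and> xcoeff k h \<in> rat_span (T (k, h))" if "k \<in> K1" "h \<in> G" for k h
    using bspec[OF T' SigmaI[OF that]] by simp
  define U where "U = (\<Union>a\<in>K1 \<times> G. T a)"
  have U: "deriv_closed {fps_deriv} U"
    unfolding deriv_closed_def
  proof (intro conjI ballI)
    show "finite U"
      unfolding U_def using T fin finK0 by (auto simp: K1_def deriv_closed_def)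
    fix \<delta> u assume "\<delta> \<in> {fps_deriv :: real fps \<Rightarrow> _}" "u \<in> U"
    then obtain k h where kh: "k \<in> K1" "h \<in> G" "u \<in> T (k, h)" "\<delta> = fps_deriv" by (auto simp: U_def)
    then have "\<delta> u \<in> rat_span (T (k, h))" using T by (auto simp: deriv_closed_def)
    moreover have "T (k, h) \<subseteq> U" using kh by (auto simp: U_def)
    ultimately show "\<delta> u \<in> rat_span U" using rat_span_mono by blast
  qed
  have coeffU: "xcoeff k h \<in> rat_span U" if "k \<in> K1" "h \<in> G" for k h
  proof -
    have "T (k, h) \<subseteq> U" using that by (auto simp: U_def)
    then show ?thesis using T[OF that] rat_span_mono by blast
  qed
  have finU: "finite U" using U by (simp add: deriv_closed_def)
  define H where "H = nonneg_part ` G \<union> fps_lift ` U"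
  have sub: "nonneg_part ` G \<subseteq> H" "rat_span (fps_lift ` U) \<subseteq> rat_span H"
    by (auto simp: H_def intro: rat_span_mono[THEN subsetD])
  have liftH: "fps_lift u \<in> rat_span H" if "u \<in> rat_span U" for u
    using rat_span_lift[OF that finU] sub by blast
  have "deriv_closed ?\<Delta> H"
    unfolding deriv_closed_def
  proof (intro conjI ballI)
    show "finite H" using fin finU by (simp add: H_def)
    fix \<delta> u assume \<delta>: "\<delta> \<in> ?\<Delta>" and "u \<in> H"
    then consider h where "h \<in> G" "u = nonneg_part h" | "u \<in> fps_lift ` U" by (auto simp: H_def)
    then show "\<delta> u \<in> rat_span H"
    proof cases
      case 1
      have *: "fps_lift (xcoeff k g) \<in> rat_span H" if "k \<in> K (\<delta>, h)" "g \<in> insert (\<delta> h) G" for k g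
      proof -
        have "k \<in> K0" unfolding K0_def using that(1) \<delta> 1(1) by blast
        then have k: "k \<in> K1" "k + 1 \<in> K1" by (simp_all add: K1_def)
        show ?thesis
        proof (cases "g \<in> G")
          case True
          then show ?thesis using coeffU k liftH by blast
        next
          case False
          then have "g = \<delta> h" using that by simp
          show ?thesis
          proof (cases "\<delta> = fps_deriv")
            case True
            then have "xcoeff k g = fps_deriv (xcoeff k h)" by (simp add: \<open>g = \<delta> h\<close> xcoeff_fps_deriv)
            moreover have "fps_deriv (xcoeff k h) \<in> rat_span U"
              by (rule rat_span_derivation[OF ratfun_derivation_fps_deriv finU _ coeffU[OF k(1) 1(1)]])
                 (use U in \<open>simp add: deriv_closed_def\<close>)
            ultimately show ?thesis using liftH by simp
          next
            case False
            then have "xcoeff k g = fps_of_poly [:of_int (k + 1):] * xcoeff (k + 1) h"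
              using \<delta> by (simp add: \<open>g = \<delta> h\<close> xcoeff_x_deriv fps_of_poly_const)
            then show ?thesis
              using liftH rat_span_poly_mult[OF coeffU[OF k(2) 1(1)]] by simp
          qed
        qed
      qed
      have "\<delta> (nonneg_part h) \<in> rat_span H"
        using * by (intro K(2)[OF \<delta> 1(1) sub(1)] ballI)
      then show ?thesis using 1 by simp
    next
      case 2
      have "deriv_closed ?\<Delta> (fps_lift ` U)"
        by (rule deriv_closed_lift[OF U lift_commutes_t_xt])
      then show ?thesis using 2 \<delta> sub by (auto simp: deriv_closed_def)
    qed
  qed
  moreover have "nonneg_part e \<in> rat_span H"
    by (rule rat_span_base) (use e in \<open>auto simp: H_def\<close>)
  ultimately show ?thesis
    unfolding finite_rank_def by blast
qed


subsection \<open>Logarithms of the generating functions\<close>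

text \<open>The differential equation characterizes the logarithm independently of the embedding of
  the reals, so products, lifts and uniqueness need no composition of series.\<close>

definition is_log :: "'a::comm_ring_1 fps \<Rightarrow> 'a fps \<Rightarrow> bool" where
  "is_log f l \<longleftrightarrow> fps_nth f 0 = 1 \<and> fps_nth l 0 = 0 \<and> f * fps_deriv l = fps_deriv f"

lemma is_log_unique:
  fixes f :: "'a::{idom,ring_char_0} fps"
  assumes "is_log f l" "is_log f m"
  shows "l = m"
  using assms log_derivative_unique[of f l m] by (auto simp: is_log_def)

lemma is_log_mult:
  assumes "is_log f l" "is_log g m"
  shows "is_log (f * g) (l + m)"
proof -
  have "f * g * fps_deriv (l + m) = g * (f * fps_deriv l) + f * (g * fps_deriv m)"
    by (simp add: algebra_simps)
  then show ?thesis
    using assms by (simp add: is_log_def mult.commute add.commute)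
qed

lemma is_log_1: "is_log 1 0"
  by (simp add: is_log_def)

lemma is_log_lift: "is_log f l \<Longrightarrow> is_log (fps_lift f) (fps_lift l)"
  by (simp add: is_log_def fps_lift_fps_deriv[symmetric] fps_lift_mult[symmetric])

lemma is_log_fps_log_id: "fps_nth f 0 = 1 \<Longrightarrow> is_log f (fps_log id f)"
  by (simp add: is_log_def fps_log_deriv fps_log_nth_0)

lemma is_log_fps_log_const:
  fixes f :: "real laurent fps"
  assumes "fps_nth f 0 = 1"
  shows "is_log f (fps_log laurent_const f)"
  using assms by (simp add: is_log_def fps_log_deriv fps_log_nth_0 laurent_const_add laurent_const_mult)

lemma is_log_fps_log_const_const:
  fixes f :: "real laurent laurent fps"
  assumes "fps_nth f 0 = 1"
  shows "is_log f (fps_log (laurent_const \<circ> laurent_const) f)"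
  using assms by (simp add: is_log_def fps_log_deriv fps_log_nth_0 laurent_const_add laurent_const_mult)

text \<open>The derivative of \<open>l\<close> is \<open>f' / f\<close>, which stays on the half
  line and has no constant term in \<open>x\<close>; \<open>l\<close> follows by integration from 0.
  Thus the factors can be told apart inside the logarithm of their product.\<close>

lemma is_log_supp:
  fixes f l :: "real laurent fps"
  assumes l: "is_log f l" and A: "A = {0..} \<or> A = {..0}" and f: "supp_in A f" "xcoeff 0 f = 1"
  shows "supp_in A l" "xcoeff 0 l = 0"
proof -
  have f0: "fps_nth f 0 = 1" using l by (simp add: is_log_def)
  have r: "supp_in A (fps_recip f)"
    by (rule supp_in_recip) (use f A in auto)
  have d: "supp_in A (fps_deriv f)"
    by (rule supp_in_fps_deriv[OF f(1)])
  have "fps_deriv l = (f * fps_recip f) * fps_deriv l"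
    by (simp add: fps_recip[OF f0])
  also have "\<dots> = fps_recip f * fps_deriv f"
    using l by (simp add: is_log_def mult_ac)
  finally have l': "fps_deriv l = fps_recip f * fps_deriv f" .
  have "supp_in A (fps_deriv l)"
    unfolding l' using A r d supp_in_nonneg_mult supp_in_nonpos_mult by blast
  moreover have "xcoeff 0 (fps_deriv l) = 0"
    unfolding l' by (subst xcoeff_0_mult) (use A r d f in \<open>auto simp: xcoeff_fps_deriv\<close>)
  moreover have "xcoeff k l = 0" if "xcoeff k (fps_deriv l) = 0" for k
  proof -
    have "fps_deriv (xcoeff k l) = 0" using that by (simp add: xcoeff_fps_deriv)
    moreover have "fps_nth (xcoeff k l) 0 = 0" using l by (simp add: is_log_def)
    ultimately show ?thesis by (metis fps_const_0_eq_0 fps_deriv_eq_0_iff)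
  qed
  ultimately show "supp_in A l" "xcoeff 0 l = 0"
    by (auto simp: supp_in_iff)
qed

section \<open>Logarithms of the bilateral series and of the kernel\<close>

lemma step_poly_bounded:
  obtains a :: nat where "supp_in {- int a..int a} (walk_kernel \<SS>)"
proof -
  let ?A = "Poly_Mapping.keys (step_poly \<SS>)"
  define a where "a = (\<Sum>k\<in>?A. nat \<bar>k\<bar>)"
  have "nat \<bar>k\<bar> \<le> a" if "k \<in> ?A" for k
    using member_le_sum[OF that, of "\<lambda>k. nat \<bar>k\<bar>"] by (simp add: a_def)
  then have A: "?A \<subseteq> {- int a..int a}" by force
  have "supp_in {- int a..int a} (fps_X * fps_const (step_poly \<SS>))"
    unfolding supp_in_def using A by auto
  then have "supp_in {- int a..int a} (walk_kernel \<SS>)"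
    unfolding walk_kernel_eq by (intro supp_in_diff supp_in_1) auto
  then show ?thesis using that by blast
qed

lemma walk_kernel_eq_poly: "walk_kernel \<SS> = fps_of_poly [:1, - step_poly \<SS>:]"
  by (simp add: walk_kernel_eq fps_of_poly_pCons)

text \<open>The derivatives of \<open>l\<close> lie in the finite field generated by
  \<open>k0\<close>, but \<open>l\<close> itself is not shown to, so it is adjoined as one further
  generator.\<close>

lemma log_bilateral_deriv_closed:
  assumes "finite \<SS>" and l: "is_log (xcoeff 0 (gf_xy (walks \<SS>))) l"
  obtains G where "deriv_closed {fps_deriv, x_deriv} G" "l \<in> G"
proof -
  define K where "K = walk_kernel \<SS>"
  define B where "B = xcoeff 0 (gf_xy (walks \<SS>))"
  obtain a where a: "supp_in {- int a..int a} K"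
    unfolding K_def by (rule step_poly_bounded)
  have K0: "fps_nth K 0 = 1" by (simp add: K_def walk_kernel_eq)
  obtain g h where gh: "K = g * h" "fps_nth g 0 = 1" "fps_nth h 0 = 1"
    "supp_in {- int a..0} g" "xcoeff 0 g = 1" "supp_in {0..int a} h"
    by (rule wiener_hopf[OF K0 a])
  have Kpoly: "\<exists>p. xcoeff k K = fps_of_poly p" for k
    unfolding K_def walk_kernel_eq_poly
    by (rule exI[of _ "map_poly (\<lambda>c. Poly_Mapping.lookup c k) [:1, - step_poly \<SS>:]"])
       (simp add: fps_eq_iff coeff_map_poly)
  define k0 where "k0 = xcoeff 0 h"
  obtain n p where "\<exists>i\<le>n. p i \<noteq> 0" "(\<Sum>i\<le>n. fps_of_poly (p i) * k0 ^ i) = 0"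
    unfolding k0_def by (rule constant_coeff_of_factor_algebraic[OF gh(1) K0 a Kpoly gh(4-6)])
  then obtain G where G: "finite G" "1 \<in> rat_span G" "k0 \<in> rat_span G"
    and mult: "\<And>u v. u \<in> G \<Longrightarrow> v \<in> G \<Longrightarrow> u * v \<in> rat_span G"
    and deriv: "\<And>\<delta> u. ratfun_derivation \<delta> \<Longrightarrow> u \<in> G \<Longrightarrow> \<delta> u \<in> rat_span G"
    by (rule algebraic_generates_finite_ring) (rule that)
  have deriv': "\<delta> u \<in> rat_span G" if "ratfun_derivation \<delta>" "u \<in> rat_span G" for \<delta> u
    using rat_span_derivation[OF that(1) G(1) deriv[OF that(1)] that(2)] .
  have div: "f \<in> rat_span G" if "h \<in> rat_span G" "h \<noteq> 0" "h * f \<in> rat_span G" for f h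
    by (rule rat_span_exact_division[OF G(1,2) mult that])
  have "k0 * B = k0 - fps_X * fps_deriv k0"
    unfolding k0_def B_def
  proof (rule bilateral_eq_log_derivative[OF _ _ gh(1,2) _ gh(5,3)])
    show "gf_xy (walks \<SS>) * K = 1" unfolding K_def by (rule gf_walks_mult_kernel[OF assms(1)])
    show "K - fps_X * fps_deriv K = 1" by (simp add: K_def walk_kernel_eq)
    show "supp_in {..0} g" by (rule supp_in_mono[OF gh(4)]) auto
    show "supp_in {0..} h" by (rule supp_in_mono[OF gh(6)]) auto
  qed
  moreover have "fps_X * fps_deriv k0 \<in> rat_span G"
    using rat_span_poly_mult[OF deriv'[OF ratfun_derivation_fps_deriv G(3)], of "[:0, 1:]"] by simp
  ultimately have k0B: "k0 * B \<in> rat_span G"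
    using G(3) by (simp add: rat_span_diff)
  have "fps_nth k0 0 = 1" using gh(3) by (simp add: k0_def)
  then have "k0 \<noteq> 0" by auto
  have B: "B \<in> rat_span G"
    by (rule div[OF G(3) \<open>k0 \<noteq> 0\<close> k0B])
  have B0: "fps_nth B 0 = 1" and l0: "fps_nth l 0 = 0" and ode: "B * fps_deriv l = fps_deriv B"
    using l by (simp_all add: is_log_def B_def)
  then have "B \<noteq> 0" by auto
  have dl: "\<delta> l \<in> rat_span G" if "\<delta> \<in> {fps_deriv, x_deriv}" for \<delta>
  proof (rule div[OF B \<open>B \<noteq> 0\<close>])
    have "B * \<delta> l = \<delta> B"
      using that ode log_partial_derivative[OF derivation_laurent_deriv B0 l0 ode] by auto
    moreover have "ratfun_derivation \<delta>"
      using that ratfun_derivation_fps_deriv ratfun_derivation_fps_map[OF derivation_laurent_deriv] by auto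
    ultimately show "B * \<delta> l \<in> rat_span G" using deriv'[OF _ B] by simp
  qed
  have "deriv_closed {fps_deriv, x_deriv} (insert l G)"
    unfolding deriv_closed_def
  proof (intro conjI ballI)
    fix \<delta> u assume \<delta>: "\<delta> \<in> {fps_deriv, x_deriv}" and u: "u \<in> insert l G"
    have "ratfun_derivation \<delta>"
      using \<delta> ratfun_derivation_fps_deriv ratfun_derivation_fps_map[OF derivation_laurent_deriv] by auto
    then have "\<delta> u \<in> rat_span G" using u dl[OF \<delta>] deriv by auto
    then show "\<delta> u \<in> rat_span (insert l G)" using rat_span_mono[of G "insert l G"] by auto
  qed (simp add: G)
  then show ?thesis using that by blast
qed

lemma ratfun_derivation_xyt:
  "\<forall>\<delta>\<in>{fps_deriv, fps_map laurent_deriv, fps_map (Poly_Mapping.map laurent_deriv)}.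
    ratfun_derivation (\<delta> :: real laurent laurent fps \<Rightarrow> _)"
  by (auto intro: ratfun_derivation_fps_deriv ratfun_derivation_fps_map derivation_laurent_deriv derivation_map)

text \<open>The kernel is a polynomial in \<open>t\<close> over Laurent polynomials, so its
  logarithmic derivatives are rational functions.\<close>

lemma log_kernel_finite_rank:
  assumes "is_log (walk_kernel \<SS>) l"
  shows "finite_rank {fps_deriv, fps_map laurent_deriv, fps_map (Poly_Mapping.map laurent_deriv)} l"
proof (rule finite_rank_if_rational_derivatives[OF ratfun_derivation_xyt])
  fix \<delta> :: "real laurent laurent fps \<Rightarrow> _"
  assume \<delta>: "\<delta> \<in> {fps_deriv, fps_map laurent_deriv, fps_map (Poly_Mapping.map laurent_deriv)}"
  let ?q = "[:1, - step_poly \<SS>:]"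
  have l: "fps_nth (walk_kernel \<SS>) 0 = 1" "fps_nth l 0 = 0"
    "walk_kernel \<SS> * fps_deriv l = fps_deriv (walk_kernel \<SS>)"
    using assms by (simp_all add: is_log_def)
  have "walk_kernel \<SS> * \<delta> l = \<delta> (walk_kernel \<SS>)"
    using \<delta> l(3) log_partial_derivative[OF derivation_laurent_deriv l]
      log_partial_derivative[OF derivation_map[OF derivation_laurent_deriv] l] by auto
  then have "fps_of_poly ?q * \<delta> l = \<delta> (fps_of_poly ?q)"
    by (simp only: walk_kernel_eq_poly)
  moreover obtain r where "\<delta> (fps_of_poly ?q) = fps_of_poly r"
    using bspec[OF ratfun_derivation_xyt \<delta>] unfolding ratfun_derivation_def by blast
  ultimately have "fps_of_poly ?q * \<delta> l = fps_of_poly r * 1" by simp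
  also have "\<dots> \<in> rat_span {1}"
    by (intro rat_span_poly_mult rat_span_base) simp
  finally show "\<delta> l \<in> rat_span {1}"
    by (rule rat_span_saturated[rotated]) simp
qed

lemma lift_commutes_xt_xyt:
  assumes "\<delta> \<in> {fps_deriv, fps_map laurent_deriv, fps_map (Poly_Mapping.map laurent_deriv)}"
  shows "(\<forall>g. \<delta> (fps_lift g) = 0) \<or> (\<exists>\<epsilon>\<in>{fps_deriv, x_deriv}. \<forall>g. \<delta> (fps_lift g) = fps_lift (\<epsilon> g))"
  using assms
  by (auto simp: fps_lift_fps_deriv fps_map_laurent_deriv_lift fps_map_map_lift
      derivation_0[OF derivation_laurent_deriv])

theorem theorem5p2:
  fixes \<SS> :: "(int \<times> int) set"
    and B0 :: "real fps" and Bp Bm :: "real laurent fps"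
  assumes "finite \<SS>"
    and "canonical_factorization (gf_x (bilateral_walks \<SS>)) B0 Bp Bm"
  shows "gf_t (loops \<SS>) = B0 \<and>
    gf_x (bilateral_slit_walks \<SS>) = Bp \<and>
    gf_xy (slit_walks \<SS>) * (walk_kernel \<SS> * fps_lift (fps_lift B0) * fps_lift Bm) = 1 \<and>
    D_finite_t (fps_log id (gf_t (loops \<SS>))) \<and>
    D_finite_xt (fps_log laurent_const (gf_x (bilateral_slit_walks \<SS>))) \<and>
    D_finite_xyt (fps_log (laurent_const \<circ> laurent_const) (gf_xy (slit_walks \<SS>)))"
proof -
  note eqs = slit_plane_factorization[OF assms]
  define B where "B = xcoeff 0 (gf_xy (walks \<SS>))"
  define S where "S = gf_xy (slit_walks \<SS>)"
  have B: "B = fps_lift B0 * Bp * Bm"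
    and Bp: "supp_in {0..} Bp" "fps_nth Bp 0 = 1" "xcoeff 0 Bp = 1"
    and Bm: "supp_in {..0} Bm" "fps_nth Bm 0 = 1" "xcoeff 0 Bm = 1"
    and B0: "fps_nth B0 0 = 1"
    using assms(2) unfolding canonical_factorization_def gf_bilateral[OF assms(1)] B_def
    by (simp_all add: supp_in_def xcoeff_def)
  define l0 where "l0 = fps_log id B0"
  define lp where "lp = fps_log laurent_const Bp"
  define lm where "lm = fps_log laurent_const Bm"
  define lk where "lk = fps_log (laurent_const \<circ> laurent_const) (walk_kernel \<SS>)"
  define ls where "ls = fps_log (laurent_const \<circ> laurent_const) S"
  define l where "l = fps_lift l0 + lp + lm"
  have l0: "is_log B0 l0" unfolding l0_def by (rule is_log_fps_log_id[OF B0])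
  have lp: "is_log Bp lp" unfolding lp_def by (rule is_log_fps_log_const[OF Bp(2)])
  have lm: "is_log Bm lm" unfolding lm_def by (rule is_log_fps_log_const[OF Bm(2)])
  have lk: "is_log (walk_kernel \<SS>) lk"
    unfolding lk_def by (rule is_log_fps_log_const_const) (simp add: walk_kernel_eq)
  have l: "is_log B l"
    unfolding B l_def by (intro is_log_mult is_log_lift l0 lp lm)
  have suppp: "supp_in {0..} lp" "xcoeff 0 lp = 0"
    using is_log_supp[OF lp _ Bp(1,3)] by auto
  have suppm: "supp_in {..0} lm" "xcoeff 0 lm = 0"
    using is_log_supp[OF lm _ Bm(1,3)] by auto
  have x0: "xcoeff 0 l = l0"
    by (simp add: l_def xcoeff_add xcoeff_lift suppp suppm)
  \<comment> \<open>Exponent 0 carries only the logarithm of \<open>B0\<close>, which therefore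
    appears in the nonnegative part together with that of \<open>Bp\<close>.\<close>
  have nn: "nonneg_part l = fps_lift l0 + lp"
  proof (rule laurent_fps_eqI)
    fix k
    have "xcoeff k lm = 0" if "k \<ge> 0"
      using that suppm by (cases "k = 0") (auto simp: supp_in_iff)
    moreover have "xcoeff k lp = 0" if "k < 0"
      using that suppp by (auto simp: supp_in_iff)
    ultimately show "xcoeff k (nonneg_part l) = xcoeff k (fps_lift l0 + lp)"
      by (auto simp: xcoeff_nonneg_part l_def xcoeff_add xcoeff_lift)
  qed
  obtain G where G: "deriv_closed {fps_deriv, x_deriv} G" "l \<in> G"
    using log_bilateral_deriv_closed[OF assms(1) l[unfolded B_def]] .
  have fr0: "finite_rank {fps_deriv} l0"
    using xcoeff_finite_rank[OF G, of 0] by (simp add: x0)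
  have frl: "finite_rank {fps_deriv, x_deriv} l"
    unfolding finite_rank_def using G rat_span_base by blast
  have frn: "finite_rank {fps_deriv, x_deriv} (nonneg_part l)"
    by (rule nonneg_part_finite_rank[OF G])
  have fr0': "finite_rank {fps_deriv, x_deriv} (fps_lift l0)"
    by (rule finite_rank_lift[OF fr0 lift_commutes_t_xt])
  have frp: "finite_rank {fps_deriv, x_deriv} lp"
    using finite_rank_diff[OF frn fr0'] by (simp add: nn)
  \<comment> \<open>No second extraction for the nonpositive factor: its logarithm is what the
    nonnegative part leaves over.\<close>
  have frm: "finite_rank {fps_deriv, x_deriv} lm"
    using finite_rank_diff[OF frl frn] unfolding nn by (simp add: l_def)

  have S0: "fps_nth S 0 = 1"
    using arg_cong[OF eqs(3), of "\<lambda>f. fps_nth f 0"] B0 Bm(2) by (simp add: S_def walk_kernel_eq)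
  have ls: "is_log S ls" unfolding ls_def by (rule is_log_fps_log_const_const[OF S0])
  \<comment> \<open>The product formula says that the logarithms of its factors add up to the
    logarithm of 1, which is 0 by uniqueness.\<close>
  have "is_log (S * (walk_kernel \<SS> * fps_lift (fps_lift B0) * fps_lift Bm))
      (ls + (lk + fps_lift (fps_lift l0) + fps_lift lm))"
    by (intro is_log_mult is_log_lift ls lk l0 lm)
  then have "ls + (lk + fps_lift (fps_lift l0) + fps_lift lm) = 0"
    using eqs(3) is_log_1 is_log_unique unfolding S_def by metis
  then have ls_eq: "ls = - lk - fps_lift (fps_lift l0) - fps_lift lm"
    by (simp add: algebra_simps eq_neg_iff_add_eq_0)
  have frs: "finite_rank {fps_deriv, fps_map laurent_deriv, fps_map (Poly_Mapping.map laurent_deriv)} ls"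
    unfolding ls_eq
    by (intro finite_rank_diff finite_rank_uminus log_kernel_finite_rank[OF lk]
        finite_rank_lift[OF fr0' lift_commutes_xt_xyt] finite_rank_lift[OF frm lift_commutes_xt_xyt])

  have "D_finite_t l0"
    unfolding D_finite_t_def by (rule D_finite_if_finite_rank[OF _ fr0]) (simp add: ratfun_derivation_fps_deriv)
  moreover have "D_finite_xt lp"
    unfolding D_finite_xt_def
    by (rule D_finite_if_finite_rank[OF _ frp])
       (simp add: ratfun_derivation_fps_deriv ratfun_derivation_fps_map[OF derivation_laurent_deriv])
  moreover have "D_finite_xyt ls"
    unfolding D_finite_xyt_def by (rule D_finite_if_finite_rank[OF ratfun_derivation_xyt frs])
  ultimately show ?thesis
    using eqs unfolding l0_def lp_def ls_def S_def by simp
qed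

end
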